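(* Let $\mu,\lambda\in A_2$ and let $d\tau$ be a nonnegative measure on $\mathbb{D}$. Then the following are equivalent: (i) there is $B<\infty$ such that for all $f\in L^2(\mathbb{T},\mu\,dm)$, $\int_{\mathbb{D}}|f|^2\lambda\,d\tau\le B\int_{\mathbb{T}}|f|^2\mu\,dm$; (ii) there is $C<\infty$ such that $\sup_{z\in\mathbb{D}}\frac{1}{\mu(z)}\|P_z\|_{L^1(\lambda\,d\tau)}<C$; (iii) there is a constant $D$ such that $\frac{1}{\mu(I_S)}(\lambda\,d\tau)(S)<D$ for all sectors $S=\{re^{i\theta}:1-h\le r<1,\ |\theta-\theta_0|\le h\}$, where $I_S$ is the arc of length $h$ centered at $e^{i\theta_0}$ and $\mu(I_S)=\int_{I_S}\mu\,dm$.
   Context: $\mathbb{T}$ is the unit circle, $\mathbb{D}$ the unit disc, $dm$ normalized arc length measure. A weight $w\ge0$ is in $A_2$ if $\sup_{I}\big(\frac{1}{|I|}\int_I w\,dm\big)\big(\frac{1}{|I|}\int_I w^{-1}dm\big)<\infty$ over subarcs $I\subset\mathbb{T}$. $P_z(\zeta)=\frac{1-|z|^2}{|1-\bar z\zeta|^2}$ is the Poisson kernel; functions on $\mathbb{T}$ (such as $f$, $\mu$, $\lambda$) are evaluated at points $z\in\mathbb{D}$ via their Poisson (harmonic) extension $u(z)=\int_{\mathbb{T}}uP_z\,dm$; $\lambda\,d\tau$ denotes the measure on $\mathbb{D}$ with density $\lambda(z)$ (Poisson extension) with respect to $\tau$. A measure satisfying these conditions is called $\lambda$-$\mu$ Carleson.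 *)

theory Defs
  imports "HOL-Analysis.Analysis"
begin

definition circle_measure :: "complex measure" where
  "circle_measure =
     distr (density lborel (\<lambda>t::real. ennreal (indicator {0..2*pi} t / (2*pi)))) borel cis"

definition arc :: "real \<Rightarrow> real \<Rightarrow> complex set" where
  "arc a b = cis ` {a..b}"

text \<open>Muckenhoupt A_2 weights on T (with the ennreal convention 1/0 = \<infinity>).\<close>
definition A2 :: "(complex \<Rightarrow> real) \<Rightarrow> bool" where
  "A2 w \<longleftrightarrow> w \<in> borel_measurable borel \<and> (\<forall>\<zeta>\<in>sphere 0 1. 0 \<le> w \<zeta>) \<and>
     (\<exists>K::real. \<forall>a b. a < b \<and> b \<le> a + 2*pi \<longrightarrow>
        ((\<integral>\<^sup>+\<zeta>\<in>arc a b. ennreal (w \<zeta>) \<partial>circle_measure) / emeasure circle_measure (arc a b)) *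
        ((\<integral>\<^sup>+\<zeta>\<in>arc a b. inverse (ennreal (w \<zeta>)) \<partial>circle_measure) / emeasure circle_measure (arc a b))
          \<le> ennreal K)"

definition poisson :: "complex \<Rightarrow> complex \<Rightarrow> real" where
  "poisson z \<zeta> = (1 - (cmod z)^2) / (cmod (1 - cnj z * \<zeta>))^2"

definition pext :: "(complex \<Rightarrow> real) \<Rightarrow> complex \<Rightarrow> ennreal" where
  "pext w z = (\<integral>\<^sup>+\<zeta>. ennreal (w \<zeta> * poisson z \<zeta>) \<partial>circle_measure)"

definition cpext :: "(complex \<Rightarrow> complex) \<Rightarrow> complex \<Rightarrow> complex" where
  "cpext f z = (\<integral>\<zeta>. f \<zeta> * complex_of_real (poisson z \<zeta>) \<partial>circle_measure)"

definition sector :: "real \<Rightarrow> real \<Rightarrow> complex set" where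
  "sector \<theta>0 h = {complex_of_real r * cis \<theta> | r \<theta>. 1 - h \<le> r \<and> r < 1 \<and> \<bar>\<theta> - \<theta>0\<bar> \<le> h}"

definition sector_arc :: "real \<Rightarrow> real \<Rightarrow> complex set" where
  "sector_arc \<theta>0 h = arc (\<theta>0 - h/2) (\<theta>0 + h/2)"

end

theory Submission
  imports Defs
begin

text \<open>
  Write \<open>M = \<mu> dm\<close>, \<open>S = \<mu>\<^sup>-\<^sup>1 dm\<close> and \<open>\<nu> = \<lambda> d\<tau>\<close>. The testing conditions are compared
  through discs centred on the circle: the \<open>A\<^sub>2\<close> condition makes \<open>M\<close> and \<open>S\<close> doubling, and reverse
  doubling of \<open>S\<close> makes the Poisson average of \<open>\<mu>\<close> comparable to its average over the arc below.
  For the embedding, the Poisson kernel is dominated by a sum over dyadic arcs, which reduces the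
  claim to \<open>\<Sum> b\<^sub>J \<langle>f\<rangle>\<^sub>J\<^sup>2 \<le> C \<integral> f\<^sup>2 dM\<close> for coefficients \<open>b\<close> that are Carleson with respect to \<open>M\<close>.
  This follows from two applications of one embedding on the dyadic tree: the first one with
  \<open>f = 1\<close> shows that \<open>b\<^sub>J \<langle>S\<rangle>\<^sub>J\<^sup>2\<close> is Carleson with respect to \<open>S\<close>, and then the embedding
  relative to \<open>S\<close> applies.
\<close>

section \<open>Carleson embedding on the dyadic tree\<close>

text \<open>The sector condition is the hub: the embedding and the Poisson test each imply it by
  explicit test objects (for every sector the indicator of one arc, respectively one kernel), and it
  leads back to both through its disc form. Discs centred on the circle serve because one such set
  measures both the weight on the boundary and the measure inside. The weight enters only through
  two inequalities, \<open>m(E)^2 <= M(E) S(E)\<close> on Borel sets and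
  \<open>M(I) S(I) <= K m(I)^2\<close> on arcs, which are symmetric in \<open>M\<close> and
  \<open>S\<close>. The dual measure is forced on the embedding: for \<open>f\<close> in the
  weighted \<open>L^2\<close> space, Cauchy-Schwarz bounds the integral of \<open>|f|\<close> over
  an arc \<open>J\<close> by the norm of \<open>f\<close> there times \<open>S(J)^(1/2)\<close>, so
  averages of \<open>f\<close> are controlled relative to \<open>S\<close>, whereas the coefficients
  are Carleson relative to \<open>M\<close>. The two embeddings bridge this mismatch. All tree sums
  stop at a finite depth with bounds independent of it; monotone convergence enters only when the
  truncation is removed.\<close>

text \<open>Node \<open>(n, i)\<close> has the children \<open>(n + 1, 2 * i)\<close> and
  \<open>(n + 1, 2 * i + 1)\<close>, and \<open>d\<close> counts generations including the root, so
  depth 1 is the root alone. The index \<open>i\<close> is not restricted to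
  \<open>i < 2 ^ n\<close>.\<close>

definition subtree_sum :: "(nat \<Rightarrow> nat \<Rightarrow> real) \<Rightarrow> nat \<Rightarrow> nat \<Rightarrow> nat \<Rightarrow> real" where
  "subtree_sum a d n i = (\<Sum>k<d. \<Sum>l<2^k. a (n + k) (2^k * i + l))"

lemma subtree_sum_0 [simp]: "subtree_sum a 0 n i = 0"
  by (simp add: subtree_sum_def)

lemma sum_lessThan_double:
  fixes g :: "nat \<Rightarrow> real"
  shows "(\<Sum>l<2 * N. g l) = (\<Sum>l<N. g l) + (\<Sum>l<N. g (N + l))"
  by (simp add: mult_2 sum.nat_group [symmetric] atLeast0LessThan [symmetric]
      sum.atLeastLessThan_concat [of 0 N "N+N", symmetric] sum.shift_bounds_nat_ivl [of g 0 N N, simplified] add.commute)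

lemma subtree_sum_Suc:
  "subtree_sum a (Suc d) n i =
     a n i + subtree_sum a d (Suc n) (2 * i) + subtree_sum a d (Suc n) (2 * i + 1)"
proof -
  have "(\<Sum>l<2^Suc k. a (n + Suc k) (2^Suc k * i + l)) =
      (\<Sum>l<2^k. a (Suc n + k) (2^k * (2 * i) + l)) +
      (\<Sum>l<2^k. a (Suc n + k) (2^k * (2 * i + 1) + l))" for k
    using sum_lessThan_double [of "\<lambda>l. a (n + Suc k) (2^Suc k * i + l)" "2^k"]
    by (simp add: algebra_simps)
  then show ?thesis
    unfolding subtree_sum_def sum.lessThan_Suc_shift by (simp add: sum.distrib)
qed

lemma subtree_sum_mono:
  assumes "\<And>n i. a n i \<le> b n i"
  shows "subtree_sum a d n i \<le> subtree_sum b d n i"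
  unfolding subtree_sum_def by (intro sum_mono assms)

lemma subtree_sum_nonneg:
  assumes "\<And>n i. 0 \<le> a n i"
  shows "0 \<le> subtree_sum a d n i"
  unfolding subtree_sum_def by (intro sum_nonneg assms)

lemma subtree_sum_cmult: "subtree_sum (\<lambda>n i. c * a n i) d n i = c * subtree_sum a d n i"
  unfolding subtree_sum_def by (simp add: sum_distrib_left)

lemma subtree_sum_term_le:
  assumes "\<And>n i. 0 \<le> a n i" and "k < d" and "l < 2^k"
  shows "a (n + k) (2^k * i + l) \<le> subtree_sum a d n i"
proof -
  have "a (n + k) (2^k * i + l) \<le> (\<Sum>l<2^k. a (n + k) (2^k * i + l))"
    using assms by (intro member_le_sum) auto
  also have "\<dots> \<le> subtree_sum a d n i"
    unfolding subtree_sum_def using assms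
    by (intro member_le_sum [where f = "\<lambda>k. \<Sum>l<2^k. a (n + k) (2^k * i + l)"]) (auto intro!: sum_nonneg)
  finally show ?thesis .
qed

text \<open>Subadditivity of the convex, 1-homogeneous function \<open>x^2 / s\<close>, which is
  Cauchy-Schwarz for two terms. It splits the Bellman function between the two children of a
  node.\<close>

lemma square_over_linear_subadd:
  fixes x y s t :: real
  assumes "0 < s" "0 < t"
  shows "(x + y)\<^sup>2 / (s + t) \<le> x\<^sup>2 / s + y\<^sup>2 / t"
proof -
  have "x\<^sup>2 / s + y\<^sup>2 / t - (x + y)\<^sup>2 / (s + t) = (x * t - y * s)\<^sup>2 / (s * t * (s + t))"
    using assms by (simp add: divide_simps add_pos_pos) (simp add: algebra_simps power2_eq_square)
  also have "\<dots> \<ge> 0" using assms by simp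
  finally show ?thesis by simp
qed

text \<open>The expression \<open>F - f\<^sup>2 / (s + C)\<close> is the Bellman function of the embedding: it is
  concave along the tree, and its derivative in \<open>C\<close> pays for the coefficients.\<close>

lemma carleson_embedding_tree_normalized:
  fixes c f s F :: "nat \<Rightarrow> nat \<Rightarrow> real"
  assumes c: "\<And>n i. 0 \<le> c n i" and s: "\<And>n i. 0 < s n i"
    and f_add: "\<And>n i. f n i = f (Suc n) (2 * i) + f (Suc n) (2 * i + 1)"
    and s_add: "\<And>n i. s n i = s (Suc n) (2 * i) + s (Suc n) (2 * i + 1)"
    and F_add: "\<And>n i. F n i = F (Suc n) (2 * i) + F (Suc n) (2 * i + 1)"
    and f_le: "\<And>n i. (f n i)\<^sup>2 \<le> F n i * s n i"
    and carleson: "\<And>d n i. subtree_sum c d n i \<le> s n i"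
  shows "subtree_sum (\<lambda>n i. c n i * (f n i / s n i)\<^sup>2) d n i
    \<le> 4 * (F n i - (f n i)\<^sup>2 / (s n i + subtree_sum c d n i))"
proof (induction d arbitrary: n i)
  case 0
  show ?case using f_le [of n i] s [of n i] by (simp add: field_simps)
next
  case (Suc d)
  define C1 where "C1 = subtree_sum c d (Suc n) (2 * i)"
  define C2 where "C2 = subtree_sum c d (Suc n) (2 * i + 1)"
  have C: "0 \<le> C1" "0 \<le> C2" unfolding C1_def C2_def by (auto intro!: subtree_sum_nonneg c)
  let ?f = "f n i" and ?s = "s n i" and ?c = "c n i" and ?C = "C1 + C2"
  have tot: "?c + ?C \<le> ?s"
    using carleson [of "Suc d" n i] by (simp add: subtree_sum_Suc C1_def C2_def)
  have "?f\<^sup>2 / (?s + ?C) \<le> (f (Suc n) (2 * i))\<^sup>2 / (s (Suc n) (2 * i) + C1)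
      + (f (Suc n) (2 * i + 1))\<^sup>2 / (s (Suc n) (2 * i + 1) + C2)"
    using square_over_linear_subadd [of "s (Suc n) (2 * i) + C1" "s (Suc n) (2 * i + 1) + C2"
        "f (Suc n) (2 * i)" "f (Suc n) (2 * i + 1)"] s [of "Suc n" "2 * i"] s [of "Suc n" "2 * i + 1"] C
    unfolding f_add [of n i] s_add [of n i] by (simp add: add_pos_nonneg add_ac)
  \<comment> \<open>The coefficient at the root is paid for by the drop of
    \<open>f^2 / (s + C)\<close> when \<open>C\<close> grows by \<open>c\<close>. By
    \<open>tot\<close> both denominators are at most \<open>2 * s\<close>, which is where the factor
    4 comes from.\<close>
  moreover have "?c * (?f / ?s)\<^sup>2 \<le> 4 * (?f\<^sup>2 / (?s + ?C) - ?f\<^sup>2 / (?s + ?C + ?c))"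
  proof -
    have pos: "0 < ?s + ?C" "0 < ?s + ?C + ?c" "0 < ?s"
      using s [of n i] C c [of n i] by linarith+
    have "(?s + ?C) * (?s + ?C + ?c) \<le> (2 * ?s) * (2 * ?s)"
      using tot C c [of n i] pos by (intro mult_mono) auto
    then have "?c * ?f\<^sup>2 / (4 * ?s\<^sup>2) \<le> ?c * ?f\<^sup>2 / ((?s + ?C) * (?s + ?C + ?c))"
      using pos c [of n i] by (intro divide_left_mono) (auto simp: power2_eq_square)
    also have "\<dots> = ?f\<^sup>2 / (?s + ?C) - ?f\<^sup>2 / (?s + ?C + ?c)"
      using pos by (simp add: diff_frac_eq) (simp add: algebra_simps)
    finally show ?thesis using pos by (simp add: power_divide field_simps)
  qed
  moreover note Suc.IH [of "Suc n" "2 * i"] Suc.IH [of "Suc n" "2 * i + 1"]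
  ultimately show ?case
    unfolding subtree_sum_Suc C1_def [symmetric] C2_def [symmetric] F_add [of n i]
    by (simp add: algebra_simps)
qed

lemma carleson_embedding_tree:
  fixes c f s F :: "nat \<Rightarrow> nat \<Rightarrow> real"
  assumes c: "\<And>n i. 0 \<le> c n i" and s: "\<And>n i. 0 < s n i" and D: "0 < D"
    and f_add: "\<And>n i. f n i = f (Suc n) (2 * i) + f (Suc n) (2 * i + 1)"
    and s_add: "\<And>n i. s n i = s (Suc n) (2 * i) + s (Suc n) (2 * i + 1)"
    and F_add: "\<And>n i. F n i = F (Suc n) (2 * i) + F (Suc n) (2 * i + 1)"
    and f_le: "\<And>n i. (f n i)\<^sup>2 \<le> F n i * s n i"
    and carleson: "\<And>d n i. subtree_sum c d n i \<le> D * s n i"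
  shows "subtree_sum (\<lambda>n i. c n i * (f n i / s n i)\<^sup>2) d n i \<le> 4 * D * F n i"
proof -
  define c' where "c' = (\<lambda>n i. (1 / D) * c n i)"
  have c': "0 \<le> c' n i" for n i using c D by (simp add: c'_def)
  have "subtree_sum (\<lambda>n i. c' n i * (f n i / s n i)\<^sup>2) d n i
      \<le> 4 * (F n i - (f n i)\<^sup>2 / (s n i + subtree_sum c' d n i))"
  proof (rule carleson_embedding_tree_normalized; (fact c' s f_add s_add F_add f_le)?)
    show "subtree_sum c' d n i \<le> s n i" for d n i
      using carleson [of d n i] D unfolding c'_def subtree_sum_cmult by (simp add: field_simps)
  qed
  also have "\<dots> \<le> 4 * F n i"
    using s [of n i] subtree_sum_nonneg [of c' d n i, OF c'] by (simp add: add_nonneg_nonneg less_imp_le)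
  finally have "(1 / D) * subtree_sum (\<lambda>n i. c n i * (f n i / s n i)\<^sup>2) d n i \<le> 4 * F n i"
    by (simp add: c'_def flip: subtree_sum_cmult)
  then show ?thesis using D by (simp add: field_simps)
qed

section \<open>Chords and angles on the unit circle\<close>

lemma sin_ge_Jordan:
  assumes "0 \<le> x" "x \<le> pi / 2"
  shows "2 * x / pi \<le> sin x"
proof -
  have "convex_on {0..pi/2} (\<lambda>x. - sin x)"
  proof (rule convex_on_realI [where f' = "\<lambda>x. - cos x"])
    show "((\<lambda>x. - sin x) has_real_derivative - cos x) (at x)" for x
      by (auto intro!: derivative_eq_intros)
    show "- cos x \<le> - cos y" if "x \<in> {0..pi/2}" "y \<in> {0..pi/2}" "x \<le> y" for x y
      using that by (auto intro!: cos_monotone_0_pi_le)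
  qed auto
  from convex_onD [OF this, of "2 * x / pi" 0 "pi / 2"] assms show ?thesis
    by (simp add: field_simps)
qed

lemma norm_cis_diff: "cmod (cis s - cis t) = 2 * \<bar>sin ((s - t) / 2)\<bar>"
proof -
  have "(cmod (cis s - cis t))\<^sup>2 = (cos s - cos t)\<^sup>2 + (sin s - sin t)\<^sup>2"
    by (simp add: cmod_power2)
  also have "\<dots> = 2 - 2 * cos (s - t)"
    using sin_cos_squared_add [of s] sin_cos_squared_add [of t]
    by (simp add: cos_diff power2_eq_square algebra_simps)
  also have "cos (s - t) = 1 - 2 * (sin ((s - t) / 2))\<^sup>2"
    by (subst cos_double_sin [symmetric]) (metis field_sum_of_halves mult_2)
  also have "2 - 2 * (1 - 2 * (sin ((s - t) / 2))\<^sup>2) = (2 * \<bar>sin ((s - t) / 2)\<bar>)\<^sup>2"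
    by (simp add: power_mult_distrib)
  finally show ?thesis by (rule power2_eq_imp_eq) auto
qed

lemma norm_cis_diff_le: "cmod (cis s - cis t) \<le> \<bar>s - t\<bar>"
  using abs_sin_x_le_abs_x [of "(s - t) / 2"] by (simp add: norm_cis_diff)

text \<open>The offset \<open>u\<close> is the principal argument of \<open>z\<close> rotated by
  \<open>-\<theta>\<close>, and Jordan's inequality bounds it by \<open>pi / 2\<close> times the
  chord. Together with \<open>norm_cis_diff_le\<close> this translates between planar discs and
  arcs.\<close>

lemma cis_near_angle:
  assumes "cmod z = 1"
  obtains t where "z = cis t" "\<bar>t - \<theta>\<bar> \<le> pi" "\<bar>t - \<theta>\<bar> \<le> pi / 2 * cmod (z - cis \<theta>)"
proof -
  define u where "u = Arg (z * cis (- \<theta>))"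
  have u: "\<bar>u\<bar> \<le> pi" using Arg_bounded [of "z * cis (- \<theta>)"] by (auto simp: u_def)
  have "cis u = z * cis (- \<theta>)" using assms unfolding u_def
    by (subst cis_Arg) (auto simp: sgn_eq norm_mult)
  then have z: "z = cis (\<theta> + u)" by (simp add: cis_mult [symmetric] mult.left_commute flip: mult.assoc) (simp add: cis_mult mult.assoc)
  have "2 * (\<bar>u\<bar> / 2) / pi \<le> sin (\<bar>u\<bar> / 2)" using u by (intro sin_ge_Jordan) auto
  also have "\<dots> \<le> \<bar>sin (u / 2)\<bar>" by (cases "0 \<le> u") auto
  finally have "\<bar>u\<bar> \<le> pi / 2 * cmod (z - cis \<theta>)"
    by (simp add: z norm_cis_diff field_simps)
  with u z show ?thesis by (intro that [of "\<theta> + u"]) auto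
qed

section \<open>Arcs and normalized arc length\<close>

lemma sets_circle_measure [simp, measurable_cong]: "sets circle_measure = sets borel"
  by (simp add: circle_measure_def)

lemma space_circle_measure [simp]: "space circle_measure = UNIV"
  by (simp add: circle_measure_def)

lemma measurable_cis [measurable]: "cis \<in> borel_measurable borel"
  by (intro borel_measurable_continuous_onI continuous_intros)

lemma emeasure_circle_measure:
  assumes [measurable]: "A \<in> sets borel"
  shows "emeasure circle_measure A = ennreal (1 / (2 * pi)) * emeasure lborel ({0..2*pi} \<inter> cis -` A)"
proof -
  have [measurable]: "cis -` A \<in> sets borel"
    using measurable_sets [OF measurable_cis assms] by simp
  have "emeasure circle_measure A
      = emeasure (density lborel (\<lambda>t::real. ennreal (indicator {0..2*pi} t / (2*pi)))) (cis -` A)"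
    unfolding circle_measure_def by (subst emeasure_distr) auto
  also have "\<dots> = (\<integral>\<^sup>+t. ennreal (1 / (2 * pi)) * indicator ({0..2*pi} \<inter> cis -` A) t \<partial>lborel)"
    by (subst emeasure_density) (auto intro!: nn_integral_cong simp: indicator_def)
  also have "\<dots> = ennreal (1 / (2 * pi)) * emeasure lborel ({0..2*pi} \<inter> cis -` A)"
    by (subst nn_integral_cmult) auto
  finally show ?thesis .
qed

lemma arc_measurable [measurable]: "arc a b \<in> sets borel"
  unfolding arc_def by (intro borel_closed compact_imp_closed compact_continuous_image continuous_intros) auto

lemma arc_shift: "arc (a + 2 * pi * of_int k) (b + 2 * pi * of_int k) = arc a b"
proof -
  have per: "cis (t + 2 * pi * of_int k) = cis t" for t by (simp flip: cis_mult)
  show ?thesis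
  proof (intro equalityI subsetI)
    fix z assume "z \<in> arc (a + 2 * pi * of_int k) (b + 2 * pi * of_int k)"
    then obtain t where "z = cis t" "a + 2 * pi * of_int k \<le> t" "t \<le> b + 2 * pi * of_int k"
      by (auto simp: arc_def)
    then show "z \<in> arc a b"
      using per [of "t - 2 * pi * of_int k"] unfolding arc_def
      by (intro image_eqI [where x = "t - 2 * pi * of_int k"]) auto
  next
    fix z assume "z \<in> arc a b"
    then obtain t where "z = cis t" "a \<le> t" "t \<le> b" by (auto simp: arc_def)
    then show "z \<in> arc (a + 2 * pi * of_int k) (b + 2 * pi * of_int k)"
      using per [of t] unfolding arc_def by (intro image_eqI [where x = "t + 2 * pi * of_int k"]) auto
  qed
qed

lemma emeasure_arc:
  assumes "a \<le> b" "b \<le> a + 2 * pi"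
  shows "emeasure circle_measure (arc a b) = ennreal ((b - a) / (2 * pi))"
proof -
  define k where "k = \<lfloor>a / (2 * pi)\<rfloor>"
  define a' where "a' = a + 2 * pi * of_int (- k)"
  define b' where "b' = b + 2 * pi * of_int (- k)"
  have "of_int k \<le> a / (2 * pi)" "a / (2 * pi) < of_int k + 1" unfolding k_def by linarith+
  then have a': "0 \<le> a'" "a' < 2 * pi"
    by (auto simp: a'_def field_simps)
  have b': "a' \<le> b'" "b' \<le> a' + 2 * pi" "b' - a' = b - a" using assms by (auto simp: a'_def b'_def)
  have arc': "arc a b = arc a' b'" unfolding a'_def b'_def arc_shift ..
  let ?P = "{0..2*pi} \<inter> cis -` arc a' b'"
  have [measurable]: "cis -` arc a' b' \<in> sets borel"
    using measurable_sets [OF measurable_cis arc_measurable] by simp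
  \<comment> \<open>With the left end moved into \<open>[0, 2 * pi)\<close>, the parameters of the
    arc are the piece up to \<open>2 * pi\<close> and the overflow wrapped round to 0. The two
    descriptions can differ only at the three points excluded below, which form a null set.\<close>
  let ?Q = "{a'<..min b' (2 * pi)} \<union> {0..<b' - 2 * pi}"
  have eqv: "t \<in> ?P \<longleftrightarrow> t \<in> ?Q" if t: "t \<noteq> a'" "t \<noteq> 2 * pi" "t \<noteq> b' - 2 * pi" for t
  proof
    assume "t \<in> ?P"
    then obtain s where s: "0 \<le> t" "t \<le> 2 * pi" "cis t = cis s" "a' \<le> s" "s \<le> b'"
      by (auto simp: arc_def)
    then have "sin t = sin s \<and> cos t = cos s" by (simp add: complex_eq_iff)
    then obtain j :: int where j: "t = s + 2 * pi * j" by (auto simp: sin_cos_eq_iff)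
    have "t < 2 * pi" using s t by auto
    then have "2 * pi * real_of_int j < 2 * pi * 1" using j s a' by linarith
    then have "j < 1" by simp
    moreover have "2 * pi * (- 2) < 2 * pi * real_of_int j" using j s a' b' by linarith
    then have "- 2 < real_of_int j" by (subst (asm) mult_less_cancel_left_pos) auto
    ultimately have "j = 0 \<or> j = - 1" by linarith
    then show "t \<in> ?Q" using j s t by auto
  next
    assume "t \<in> ?Q"
    then show "t \<in> ?P"
    proof
      assume "t \<in> {a'<..min b' (2 * pi)}"
      then show ?thesis using a' by (auto simp: arc_def)
    next
      assume "t \<in> {0..<b' - 2 * pi}"
      moreover have "cis t = cis (t + 2 * pi)" by (simp flip: cis_mult)
      ultimately show ?thesis using a' b' unfolding arc_def
        by (auto intro!: image_eqI [where x = "t + 2 * pi"])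
    qed
  qed
  have "AE t in lborel. t \<in> ?P \<longleftrightarrow> t \<in> ?Q"
    using AE_lborel_singleton [of a'] AE_lborel_singleton [of "2 * pi"] AE_lborel_singleton [of "b' - 2 * pi"]
    by eventually_elim (rule eqv)
  then have "emeasure lborel ?P = emeasure lborel ?Q"
    by (intro emeasure_eq_AE) auto
  also have "\<dots> = emeasure lborel {a'<..min b' (2 * pi)} + emeasure lborel {0..<b' - 2 * pi}"
    using b' by (intro plus_emeasure [symmetric]) auto
  also have "\<dots> = ennreal (b - a)"
    using a' b' by (cases "b' \<le> 2 * pi") (auto simp: min_def ennreal_plus [symmetric] simp del: ennreal_plus)
  finally show ?thesis
    using assms by (simp add: arc' emeasure_circle_measure ennreal_mult [symmetric] field_simps)
qed

lemma emeasure_circle_UNIV: "emeasure circle_measure UNIV = 1"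
  by (subst emeasure_circle_measure) (auto simp: ennreal_mult [symmetric] simp flip: ennreal_1)

interpretation circle: finite_measure circle_measure
  by standard (simp add: emeasure_circle_UNIV)

lemma measure_arc:
  assumes "a \<le> b" "b \<le> a + 2 * pi"
  shows "measure circle_measure (arc a b) = (b - a) / (2 * pi)"
  using assms by (simp add: measure_def emeasure_arc)

lemma AE_circle_measure_sphere: "AE z in circle_measure. cmod z = 1"
proof (rule AE_I [where N = "- sphere 0 1"])
  show "emeasure circle_measure (- sphere 0 1) = 0"
    by (subst emeasure_circle_measure) (auto simp: vimage_def)
qed auto

text \<open>A planar disc, not an arc: the same set is measured by the weights on the circle and by
  the measure inside the unit disc.\<close>

definition circle_disc :: "real \<Rightarrow> real \<Rightarrow> complex set" where
  "circle_disc \<theta> \<rho> = cball (cis \<theta>) \<rho>"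

lemma circle_disc_measurable [measurable]: "circle_disc \<theta> \<rho> \<in> sets borel"
  by (simp add: circle_disc_def)

lemma circle_disc_mono: "\<rho> \<le> \<rho>' \<Longrightarrow> circle_disc \<theta> \<rho> \<subseteq> circle_disc \<theta> \<rho>'"
  by (auto simp: circle_disc_def)

text \<open>A chord of length \<open>\<rho>\<close> spans an angle of at most
  \<open>pi / 2 * \<rho>\<close>, which gives normalized length \<open>\<rho> / 2\<close> for the
  two sides together. Capping the half-angle at \<open>pi\<close> keeps the arc admissible for the
  \<open>A2\<close> condition.\<close>

lemma circle_disc_subset_arc:
  assumes "0 < \<rho>"
  obtains a b where "a < b" "b \<le> a + 2 * pi" "circle_disc \<theta> \<rho> \<inter> sphere 0 1 \<subseteq> arc a b"
    "measure circle_measure (arc a b) \<le> \<rho> / 2"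
proof -
  define r where "r = min pi (pi / 2 * \<rho>)"
  have r: "0 < r" "r \<le> pi" "r \<le> pi / 2 * \<rho>" using assms by (auto simp: r_def)
  show ?thesis
  proof (rule that [of "\<theta> - r" "\<theta> + r"])
    show "circle_disc \<theta> \<rho> \<inter> sphere 0 1 \<subseteq> arc (\<theta> - r) (\<theta> + r)"
    proof
      fix z assume z: "z \<in> circle_disc \<theta> \<rho> \<inter> sphere 0 1"
      then have "cmod z = 1" by simp
      then obtain t where t: "z = cis t" "\<bar>t - \<theta>\<bar> \<le> pi" "\<bar>t - \<theta>\<bar> \<le> pi / 2 * cmod (z - cis \<theta>)"
        by (rule cis_near_angle)
      moreover have "pi / 2 * cmod (z - cis \<theta>) \<le> pi / 2 * \<rho>"
        using z by (intro mult_left_mono) (auto simp: circle_disc_def dist_norm norm_minus_commute)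
      ultimately have "\<bar>t - \<theta>\<bar> \<le> pi / 2 * \<rho>" by linarith
      with t have "\<bar>t - \<theta>\<bar> \<le> r" by (simp add: r_def)
      then have "t \<in> {\<theta> - r..\<theta> + r}" by auto
      with t(1) show "z \<in> arc (\<theta> - r) (\<theta> + r)" by (auto simp: arc_def)
    qed
    show "measure circle_measure (arc (\<theta> - r) (\<theta> + r)) \<le> \<rho> / 2"
      using r by (subst measure_arc) (auto simp: field_simps)
  qed (use r in auto)
qed

lemma arc_subset_circle_disc: "arc (\<theta> - \<rho>) (\<theta> + \<rho>) \<subseteq> circle_disc \<theta> \<rho>"
proof
  fix z assume "z \<in> arc (\<theta> - \<rho>) (\<theta> + \<rho>)"
  then obtain t where "z = cis t" "\<bar>\<theta> - t\<bar> \<le> \<rho>" by (auto simp: arc_def)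
  with norm_cis_diff_le [of \<theta> t] show "z \<in> circle_disc \<theta> \<rho>"
    by (auto simp: circle_disc_def dist_norm)
qed

lemma measure_circle_disc_ge:
  assumes "0 \<le> \<rho>" "\<rho> \<le> pi"
  shows "\<rho> / pi \<le> measure circle_measure (circle_disc \<theta> \<rho>)"
proof -
  have "\<rho> / pi = measure circle_measure (arc (\<theta> - \<rho>) (\<theta> + \<rho>))"
    using assms by (subst measure_arc) (auto simp: field_simps)
  also have "\<dots> \<le> measure circle_measure (circle_disc \<theta> \<rho>)"
    by (intro circle.finite_measure_mono arc_subset_circle_disc) simp
  finally show ?thesis .
qed

lemma measure_circle_disc_le:
  assumes "0 < \<rho>"
  shows "measure circle_measure (circle_disc \<theta> \<rho>) \<le> \<rho> / 2"
proof -
  obtain a b where ab: "circle_disc \<theta> \<rho> \<inter> sphere 0 1 \<subseteq> arc a b"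
    "measure circle_measure (arc a b) \<le> \<rho> / 2"
    using circle_disc_subset_arc [OF assms] by metis
  have "measure circle_measure (circle_disc \<theta> \<rho>) \<le> measure circle_measure (arc a b)"
    using AE_circle_measure_sphere ab(1)
    by (intro circle.finite_measure_mono_AE) (auto elim!: eventually_mono)
  with ab(2) show ?thesis by simp
qed

lemma circle_disc_2: "sphere 0 1 \<subseteq> circle_disc \<theta> 2"
proof
  fix z :: complex assume "z \<in> sphere 0 1"
  then show "z \<in> circle_disc \<theta> 2"
    using norm_triangle_ineq4 [of "cis \<theta>" z] by (simp add: circle_disc_def dist_norm)
qed

section \<open>The Poisson kernel\<close>

lemma measurable_poisson [measurable]:
  assumes [measurable]: "f \<in> borel_measurable N" "g \<in> borel_measurable N"
  shows "(\<lambda>x. poisson (f x) (g x)) \<in> borel_measurable N"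
proof -
  have [measurable]: "cnj \<in> borel_measurable borel"
    by (intro borel_measurable_continuous_onI continuous_intros)
  show ?thesis unfolding poisson_def by measurable
qed

text \<open>The denominator \<open>X\<close> of the kernel satisfies
  \<open>X <= \<delta> + d <= 3 * X\<close>, and the numerator
  \<open>\<delta> * (2 - \<delta>)\<close> lies between \<open>\<delta>\<close> and
  \<open>2 * \<delta>\<close>; hence the factors 1 and 18 = 2 * 9. The point \<open>w\<close> ranges
  over the closed disc, since the kernel is integrated against measures on the circle and inside
  it.\<close>

lemma poisson_bounds:
  fixes \<delta> \<theta> :: real and w :: complex
  assumes "0 < \<delta>" "\<delta> \<le> 1" "cmod w \<le> 1"
  defines "d \<equiv> cmod (w - cis \<theta>)"
  shows "\<delta> / (\<delta> + d)\<^sup>2 \<le> poisson (of_real (1 - \<delta>) * cis \<theta>) w" (is ?lower)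
    and "poisson (of_real (1 - \<delta>) * cis \<theta>) w \<le> 18 * (\<delta> / (\<delta> + d)\<^sup>2)" (is ?upper)
proof -
  define u where "u = cis (- \<theta>) * w"
  define X where "X = cmod (1 - of_real (1 - \<delta>) * u)"
  have u: "cmod u \<le> 1" using assms by (simp add: u_def norm_mult)
  have "1 - u = - (cis (- \<theta>) * (w - cis \<theta>))" by (simp add: u_def algebra_simps cis_mult)
  then have d: "d = cmod (1 - u)" by (simp add: d_def norm_mult)
  have p: "poisson (of_real (1 - \<delta>) * cis \<theta>) w = (\<delta> * (2 - \<delta>)) / X\<^sup>2"
    using assms unfolding poisson_def X_def u_def
    by (simp add: norm_mult cis_cnj mult.assoc flip: of_real_diff) (simp add: power2_eq_square algebra_simps)
  have "X \<le> \<delta> + (1 - \<delta>) * d"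
  proof -
    have "1 - of_real (1 - \<delta>) * u = of_real \<delta> + of_real (1 - \<delta>) * (1 - u)" by (simp add: algebra_simps)
    then show ?thesis
      using assms norm_triangle_ineq [of "of_real \<delta>" "of_real (1 - \<delta>) * (1 - u)"]
      by (simp add: X_def d norm_mult flip: of_real_diff)
  qed
  moreover have "(1 - \<delta>) * d \<le> d" using assms by (simp add: d mult_left_le_one_le)
  ultimately have X1: "X \<le> \<delta> + d" by linarith
  have X2: "\<delta> \<le> X"
  proof -
    have "cmod (of_real (1 - \<delta>) * u) \<le> 1 - \<delta>"
      using assms u by (simp add: norm_mult mult_left_le flip: of_real_diff)
    then show ?thesis
      using norm_triangle_ineq2 [of 1 "of_real (1 - \<delta>) * u"] by (simp add: X_def)
  qed
  have X3: "d \<le> X + \<delta>"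
  proof -
    have "d = cmod ((1 - of_real (1 - \<delta>) * u) - of_real \<delta> * u)" by (simp add: d algebra_simps)
    moreover have "cmod (of_real \<delta> * u) \<le> \<delta>" using assms u by (simp add: norm_mult mult_left_le)
    ultimately show ?thesis
      using norm_triangle_ineq4 [of "1 - of_real (1 - \<delta>) * u" "of_real \<delta> * u"] by (simp add: X_def)
  qed
  have d0: "0 \<le> d" by (simp add: d_def)
  have "\<delta> / (\<delta> + d)\<^sup>2 \<le> \<delta> / X\<^sup>2"
    using assms X1 X2 d0 by (intro divide_left_mono power_mono mult_pos_pos zero_less_power) auto
  also have "\<dots> \<le> \<delta> * (2 - \<delta>) / X\<^sup>2"
    using assms by (intro divide_right_mono) auto
  finally show ?lower unfolding p .
  have "(\<delta> + d)\<^sup>2 \<le> (3 * X)\<^sup>2" using assms X2 X3 d0 by (intro power_mono) auto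
  then have "18 * \<delta> / (9 * X\<^sup>2) \<le> 18 * \<delta> / (\<delta> + d)\<^sup>2"
    using assms(1-3) X2 d0 add_pos_nonneg [of \<delta> d]
    by (intro divide_left_mono mult_pos_pos zero_less_power) (auto simp: power_mult_distrib)
  moreover have "\<delta> * (2 - \<delta>) / X\<^sup>2 \<le> \<delta> * 2 / X\<^sup>2"
    using assms by (intro divide_right_mono mult_left_mono) auto
  ultimately show ?upper unfolding p by simp
qed

text \<open>The kernel is of size \<open>1 / \<delta>\<close> at distances comparable to
  \<open>\<delta>\<close>. It is used with \<open>a = 1\<close> on arcs and discs of radius
  \<open>\<delta>\<close>, and with \<open>a = 2\<close> on sectors.\<close>

lemma poisson_ge_near:
  assumes \<delta>: "0 < \<delta>" "\<delta> \<le> 1" and w: "cmod w \<le> 1" and a: "0 \<le> a" "cmod (w - cis \<theta>) \<le> a * \<delta>"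
  shows "1 / ((1 + a)\<^sup>2 * \<delta>) \<le> poisson (of_real (1 - \<delta>) * cis \<theta>) w"
proof -
  let ?d = "cmod (w - cis \<theta>)"
  have "1 / ((1 + a)\<^sup>2 * \<delta>) = \<delta> / ((1 + a) * \<delta>)\<^sup>2"
    using \<delta> by (simp add: power2_eq_square)
  also have "\<dots> \<le> \<delta> / (\<delta> + ?d)\<^sup>2"
    using \<delta> a add_pos_nonneg [of \<delta> ?d]
    by (intro divide_left_mono power_mono mult_pos_pos zero_less_power) (auto simp: algebra_simps)
  also have "\<dots> \<le> poisson (of_real (1 - \<delta>) * cis \<theta>) w" by (intro poisson_bounds \<delta> w)
  finally show ?thesis .
qed

lemma ball_polar:
  assumes "z \<in> ball (0::complex) 1"
  obtains \<delta> \<theta> where "0 < \<delta>" "\<delta> \<le> 1" "z = of_real (1 - \<delta>) * cis \<theta>"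
  using assms rcis_cmod_Arg [of z] by (intro that [of "1 - cmod z" "Arg z"]) (auto simp: rcis_def)

lemma poisson_nonneg: "cmod z \<le> 1 \<Longrightarrow> 0 \<le> poisson z w"
  unfolding poisson_def by (simp add: power_le_one)

lemma poisson_pos:
  assumes "z \<in> ball 0 1" "cmod w \<le> 1"
  shows "0 < poisson z w"
proof -
  obtain \<delta> \<theta> where z: "0 < \<delta>" "\<delta> \<le> 1" "z = of_real (1 - \<delta>) * cis \<theta>"
    using assms(1) by (rule ball_polar)
  have "0 < \<delta> + cmod (w - cis \<theta>)" using z by (intro add_pos_nonneg) auto
  then have "0 < \<delta> / (\<delta> + cmod (w - cis \<theta>))\<^sup>2" using z by simp
  also have "\<dots> \<le> poisson z w" unfolding z(3) using z assms by (intro poisson_bounds) auto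
  finally show ?thesis .
qed

lemma poisson_le_circle:
  assumes "cmod z < 1" "cmod \<zeta> = 1"
  shows "poisson z \<zeta> \<le> 2 * (1 - cmod z) / (cmod (\<zeta> - z))\<^sup>2"
proof -
  have "1 = cnj \<zeta> * \<zeta>" using assms by (simp add: complex_norm_square [symmetric] mult.commute)
  then have "1 - cnj z * \<zeta> = cnj (\<zeta> - z) * \<zeta>" by (simp add: algebra_simps)
  then have "cmod (1 - cnj z * \<zeta>) = cmod (\<zeta> - z)" using assms by (simp add: norm_mult flip: complex_cnj_diff)
  moreover have "1 - (cmod z)\<^sup>2 \<le> 2 * (1 - cmod z)"
  proof -
    have "0 \<le> (1 - cmod z)\<^sup>2" by simp
    then show ?thesis by (simp add: power2_eq_square algebra_simps)
  qed
  ultimately show ?thesis unfolding poisson_def by (simp add: divide_right_mono)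
qed

lemma measurable_pext [measurable]:
  assumes [measurable]: "w \<in> borel_measurable borel"
  shows "pext w \<in> borel_measurable borel"
  unfolding pext_def by measurable

lemma measurable_cpext [measurable]:
  assumes [measurable]: "f \<in> borel_measurable borel"
  shows "cpext f \<in> borel_measurable borel"
  unfolding cpext_def by measurable

section \<open>Muckenhoupt weights and their duals\<close>

text \<open>Only the two inequalities that express duality of the weights are kept. They are
  symmetric in the two measures, so \<open>swap\<close> makes every result about \<open>M\<close>
  available for \<open>S\<close>. Working with measures also avoids pointwise inverses of the
  weight.\<close>

locale A2_pair = M: finite_measure M + S: finite_measure S for M S :: "complex measure" +
  fixes K :: real
  assumes sets_M [simp, measurable_cong]: "sets M = sets borel"
    and sets_S [simp, measurable_cong]: "sets S = sets borel"
    and M_sphere: "AE z in M. cmod z = 1"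
    and S_sphere: "AE z in S. cmod z = 1"
    and K_pos: "0 < K"
    and cauchy_schwarz: "E \<in> sets borel \<Longrightarrow>
      (measure circle_measure E)\<^sup>2 \<le> measure M E * measure S E"
    and A2_arc: "a < b \<Longrightarrow> b \<le> a + 2 * pi \<Longrightarrow>
      measure M (arc a b) * measure S (arc a b) \<le> K * (measure circle_measure (arc a b))\<^sup>2"
begin

lemma swap: "A2_pair S M K"
  using cauchy_schwarz A2_arc K_pos M_sphere S_sphere
  by unfold_locales (auto simp: mult.commute)

lemma measure_mono_sphere:
  assumes "A \<inter> sphere 0 1 \<subseteq> B" "B \<in> sets borel"
  shows "measure M A \<le> measure M B"
  using assms M_sphere by (intro M.finite_measure_mono_AE) (auto elim!: eventually_mono)

lemma measure_pos:
  assumes "E \<in> sets borel" "0 < measure circle_measure E"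
  shows "0 < measure M E"
  using cauchy_schwarz [OF assms(1)] assms(2)
  by (metis less_le_not_le measure_nonneg mult_zero_left order_le_less zero_less_power)

lemma circle_disc_pos: "0 < \<rho> \<Longrightarrow> 0 < measure M (circle_disc \<theta> \<rho>)"
proof -
  assume "0 < \<rho>"
  then have "0 < min \<rho> pi / pi" by simp
  also have "\<dots> \<le> measure circle_measure (circle_disc \<theta> (min \<rho> pi))"
    using \<open>0 < \<rho>\<close> by (intro measure_circle_disc_ge) auto
  finally have "0 < measure M (circle_disc \<theta> (min \<rho> pi))" by (intro measure_pos) auto
  also have "\<dots> \<le> measure M (circle_disc \<theta> \<rho>)"
    by (intro M.finite_measure_mono circle_disc_mono) auto
  finally show ?thesis .
qed

text \<open>Cauchy-Schwarz on \<open>E\<close>, enlarging \<open>S(E)\<close> to \<open>S\<close> of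
  the whole arc, then \<open>A2\<close> on the arc: a set filling a fixed share of an arc in length
  carries a fixed share of its \<open>M\<close>-mass. All doubling statements below come from
  this.\<close>

lemma measure_arc_compare:
  assumes "a < b" "b \<le> a + 2 * pi" "E \<in> sets borel" "E \<inter> sphere 0 1 \<subseteq> arc a b"
  shows "(measure circle_measure E)\<^sup>2 * measure M (arc a b)
    \<le> K * (measure circle_measure (arc a b))\<^sup>2 * measure M E"
proof -
  have "(measure circle_measure E)\<^sup>2 * measure M (arc a b)
      \<le> (measure M E * measure S (arc a b)) * measure M (arc a b)"
    using A2_pair.measure_mono_sphere [OF swap assms(4)]
    by (intro mult_right_mono order_trans [OF cauchy_schwarz [OF assms(3)]] mult_left_mono) auto
  also have "\<dots> = measure M E * (measure M (arc a b) * measure S (arc a b))" by simp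
  also have "\<dots> \<le> measure M E * (K * (measure circle_measure (arc a b))\<^sup>2)"
    using assms by (intro mult_left_mono A2_arc) auto
  finally show ?thesis by (simp add: mult_ac)
qed

lemma measure_disc_compare:
  assumes "0 < \<rho>" "E \<in> sets borel" "E \<subseteq> circle_disc \<theta> \<rho>"
  shows "(measure circle_measure E)\<^sup>2 * measure M (circle_disc \<theta> \<rho>) \<le> K * (\<rho> / 2)\<^sup>2 * measure M E"
proof -
  obtain a b where ab: "a < b" "b \<le> a + 2 * pi" "circle_disc \<theta> \<rho> \<inter> sphere 0 1 \<subseteq> arc a b"
    "measure circle_measure (arc a b) \<le> \<rho> / 2"
    using circle_disc_subset_arc [OF assms(1)] by metis
  have "(measure circle_measure E)\<^sup>2 * measure M (circle_disc \<theta> \<rho>)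
      \<le> (measure circle_measure E)\<^sup>2 * measure M (arc a b)"
    by (intro mult_left_mono measure_mono_sphere ab) auto
  also have "\<dots> \<le> K * (measure circle_measure (arc a b))\<^sup>2 * measure M E"
    using assms ab by (intro measure_arc_compare) auto
  also have "\<dots> \<le> K * (\<rho> / 2)\<^sup>2 * measure M E"
    using ab K_pos by (intro mult_right_mono mult_left_mono power_mono) auto
  finally show ?thesis .
qed

lemma A2_disc:
  assumes "0 < \<rho>"
  shows "measure M (circle_disc \<theta> \<rho>) * measure S (circle_disc \<theta> \<rho>) \<le> K * (\<rho> / 2)\<^sup>2"
proof -
  obtain a b where ab: "a < b" "b \<le> a + 2 * pi" "circle_disc \<theta> \<rho> \<inter> sphere 0 1 \<subseteq> arc a b"
    "measure circle_measure (arc a b) \<le> \<rho> / 2"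
    using circle_disc_subset_arc [OF assms] by metis
  have "measure M (circle_disc \<theta> \<rho>) * measure S (circle_disc \<theta> \<rho>)
      \<le> measure M (arc a b) * measure S (arc a b)"
    using measure_mono_sphere [OF ab(3)] A2_pair.measure_mono_sphere [OF swap ab(3)]
    by (intro mult_mono) auto
  also have "\<dots> \<le> K * (measure circle_measure (arc a b))\<^sup>2" using ab by (intro A2_arc)
  also have "\<dots> \<le> K * (\<rho> / 2)\<^sup>2" using ab K_pos by (intro mult_left_mono power_mono) auto
  finally show ?thesis .
qed

text \<open>The annulus between the discs has length at least
  \<open>2 * \<rho> / pi - \<rho> / 2 = c * \<rho>\<close>, positive because \<open>pi < 4\<close>,
  so it carries the share \<open>c^2 / L\<close> of the mass of the larger disc. Replacing
  \<open>K\<close> by \<open>L = max K 1\<close> keeps the factor strictly between 0 and 1.\<close>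

lemma reverse_doubling:
  obtains q where "0 < q" "q < 1"
    "\<And>\<theta> \<rho>. 0 < \<rho> \<Longrightarrow> \<rho> \<le> 1 \<Longrightarrow> measure M (circle_disc \<theta> \<rho>) \<le> q * measure M (circle_disc \<theta> (2 * \<rho>))"
proof -
  define c where "c = (4 - pi) / (2 * pi)"
  define L where "L = max K 1"
  have c: "0 < c" "c < 1" using pi_less_4 pi_gt3 by (auto simp: c_def field_simps)
  have L: "1 \<le> L" "K \<le> L" by (auto simp: L_def)
  have c2: "0 < c\<^sup>2" "c\<^sup>2 < 1" using c by (auto simp: power_less_one_iff abs_square_less_1)
  show ?thesis
  proof (rule that [of "1 - c\<^sup>2 / L"])
    show "0 < 1 - c\<^sup>2 / L" "1 - c\<^sup>2 / L < 1" using c2 L by (auto simp: field_simps)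
    fix \<theta> \<rho> :: real assume \<rho>: "0 < \<rho>" "\<rho> \<le> 1"
    let ?A = "circle_disc \<theta> \<rho>" and ?B = "circle_disc \<theta> (2 * \<rho>)"
    have sub: "?A \<subseteq> ?B" using \<rho> by (intro circle_disc_mono) auto
    have "c * \<rho> = 2 * \<rho> / pi - \<rho> / 2" by (simp add: c_def field_simps)
    also have "\<dots> \<le> measure circle_measure ?B - measure circle_measure ?A"
      using \<rho> pi_gt3 by (intro diff_mono measure_circle_disc_ge measure_circle_disc_le) auto
    also have "\<dots> = measure circle_measure (?B - ?A)"
      using sub by (subst circle.finite_measure_Diff) auto
    finally have "(c * \<rho>)\<^sup>2 * measure M ?B \<le> (measure circle_measure (?B - ?A))\<^sup>2 * measure M ?B"
      using c \<rho> by (intro mult_right_mono power_mono) auto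
    also have "\<dots> \<le> K * (2 * \<rho> / 2)\<^sup>2 * measure M (?B - ?A)"
      using \<rho> by (intro measure_disc_compare) auto
    also have "\<dots> \<le> L * \<rho>\<^sup>2 * measure M (?B - ?A)"
      using L by (intro mult_mono) auto
    finally have "c\<^sup>2 * measure M ?B \<le> L * measure M (?B - ?A)"
      using \<rho> by (simp add: power_mult_distrib field_simps)
    also have "measure M (?B - ?A) = measure M ?B - measure M ?A"
      using sub by (subst M.finite_measure_Diff) auto
    finally show "measure M ?A \<le> (1 - c\<^sup>2 / L) * measure M ?B"
      using L by (simp add: field_simps)
  qed
qed

text \<open>The \<open>A\<^sub>2\<close> condition alone only gives growth by the factor \<open>4\<close> per doubling; the gain
  \<open>q < 1\<close> comes from reverse doubling of the dual weight.\<close>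

lemma disc_growth:
  obtains C q where "0 < C" "0 < q" "q < 1"
    "\<And>\<theta> \<delta> k. 0 < \<delta> \<Longrightarrow> \<delta> \<le> 1 \<Longrightarrow> 2 ^ k * \<delta> \<le> 4 \<Longrightarrow>
       measure M (circle_disc \<theta> (2 ^ k * \<delta>)) \<le> C * (4 * q) ^ k * measure M (circle_disc \<theta> \<delta>)"
proof -
  interpret SM: A2_pair S M K by (rule swap)
  obtain q where q: "0 < q" "q < 1" and rd: "\<And>\<theta> \<rho>. 0 < \<rho> \<Longrightarrow> \<rho> \<le> 1 \<Longrightarrow>
      measure S (circle_disc \<theta> \<rho>) \<le> q * measure S (circle_disc \<theta> (2 * \<rho>))"
    using SM.reverse_doubling by metis
  \<comment> \<open>Reverse doubling starts from radii up to 1 and so reaches radius 2. The last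
    doubling, up to radius 4, uses monotonicity alone; the factor \<open>q\<close> on the left
    accounts for the missing gain.\<close>
  have dual: "q * measure S (circle_disc \<theta> \<delta>) \<le> q ^ k * measure S (circle_disc \<theta> (2 ^ k * \<delta>))"
    if \<delta>: "0 < \<delta>" "\<delta> \<le> 1" "2 ^ k * \<delta> \<le> 4" for \<theta> \<delta> k
  proof (cases k)
    case 0
    then show ?thesis using q by (simp add: mult_left_le_one_le)
  next
    case (Suc j)
    have *: "measure S (circle_disc \<theta> \<delta>) \<le> q ^ i * measure S (circle_disc \<theta> (2 ^ i * \<delta>))"
      if "2 ^ i * \<delta> \<le> 2" for i
      using that
    proof (induction i)
      case (Suc i)
      have "measure S (circle_disc \<theta> \<delta>) \<le> q ^ i * measure S (circle_disc \<theta> (2 ^ i * \<delta>))"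
        using Suc \<delta> by auto
      also have "\<dots> \<le> q ^ i * (q * measure S (circle_disc \<theta> (2 * (2 ^ i * \<delta>))))"
        using Suc \<delta> q by (intro mult_left_mono rd) auto
      finally show ?case by (simp add: mult_ac)
    qed simp
    have "measure S (circle_disc \<theta> \<delta>) \<le> q ^ j * measure S (circle_disc \<theta> (2 ^ j * \<delta>))"
      using \<delta> Suc by (intro *) (simp add: mult.commute)
    also have "\<dots> \<le> q ^ j * measure S (circle_disc \<theta> (2 ^ k * \<delta>))"
      using q Suc \<delta> by (intro mult_left_mono S.finite_measure_mono circle_disc_mono) auto
    finally show ?thesis using q Suc by (simp add: mult_ac)
  qed
  show ?thesis
  proof (rule that [of "K * pi\<^sup>2 / (4 * q)" q])
    show "0 < K * pi\<^sup>2 / (4 * q)" using K_pos q by simp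
    fix \<theta> \<delta> :: real and k :: nat
    assume \<delta>: "0 < \<delta>" "\<delta> \<le> 1" "2 ^ k * \<delta> \<le> 4"
    let ?M = "\<lambda>k. measure M (circle_disc \<theta> (2 ^ k * \<delta>))" and ?S = "\<lambda>k. measure S (circle_disc \<theta> (2 ^ k * \<delta>))"
    have S0: "0 < ?S 0" using \<delta> by (simp add: SM.circle_disc_pos)
    have "(\<delta> / pi)\<^sup>2 \<le> (measure circle_measure (circle_disc \<theta> \<delta>))\<^sup>2"
      using \<delta> pi_gt3 by (intro power_mono measure_circle_disc_ge) auto
    also have "\<dots> \<le> ?M 0 * ?S 0" using cauchy_schwarz by simp
    finally have low: "\<delta>\<^sup>2 \<le> pi\<^sup>2 * (?M 0 * ?S 0)" by (simp add: power_divide field_simps)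
    \<comment> \<open>\<open>A2\<close> on the large disc bounds \<open>?M k * ?S k\<close> by a
      multiple of \<open>4 ^ k * \<delta>^2\<close>, Cauchy-Schwarz on the small disc bounds
      \<open>\<delta>^2\<close> by \<open>?M 0 * ?S 0\<close>, and \<open>dual\<close> compares
      \<open>?S 0\<close> with \<open>?S k\<close>. Cancelling \<open>?S 0\<close> leaves the growth
      bound.\<close>
    have "(q * ?M k) * ?S 0 = ?M k * (q * ?S 0)" by simp
    also have "\<dots> \<le> ?M k * (q ^ k * ?S k)" using dual [OF \<delta>] by (intro mult_left_mono) auto
    also have "\<dots> = q ^ k * (?M k * ?S k)" by simp
    also have "\<dots> \<le> q ^ k * (K * (2 ^ k * \<delta> / 2)\<^sup>2)"
      using \<delta> q by (intro mult_left_mono A2_disc) auto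
    also have "(2 ^ k * \<delta> / 2)\<^sup>2 = 4 ^ k * \<delta>\<^sup>2 / 4"
      by (simp add: power_mult_distrib power_divide power2_eq_square flip: power_mult_distrib)
    also have "q ^ k * (K * (4 ^ k * \<delta>\<^sup>2 / 4)) = K / 4 * (4 * q) ^ k * \<delta>\<^sup>2"
      by (simp add: power_mult_distrib)
    also have "\<dots> \<le> K / 4 * (4 * q) ^ k * (pi\<^sup>2 * (?M 0 * ?S 0))"
      using K_pos q low by (intro mult_left_mono) auto
    finally have "(q * ?M k) * ?S 0 \<le> (K / 4 * (4 * q) ^ k * (pi\<^sup>2 * ?M 0)) * ?S 0"
      by (simp add: mult_ac)
    then have "q * ?M k \<le> K / 4 * (4 * q) ^ k * (pi\<^sup>2 * ?M 0)"
      using S0 by (simp only: mult_le_cancel_right_pos)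
    then show "?M k \<le> K * pi\<^sup>2 / (4 * q) * (4 * q) ^ k * measure M (circle_disc \<theta> \<delta>)"
      using q by (simp add: field_simps)
  qed (use q in auto)
qed

end

section \<open>Poisson integrals of measures controlled on discs\<close>

text \<open>One term suffices: for the least \<open>k\<close> with
  \<open>d <= 2 ^ k * \<delta>\<close>, either \<open>k = 0\<close> or \<open>d\<close> exceeds half
  of that radius, and so the kernel is at most \<open>4 / (4 ^ k * \<delta>)\<close>. Since
  \<open>d <= 2\<close>, this \<open>k\<close> satisfies
  \<open>2 ^ k * \<delta> <= 4\<close>.\<close>

lemma kernel_le_dyadic_sum:
  assumes "0 < \<delta>" "\<delta> \<le> 1" "cmod w \<le> 1"
  shows "\<delta> / (\<delta> + cmod (w - cis \<theta>))\<^sup>2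
    \<le> (\<Sum>k | 2 ^ k * \<delta> \<le> 4. 4 / (4 ^ k * \<delta>) * indicator (circle_disc \<theta> (2 ^ k * \<delta>)) w)"
    and "finite {k::nat. 2 ^ k * \<delta> \<le> 4}"
proof -
  define d where "d = cmod (w - cis \<theta>)"
  have d: "0 \<le> d" "d \<le> 2" using assms norm_triangle_ineq4 [of w "cis \<theta>"] by (auto simp: d_def)
  have ex: "\<exists>k::nat. x < 2 ^ k * \<delta>" for x
    using real_arch_pow [of 2 "x / \<delta>"] assms by (auto simp: field_simps)
  obtain n :: nat where n: "4 < 2 ^ n * \<delta>" using ex by blast
  have "k < n" if "2 ^ k * \<delta> \<le> 4" for k :: nat
  proof (rule ccontr)
    assume "\<not> k < n"
    then have "(2::real) ^ n * \<delta> \<le> 2 ^ k * \<delta>" using assms by (intro mult_right_mono power_increasing) auto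
    with that n show False by simp
  qed
  then show fin: "finite {k::nat. 2 ^ k * \<delta> \<le> 4}" by (intro finite_subset [OF _ finite_lessThan [of n]]) auto
  define k where "k = (LEAST k. d \<le> 2 ^ k * \<delta>)"
  have k: "d \<le> 2 ^ k * \<delta>" unfolding k_def by (rule LeastI_ex) (use ex [of d] in \<open>auto intro: less_imp_le\<close>)
  have "2 ^ k * \<delta> \<le> 4 \<and> \<delta> / (\<delta> + d)\<^sup>2 \<le> 4 / (4 ^ k * \<delta>)"
  proof (cases k)
    case 0
    have "\<delta>\<^sup>2 \<le> (\<delta> + d)\<^sup>2" using assms d by (intro power_mono) auto
    then have "\<delta> / (\<delta> + d)\<^sup>2 \<le> \<delta> / \<delta>\<^sup>2" using assms d by (intro divide_left_mono) (auto intro!: mult_pos_pos)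
    also have "\<dots> \<le> 4 / \<delta>" using assms by (simp add: power2_eq_square field_simps)
    finally show ?thesis using 0 assms by simp
  next
    case (Suc j)
    have j: "2 ^ j * \<delta> < d" using not_less_Least [of j "\<lambda>k. d \<le> 2 ^ k * \<delta>"] Suc k_def by auto
    have pos: "0 < 2 ^ j * \<delta>" using assms by simp
    have "(2 ^ j * \<delta>)\<^sup>2 \<le> (\<delta> + d)\<^sup>2" using assms j pos by (intro power_mono) auto
    then have "\<delta> / (\<delta> + d)\<^sup>2 \<le> \<delta> / (2 ^ j * \<delta>)\<^sup>2"
      using assms d pos by (intro divide_left_mono mult_pos_pos zero_less_power) auto
    also have "\<dots> = 4 / (4 ^ k * \<delta>)"
    proof -
      have "(4::real) ^ j = (2 ^ j)\<^sup>2" by (simp add: power2_eq_square flip: power_mult_distrib)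
      then show ?thesis using assms Suc by (simp add: power_mult_distrib power2_eq_square)
    qed
    moreover have "2 ^ k * \<delta> \<le> 4" using j d Suc by (simp add: mult.commute)
    ultimately show ?thesis by simp
  qed
  then have k4: "k \<in> {k. 2 ^ k * \<delta> \<le> 4}" and kb: "\<delta> / (\<delta> + d)\<^sup>2 \<le> 4 / (4 ^ k * \<delta>)" by auto
  have "w \<in> circle_disc \<theta> (2 ^ k * \<delta>)"
    using k by (simp add: circle_disc_def d_def dist_norm norm_minus_commute)
  then have "\<delta> / (\<delta> + d)\<^sup>2 \<le> 4 / (4 ^ k * \<delta>) * indicator (circle_disc \<theta> (2 ^ k * \<delta>)) w"
    using kb by simp
  also have "\<dots> \<le> (\<Sum>k | 2 ^ k * \<delta> \<le> 4. 4 / (4 ^ k * \<delta>) * indicator (circle_disc \<theta> (2 ^ k * \<delta>)) w)"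
    using fin k4 assms by (intro member_le_sum [where f = "\<lambda>k. 4 / (4 ^ k * \<delta>) * indicator (circle_disc \<theta> (2 ^ k * \<delta>)) w"]) auto
  finally show "\<delta> / (\<delta> + cmod (w - cis \<theta>))\<^sup>2
    \<le> (\<Sum>k | 2 ^ k * \<delta> \<le> 4. 4 / (4 ^ k * \<delta>) * indicator (circle_disc \<theta> (2 ^ k * \<delta>)) w)"
    by (simp add: d_def)
qed

text \<open>On the \<open>k\<close>-th disc the kernel contributes \<open>4 ^ (-k)\<close> and
  \<open>disc_growth\<close> contributes \<open>(4 * q) ^ k\<close>; the product
  \<open>q ^ k\<close> is summable, and 72 = 18 * 4. The constant is fixed before
  \<open>\<nu>\<close> and \<open>D\<close>, because the bound is applied both to the measure inside
  the disc and, with \<open>D = 1\<close>, to \<open>M\<close> itself.\<close>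

lemma (in A2_pair) poisson_kernel_integral_le:
  obtains X where "0 < X"
    "\<And>\<nu> D \<theta> \<delta>. sets \<nu> = sets borel \<Longrightarrow> (AE w in \<nu>. cmod w \<le> 1) \<Longrightarrow> 0 \<le> D \<Longrightarrow> 0 < \<delta> \<Longrightarrow> \<delta> \<le> 1 \<Longrightarrow>
      (\<And>\<rho>. 0 < \<rho> \<Longrightarrow> emeasure \<nu> (circle_disc \<theta> \<rho>) \<le> ennreal (D * measure M (circle_disc \<theta> \<rho>))) \<Longrightarrow>
      (\<integral>\<^sup>+w. ennreal (poisson (of_real (1 - \<delta>) * cis \<theta>) w) \<partial>\<nu>)
        \<le> ennreal (X * D * measure M (circle_disc \<theta> \<delta>) / \<delta>)"
proof -
  obtain C q where C: "0 < C" and q: "0 < q" "q < 1" and growth: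
    "\<And>\<theta> \<delta> k. 0 < \<delta> \<Longrightarrow> \<delta> \<le> 1 \<Longrightarrow> 2 ^ k * \<delta> \<le> 4 \<Longrightarrow>
       measure M (circle_disc \<theta> (2 ^ k * \<delta>)) \<le> C * (4 * q) ^ k * measure M (circle_disc \<theta> \<delta>)"
    using disc_growth by metis
  show ?thesis
  proof (rule that [of "72 * C / (1 - q)"])
    show "0 < 72 * C / (1 - q)" using C q by simp
    fix \<nu> :: "complex measure" and D \<theta> \<delta> :: real
    assume [simp, measurable_cong]: "sets \<nu> = sets borel" and supp: "AE w in \<nu>. cmod w \<le> 1"
      and D: "0 \<le> D" and \<delta>: "0 < \<delta>" "\<delta> \<le> 1"
      and \<nu>: "\<And>\<rho>. 0 < \<rho> \<Longrightarrow> emeasure \<nu> (circle_disc \<theta> \<rho>) \<le> ennreal (D * measure M (circle_disc \<theta> \<rho>))"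
    let ?I = "{k::nat. 2 ^ k * \<delta> \<le> 4}"
    let ?M = "measure M (circle_disc \<theta> \<delta>)"
    have fin: "finite ?I" using kernel_le_dyadic_sum(2) [OF \<delta>, of 0] by simp
    have "(\<integral>\<^sup>+w. ennreal (poisson (of_real (1 - \<delta>) * cis \<theta>) w) \<partial>\<nu>)
      \<le> (\<integral>\<^sup>+w. (\<Sum>k\<in>?I. ennreal (18 * (4 / (4 ^ k * \<delta>))) * indicator (circle_disc \<theta> (2 ^ k * \<delta>)) w) \<partial>\<nu>)"
    proof (rule nn_integral_mono_AE, use supp in eventually_elim)
      fix w :: complex assume w: "cmod w \<le> 1"
      have "poisson (of_real (1 - \<delta>) * cis \<theta>) w \<le> 18 * (\<delta> / (\<delta> + cmod (w - cis \<theta>))\<^sup>2)"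
        using \<delta> w by (intro poisson_bounds) auto
      also have "\<dots> \<le> 18 * (\<Sum>k\<in>?I. 4 / (4 ^ k * \<delta>) * indicator (circle_disc \<theta> (2 ^ k * \<delta>)) w)"
        using \<delta> w by (intro mult_left_mono kernel_le_dyadic_sum) auto
      also have "\<dots> = (\<Sum>k\<in>?I. 18 * (4 / (4 ^ k * \<delta>)) * indicator (circle_disc \<theta> (2 ^ k * \<delta>)) w)"
        by (simp add: sum_distrib_left mult.assoc)
      finally have "ennreal (poisson (of_real (1 - \<delta>) * cis \<theta>) w)
        \<le> ennreal (\<Sum>k\<in>?I. 18 * (4 / (4 ^ k * \<delta>)) * indicator (circle_disc \<theta> (2 ^ k * \<delta>)) w)"
        by (rule ennreal_leI)
      also have "\<dots> = (\<Sum>k\<in>?I. ennreal (18 * (4 / (4 ^ k * \<delta>)) * indicator (circle_disc \<theta> (2 ^ k * \<delta>)) w))"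
        using \<delta> by (subst sum_ennreal) auto
      also have "\<dots> = (\<Sum>k\<in>?I. ennreal (18 * (4 / (4 ^ k * \<delta>))) * indicator (circle_disc \<theta> (2 ^ k * \<delta>)) w)"
        by (intro sum.cong) (auto simp: indicator_def)
      finally show "ennreal (poisson (of_real (1 - \<delta>) * cis \<theta>) w) \<le> \<dots>" .
    qed
    also have "\<dots> = (\<Sum>k\<in>?I. ennreal (18 * (4 / (4 ^ k * \<delta>))) * emeasure \<nu> (circle_disc \<theta> (2 ^ k * \<delta>)))"
      by (subst nn_integral_sum) (auto intro!: sum.cong simp: nn_integral_cmult)
    also have "\<dots> \<le> (\<Sum>k\<in>?I. ennreal (72 * C * D * ?M / \<delta> * q ^ k))"
    proof (rule sum_mono)
      fix k assume k: "k \<in> ?I"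
      have "ennreal (18 * (4 / (4 ^ k * \<delta>))) * emeasure \<nu> (circle_disc \<theta> (2 ^ k * \<delta>))
         \<le> ennreal (18 * (4 / (4 ^ k * \<delta>))) * ennreal (D * measure M (circle_disc \<theta> (2 ^ k * \<delta>)))"
        using \<delta> by (intro mult_left_mono \<nu>) auto
      also have "\<dots> = ennreal (18 * (4 / (4 ^ k * \<delta>)) * (D * measure M (circle_disc \<theta> (2 ^ k * \<delta>))))"
        using \<delta> D by (intro ennreal_mult [symmetric]) auto
      also have "\<dots> \<le> ennreal (18 * (4 / (4 ^ k * \<delta>)) * (D * (C * (4 * q) ^ k * ?M)))"
        using \<delta> D k by (intro ennreal_leI mult_left_mono growth) auto
      also have "18 * (4 / (4 ^ k * \<delta>)) * (D * (C * (4 * q) ^ k * ?M)) = 72 * C * D * ?M / \<delta> * q ^ k"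
        using \<delta> by (simp add: power_mult_distrib)
      finally show "ennreal (18 * (4 / (4 ^ k * \<delta>))) * emeasure \<nu> (circle_disc \<theta> (2 ^ k * \<delta>))
        \<le> ennreal (72 * C * D * ?M / \<delta> * q ^ k)" .
    qed
    also have "\<dots> = ennreal (72 * C * D * ?M / \<delta> * (\<Sum>k\<in>?I. q ^ k))"
      using C D \<delta> q by (subst sum_ennreal) (auto simp: sum_distrib_left)
    also have "\<dots> \<le> ennreal (72 * C * D * ?M / \<delta> * (1 / (1 - q)))"
    proof (intro ennreal_leI mult_left_mono)
      have "(\<Sum>k\<in>?I. q ^ k) \<le> (\<Sum>k. q ^ k)" using q fin by (intro sum_le_suminf) auto
      then show "(\<Sum>k\<in>?I. q ^ k) \<le> 1 / (1 - q)" using q by (simp add: suminf_geometric)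
    qed (use C D \<delta> in auto)
    also have "72 * C * D * ?M / \<delta> * (1 / (1 - q)) = 72 * C / (1 - q) * D * ?M / \<delta>" by simp
    finally show "(\<integral>\<^sup>+w. ennreal (poisson (of_real (1 - \<delta>) * cis \<theta>) w) \<partial>\<nu>)
        \<le> ennreal (72 * C / (1 - q) * D * measure M (circle_disc \<theta> \<delta>) / \<delta>)" .
  qed
qed

section \<open>Dyadic arcs\<close>

text \<open>Half-open, so that the children of an arc partition it exactly. The index is not reduced
  modulo \<open>2 ^ n\<close>: adding \<open>2 ^ n\<close> gives the same arc, hence the window
  condition in \<open>dyadic_arc_disjoint\<close>.\<close>

definition dyadic_arc :: "nat \<Rightarrow> nat \<Rightarrow> complex set" where
  "dyadic_arc n i = cis ` {2 * pi * i / 2 ^ n ..< 2 * pi * (i + 1) / 2 ^ n}"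

definition dyadic_center :: "nat \<Rightarrow> nat \<Rightarrow> real" where
  "dyadic_center n i = pi * (2 * i + 1) / 2 ^ n"

lemma dyadic_arc_subset_arc: "dyadic_arc n i \<subseteq> arc (2 * pi * i / 2 ^ n) (2 * pi * (i + 1) / 2 ^ n)"
  by (auto simp: dyadic_arc_def arc_def)

lemma cis_half_open_measurable: "cis ` {a..<b} \<in> sets borel"
proof -
  have "{a..<b} = (\<Union>k::nat. {a..b - 1 / real (Suc k)})"
  proof (intro equalityI subsetI)
    fix t assume t: "t \<in> {a..<b}"
    then obtain k where "1 / real (Suc k) < b - t" using nat_approx_posE [of "b - t"] by auto
    then show "t \<in> (\<Union>k::nat. {a..b - 1 / real (Suc k)})" using t by (auto intro!: exI [of _ k] simp del: of_nat_Suc)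
  next
    fix t assume "t \<in> (\<Union>k::nat. {a..b - 1 / real (Suc k)})"
    then obtain k :: nat where "a \<le> t" "t \<le> b - 1 / real (Suc k)" by (auto simp del: of_nat_Suc)
    moreover have "0 < 1 / real (Suc k)" by simp
    ultimately show "t \<in> {a..<b}" unfolding atLeastLessThan_iff by linarith
  qed
  then have "cis ` {a..<b} = (\<Union>k::nat. arc a (b - 1 / real (Suc k)))" by (simp add: image_UN arc_def del: of_nat_Suc)
  then show ?thesis by simp
qed

lemma dyadic_arc_measurable [measurable]: "dyadic_arc n i \<in> sets borel"
  unfolding dyadic_arc_def by (rule cis_half_open_measurable)

lemma dyadic_arc_split: "dyadic_arc n i = dyadic_arc (Suc n) (2 * i) \<union> dyadic_arc (Suc n) (2 * i + 1)"
proof -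
  let ?e = "\<lambda>x::real. 2 * pi * x / 2 ^ Suc n"
  have "{2 * pi * i / 2 ^ n ..< 2 * pi * (i + 1) / 2 ^ n} = {?e (2 * i) ..< ?e (2 * i + 2)}"
    by (simp add: add_divide_distrib distrib_left mult.assoc)
  also have "\<dots> = {?e (2 * i) ..< ?e (2 * i + 1)} \<union> {?e (2 * i + 1) ..< ?e (2 * i + 2)}"
    by (intro ivl_disj_un(17) [symmetric] divide_right_mono mult_left_mono) auto
  finally show ?thesis unfolding dyadic_arc_def by (simp add: image_Un add_ac)
qed

lemma cis_eq_imp_eq:
  assumes "cis s = cis t" "\<bar>s - t\<bar> < 2 * pi"
  shows "s = t"
proof -
  have "sin s = sin t \<and> cos s = cos t" using assms by (simp add: complex_eq_iff)
  then obtain j :: int where j: "s = t + 2 * pi * j" by (auto simp: sin_cos_eq_iff)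
  then have "\<bar>real_of_int j\<bar> < 1" using assms(2) by (simp add: abs_mult)
  then have "j = 0" by linarith
  with j show ?thesis by simp
qed

lemma dyadic_arc_disjoint:
  assumes "i \<noteq> j" "i < j + 2 ^ n" "j < i + 2 ^ n"
  shows "dyadic_arc n i \<inter> dyadic_arc n j = {}"
proof (rule ccontr)
  assume "dyadic_arc n i \<inter> dyadic_arc n j \<noteq> {}"
  then obtain s t where eq: "cis s = cis t"
    and s: "2 * pi * i / 2 ^ n \<le> s" "s < 2 * pi * (i + 1) / 2 ^ n"
    and t: "2 * pi * j / 2 ^ n \<le> t" "t < 2 * pi * (j + 1) / 2 ^ n"
    unfolding dyadic_arc_def by auto
  have step: "2 * pi * real (a + 1) / 2 ^ n \<le> 2 * pi * b / 2 ^ n" if "a + 1 \<le> b" for a b :: nat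
    using that by (intro divide_right_mono mult_left_mono) auto
  have per: "2 * pi * real (a + 2 ^ n) / 2 ^ n = 2 * pi * a / 2 ^ n + 2 * pi" for a
    by (simp add: field_simps)
  have "s < t + 2 * pi" using step [of i "j + 2 ^ n"] assms(2) s t per [of j] by simp
  moreover have "t < s + 2 * pi" using step [of j "i + 2 ^ n"] assms(3) s t per [of i] by simp
  ultimately have "s = t" using eq by (intro cis_eq_imp_eq) auto
  moreover have "i + 1 \<le> j \<or> j + 1 \<le> i" using assms(1) by linarith
  ultimately show False using step [of i j] step [of j i] s t by auto
qed

lemma dyadic_arc_children_disjoint: "dyadic_arc (Suc n) (2 * i) \<inter> dyadic_arc (Suc n) (2 * i + 1) = {}"
proof (rule dyadic_arc_disjoint)
  have "(1::nat) \<le> 2 ^ n" by simp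
  then show "2 * i < 2 * i + 1 + 2 ^ Suc n" "2 * i + 1 < 2 * i + 2 ^ Suc n" unfolding power_Suc by linarith+
qed simp

lemma dyadic_arc_subset_disc: "dyadic_arc n i \<subseteq> circle_disc (dyadic_center n i) (pi / 2 ^ n)"
proof -
  have "2 * pi * i / 2 ^ n = dyadic_center n i - pi / 2 ^ n"
    "2 * pi * (i + 1) / 2 ^ n = dyadic_center n i + pi / 2 ^ n"
    by (auto simp: dyadic_center_def field_simps)
  then show ?thesis using dyadic_arc_subset_arc [of n i] arc_subset_circle_disc by (metis subset_trans)
qed

lemma circle_disc_shift:
  assumes "z \<in> circle_disc \<theta> \<rho>" "cmod (cis \<theta> - cis \<theta>') + \<rho> \<le> \<rho>'"
  shows "z \<in> circle_disc \<theta>' \<rho>'"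
proof -
  have "dist (cis \<theta>') z \<le> dist (cis \<theta>') (cis \<theta>) + dist (cis \<theta>) z" by (rule dist_triangle)
  then show ?thesis using assms by (simp add: circle_disc_def dist_norm norm_minus_commute)
qed

lemma dyadic_arc_length:
  shows "2 * pi * real i / 2 ^ n < 2 * pi * (real i + 1) / 2 ^ n"
    and "2 * pi * (real i + 1) / 2 ^ n \<le> 2 * pi * real i / 2 ^ n + 2 * pi"
proof -
  have "2 * pi * (real i + 1) / 2 ^ n = 2 * pi * real i / 2 ^ n + 2 * pi / 2 ^ n" by (simp add: field_simps)
  moreover have "2 * pi / 2 ^ n \<le> 2 * pi / 1" by (intro divide_left_mono) auto
  moreover have "0 < 2 * pi / 2 ^ n" by simp
  ultimately show "2 * pi * real i / 2 ^ n < 2 * pi * (real i + 1) / 2 ^ n"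
    "2 * pi * (real i + 1) / 2 ^ n \<le> 2 * pi * real i / 2 ^ n + 2 * pi" by linarith+
qed

lemma measure_dyadic_arc_hull:
  "measure circle_measure (arc (2 * pi * i / 2 ^ n) (2 * pi * (real i + 1) / 2 ^ n)) = 1 / 2 ^ n"
  using dyadic_arc_length [of i n] by (subst measure_arc) (auto simp: field_simps)

lemma measure_dyadic_arc: "measure circle_measure (dyadic_arc n i) = 1 / 2 ^ n"
proof -
  let ?a = "2 * pi * i / 2 ^ n" and ?b = "2 * pi * (real i + 1) / 2 ^ n"
  have "measure circle_measure (arc ?a ?b) \<le> measure circle_measure (dyadic_arc n i \<union> arc ?b ?b)"
  proof (intro circle.finite_measure_mono subsetI)
    fix z assume "z \<in> arc ?a ?b"
    then obtain t where "z = cis t" "?a \<le> t" "t \<le> ?b" by (auto simp: arc_def)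
    then show "z \<in> dyadic_arc n i \<union> arc ?b ?b"
      by (cases "t = ?b") (auto simp: arc_def dyadic_arc_def add.commute)
  qed simp
  also have "\<dots> \<le> measure circle_measure (dyadic_arc n i) + measure circle_measure (arc ?b ?b)"
    by (intro measure_Un_le) auto
  also have "measure circle_measure (arc ?b ?b) = 0" by (subst measure_arc) auto
  finally have "1 / 2 ^ n \<le> measure circle_measure (dyadic_arc n i)"
    unfolding measure_dyadic_arc_hull by simp
  moreover have "measure circle_measure (dyadic_arc n i) \<le> 1 / 2 ^ n"
    using dyadic_arc_subset_arc [of n i] unfolding measure_dyadic_arc_hull [of i n, symmetric]
    by (intro circle.finite_measure_mono) (auto simp: add.commute)
  ultimately show ?thesis by simp
qed

lemma sphere_dyadic_arc:
  assumes "cmod z = 1"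
  obtains i where "i < 2 ^ n" "z \<in> dyadic_arc n i"
proof -
  define t where "t = Arg2pi z"
  have t: "0 \<le> t" "t < 2 * pi" using Arg2pi [of z] by (auto simp: t_def)
  have z: "z = cis t" using Arg2pi [of z] assms by (simp add: t_def is_Arg_def cis_conv_exp)
  define x where "x = t * 2 ^ n / (2 * pi)"
  have x: "0 \<le> x" "x < 2 ^ n" using t by (auto simp: x_def field_simps)
  have fl: "real (nat \<lfloor>x\<rfloor>) \<le> x" "x < real (nat \<lfloor>x\<rfloor>) + 1" using x by linarith+
  have tx: "t = 2 * pi * x / 2 ^ n" by (simp add: x_def)
  show ?thesis
  proof (rule that [of "nat \<lfloor>x\<rfloor>"])
    have "real (nat \<lfloor>x\<rfloor>) < 2 ^ n" using fl x by linarith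
    then show "nat \<lfloor>x\<rfloor> < 2 ^ n" by (metis of_nat_less_iff of_nat_numeral of_nat_power)
    have "2 * pi * real (nat \<lfloor>x\<rfloor>) / 2 ^ n \<le> t"
      unfolding tx using fl by (intro divide_right_mono mult_left_mono) auto
    moreover have "t < 2 * pi * (real (nat \<lfloor>x\<rfloor>) + 1) / 2 ^ n"
      unfolding tx by (intro divide_strict_right_mono mult_strict_left_mono fl) auto
    ultimately show "z \<in> dyadic_arc n (nat \<lfloor>x\<rfloor>)"
      unfolding z dyadic_arc_def by (intro imageI) (simp add: add.commute)
  qed
qed

text \<open>A packing argument. If \<open>z\<close> lies in several of these discs, their centres
  are within \<open>12 / 2 ^ n\<close> of each other, so the corresponding disjoint arcs, each of
  length \<open>1 / 2 ^ n\<close>, fit into one disc of radius \<open>16 / 2 ^ n\<close> (using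
  \<open>pi < 4\<close>), whose length is at most \<open>8 / 2 ^ n\<close>.\<close>

lemma dyadic_disc_overlap:
  assumes "finite L" and L: "\<And>i j. i \<in> L \<Longrightarrow> j \<in> L \<Longrightarrow> i < j + 2 ^ n"
  shows "(\<Sum>i\<in>L. indicator (circle_disc (dyadic_center n i) (6 / 2 ^ n)) z) \<le> (8::real)"
proof -
  define A where "A = {i \<in> L. z \<in> circle_disc (dyadic_center n i) (6 / 2 ^ n)}"
  have finA: "finite A" using assms by (simp add: A_def)
  have "(\<Sum>i\<in>L. indicator (circle_disc (dyadic_center n i) (6 / 2 ^ n)) z) = real (card A)"
    using assms(1) by (simp add: A_def indicator_def sum.If_cases Int_def)
  also have "\<dots> \<le> 8"
  proof (cases "A = {}")
    case False
    then obtain j where j: "j \<in> A" by auto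
    have "real (card A) / 2 ^ n = (\<Sum>i\<in>A. measure circle_measure (dyadic_arc n i))"
      by (simp add: measure_dyadic_arc)
    also have "\<dots> = measure circle_measure (\<Union>i\<in>A. dyadic_arc n i)"
    proof (rule circle.finite_measure_finite_Union [symmetric, OF finA])
      show "disjoint_family_on (dyadic_arc n) A"
        unfolding disjoint_family_on_def
      proof (intro ballI impI)
        fix a b assume "a \<in> A" "b \<in> A" "a \<noteq> b"
        then show "dyadic_arc n a \<inter> dyadic_arc n b = {}"
          using L by (intro dyadic_arc_disjoint) (auto simp: A_def)
      qed
    qed auto
    also have "\<dots> \<le> measure circle_measure (circle_disc (dyadic_center n j) (16 / 2 ^ n))"
    proof (intro circle.finite_measure_mono UN_least)
      fix i assume "i \<in> A"
      then have "cmod (cis (dyadic_center n i) - z) \<le> 6 / 2 ^ n" "cmod (cis (dyadic_center n j) - z) \<le> 6 / 2 ^ n"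
        using j by (auto simp: A_def circle_disc_def dist_norm)
      then have "cmod (cis (dyadic_center n i) - cis (dyadic_center n j)) \<le> 12 / 2 ^ n"
        using norm_triangle_ineq4 [of "cis (dyadic_center n i) - z" "cis (dyadic_center n j) - z"] by simp
      moreover have "pi / 2 ^ n \<le> 4 / 2 ^ n" using pi_less_4 by (intro divide_right_mono) auto
      ultimately show "dyadic_arc n i \<subseteq> circle_disc (dyadic_center n j) (16 / 2 ^ n)"
        using dyadic_arc_subset_disc [of n i] by (auto intro: circle_disc_shift)
    qed simp
    also have "\<dots> \<le> (16 / 2 ^ n) / 2" by (intro measure_circle_disc_le) simp
    finally show ?thesis by (simp add: field_simps)
  qed simp
  finally show ?thesis .
qed

lemma truncated_geometric_sum:
  fixes x :: real
  assumes "0 \<le> x"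
  shows "(\<Sum>k<d. if 2 ^ k * x \<le> 6 then 2 ^ k * x else 0) \<le> 12"
proof -
  \<comment> \<open>The second entry of the minimum carries the induction: a new term
    \<open>2 ^ d * x\<close>, present only if it is at most 6, at most doubles the bound
    \<open>2 ^ d * x\<close>, which stays below 12.\<close>
  have "(\<Sum>k<d. if 2 ^ k * x \<le> 6 then 2 ^ k * x else 0) \<le> min 12 (2 ^ d * x)"
    using assms by (induction d) (auto simp: mult_ac split: if_splits)
  then show ?thesis by simp
qed

section \<open>Tents over dyadic arcs and the dyadic bound for the Poisson kernel\<close>

text \<open>The height of \<open>z\<close> relative to the arc, cut off to an enlarged tent above
  it. If \<open>\<zeta>\<close> lies in the arc at distance about \<open>2 ^ (-n)\<close> from
  \<open>z\<close>, the kernel is at most \<open>2 * tent_weight * 2 ^ n\<close>, with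
  \<open>2 ^ n\<close> the reciprocal length of the arc. The radius 6 is 4 (an arc point to the
  centre, as \<open>pi < 4\<close>) plus 2 (that point to \<open>z\<close>).\<close>

definition tent_weight :: "nat \<Rightarrow> nat \<Rightarrow> complex \<Rightarrow> real" where
  "tent_weight n i z = (1 - cmod z) * 2 ^ n * indicator (circle_disc (dyadic_center n i) (6 / 2 ^ n)) z"

lemma measurable_tent_weight [measurable]: "tent_weight n i \<in> borel_measurable borel"
  unfolding tent_weight_def by measurable

lemma tent_weight_nonneg: "cmod z \<le> 1 \<Longrightarrow> 0 \<le> tent_weight n i z"
  by (simp add: tent_weight_def)

lemma circle_disc_dist_boundary:
  assumes "z \<in> circle_disc \<theta> \<rho>"
  shows "1 - cmod z \<le> \<rho>"
  using assms norm_triangle_ineq2 [of "cis \<theta>" z] by (simp add: circle_disc_def dist_norm)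

text \<open>At each level at most 8 tents contain \<open>z\<close>, each of weight
  \<open>2 ^ k * x\<close>, and none does once \<open>2 ^ k * x > 6\<close>, because the tents are
  then too low. The truncated geometric series gives 8 * 12 = 96.\<close>

lemma subtree_sum_tent_weight_le_96:
  assumes "cmod z \<le> 1"
  shows "subtree_sum (\<lambda>n i. tent_weight n i z) d n i \<le> 96"
proof -
  define x where "x = (1 - cmod z) * 2 ^ n"
  have x: "0 \<le> x" using assms by (simp add: x_def)
  have level: "(\<Sum>l<2 ^ k. tent_weight (n + k) (2 ^ k * i + l) z)
    \<le> 8 * (if 2 ^ k * x \<le> 6 then 2 ^ k * x else 0)" for k
  proof (cases "2 ^ k * x \<le> 6")
    case True
    let ?I = "\<lambda>j. indicator (circle_disc (dyadic_center (n + k) j) (6 / 2 ^ (n + k))) z :: real"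
    have "(\<Sum>l<2 ^ k. tent_weight (n + k) (2 ^ k * i + l) z) = 2 ^ k * x * (\<Sum>l<2 ^ k. ?I (2 ^ k * i + l))"
      by (simp add: tent_weight_def x_def sum_distrib_left power_add mult_ac)
    also have "(\<Sum>l<2 ^ k. ?I (2 ^ k * i + l)) = (\<Sum>j\<in>(\<lambda>l. 2 ^ k * i + l) ` {..<2 ^ k}. ?I j)"
      by (subst sum.reindex) (auto simp: inj_on_def)
    finally have split: "(\<Sum>l<2 ^ k. tent_weight (n + k) (2 ^ k * i + l) z)
      = 2 ^ k * x * (\<Sum>j\<in>(\<lambda>l. 2 ^ k * i + l) ` {..<2 ^ k}. ?I j)" .
    have "(\<Sum>j\<in>(\<lambda>l. 2 ^ k * i + l) ` {..<2 ^ k}. ?I j) \<le> 8"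
    proof (rule dyadic_disc_overlap)
      fix a b assume "a \<in> (\<lambda>l. 2 ^ k * i + l) ` {..<2 ^ k}" "b \<in> (\<lambda>l. 2 ^ k * i + l) ` {..<2 ^ k}"
      then have "a < b + 2 ^ k" by auto
      also have "(2::nat) ^ k \<le> 2 ^ (n + k)" by (intro power_increasing) auto
      finally show "a < b + 2 ^ (n + k)" by simp
    qed simp
    then have "2 ^ k * x * (\<Sum>j\<in>(\<lambda>l. 2 ^ k * i + l) ` {..<2 ^ k}. ?I j) \<le> 2 ^ k * x * 8"
      using x by (intro mult_left_mono) auto
    then show ?thesis using True unfolding split by simp
  next
    case False
    have "tent_weight (n + k) j z = 0" for j
    proof (rule ccontr)
      assume "tent_weight (n + k) j z \<noteq> 0"
      then have "1 - cmod z \<le> 6 / 2 ^ (n + k)"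
        by (intro circle_disc_dist_boundary) (auto simp: tent_weight_def split: split_indicator_asm)
      then have "2 ^ k * x \<le> 6" by (simp add: x_def power_add field_simps)
      with False show False by simp
    qed
    then show ?thesis using False by simp
  qed
  have "subtree_sum (\<lambda>n i. tent_weight n i z) d n i \<le> (\<Sum>k<d. 8 * (if 2 ^ k * x \<le> 6 then 2 ^ k * x else 0))"
    unfolding subtree_sum_def by (intro sum_mono level)
  also have "\<dots> \<le> 8 * 12"
    unfolding sum_distrib_left [symmetric] using truncated_geometric_sum [OF x] by (intro mult_left_mono) auto
  finally show ?thesis by simp
qed

text \<open>Localization of the previous bound: centres of descendants stay within
  \<open>4 / 2 ^ n\<close> of the centre of the root, and their tents have radius at most
  \<open>6 / 2 ^ n\<close>, so all of them lie in the disc of radius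
  \<open>10 / 2 ^ n\<close>.\<close>

lemma subtree_sum_tent_weight_le:
  assumes "cmod z \<le> 1"
  shows "subtree_sum (\<lambda>n i. tent_weight n i z) d n i
    \<le> 96 * indicator (circle_disc (dyadic_center n i) (10 / 2 ^ n)) z"
proof (cases "z \<in> circle_disc (dyadic_center n i) (10 / 2 ^ n)")
  case True
  then show ?thesis using subtree_sum_tent_weight_le_96 [OF assms] by simp
next
  case False
  have "tent_weight (n + k) (2 ^ k * i + l) z = 0" if l: "l < 2 ^ k" for k l
  proof (rule ccontr)
    let ?c = "dyadic_center (n + k) (2 ^ k * i + l)"
    assume "tent_weight (n + k) (2 ^ k * i + l) z \<noteq> 0"
    then have z: "z \<in> circle_disc ?c (6 / 2 ^ (n + k))"
      by (auto simp: tent_weight_def split: split_indicator_asm)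
    have "real l + 1 \<le> real (2 ^ k)" using l by (metis Suc_eq_plus1 Suc_leI of_nat_1 of_nat_add of_nat_le_iff)
    then have l': "\<bar>2 * real l + 1 - 2 ^ k\<bar> \<le> 2 ^ k" by auto
    have "?c - dyadic_center n i = pi * (2 * real l + 1 - 2 ^ k) / 2 ^ (n + k)"
      by (simp add: dyadic_center_def power_add field_simps)
    then have "\<bar>?c - dyadic_center n i\<bar> = pi * \<bar>2 * real l + 1 - 2 ^ k\<bar> / 2 ^ (n + k)"
      by (simp add: abs_mult)
    also have "\<dots> \<le> pi * 2 ^ k / 2 ^ (n + k)" using l' by (intro divide_right_mono mult_left_mono) auto
    also have "\<dots> = pi / 2 ^ n" by (simp add: power_add)
    also have "\<dots> \<le> 4 / 2 ^ n" using pi_less_4 by (intro divide_right_mono) auto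
    finally have "cmod (cis ?c - cis (dyadic_center n i)) \<le> 4 / 2 ^ n"
      using norm_cis_diff_le order_trans by blast
    moreover have "(6::real) / 2 ^ (n + k) \<le> 6 / 2 ^ n"
      by (intro divide_left_mono power_increasing) auto
    ultimately have "z \<in> circle_disc (dyadic_center n i) (10 / 2 ^ n)"
      by (intro circle_disc_shift [OF z]) simp
    with False show False by simp
  qed
  then show ?thesis using False by (simp add: subtree_sum_def)
qed

text \<open>A single term dominates: \<open>n\<close> is the first level with
  \<open>2 ^ (-n)\<close> below the distance from \<open>\<zeta>\<close> to \<open>z\<close>, so
  this distance is at most \<open>2 / 2 ^ n\<close>, and \<open>i\<close> is the arc containing
  \<open>\<zeta>\<close>. The hypothesis on \<open>N\<close> ensures \<open>n <= N\<close>, since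
  the distance is at least \<open>1 - cmod z\<close>.\<close>

lemma poisson_le_dyadic_sum:
  assumes z: "cmod z < 1" and N: "1 < 2 ^ N * (1 - cmod z)" and \<zeta>: "cmod \<zeta> = 1"
  shows "poisson z \<zeta> \<le> subtree_sum (\<lambda>n i. 2 * tent_weight n i z * 2 ^ n * indicator (dyadic_arc n i) \<zeta>) (Suc N) 0 0"
proof -
  define d where "d = cmod (\<zeta> - z)"
  have d: "1 - cmod z \<le> d" "d \<le> 2"
    using norm_triangle_ineq2 [of \<zeta> z] norm_triangle_ineq4 [of \<zeta> z] z \<zeta> by (auto simp: d_def)
  have "2 ^ N * (1 - cmod z) \<le> 2 ^ N * d" using d by (intro mult_left_mono) auto
  with N have Nd: "1 < 2 ^ N * d" by linarith
  define n where "n = (LEAST n. 1 < 2 ^ n * d)"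
  have n: "1 < 2 ^ n * d" unfolding n_def using Nd by (rule LeastI)
  have nN: "n \<le> N" unfolding n_def using Nd by (rule Least_le)
  have dn: "d \<le> 2 / 2 ^ n"
  proof (cases n)
    case (Suc j)
    then have "\<not> 1 < 2 ^ j * d" using not_less_Least [of j "\<lambda>n. 1 < 2 ^ n * d"] n_def by auto
    then show ?thesis using Suc by (simp add: field_simps)
  qed (use d in simp)
  obtain i where i: "i < 2 ^ n" "\<zeta> \<in> dyadic_arc n i" using \<zeta> by (rule sphere_dyadic_arc)
  have "dist (cis (dyadic_center n i)) \<zeta> \<le> pi / 2 ^ n"
    using i dyadic_arc_subset_disc [of n i] by (auto simp: circle_disc_def)
  moreover have "pi / 2 ^ n \<le> 4 / 2 ^ n" using pi_less_4 by (intro divide_right_mono) auto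
  moreover have "dist \<zeta> z \<le> 2 / 2 ^ n" using dn by (simp add: d_def dist_norm)
  ultimately have "dist (cis (dyadic_center n i)) z \<le> 6 / 2 ^ n"
    using dist_triangle [of "cis (dyadic_center n i)" z \<zeta>] by simp
  then have tw: "tent_weight n i z = (1 - cmod z) * 2 ^ n"
    by (simp add: tent_weight_def circle_disc_def)
  have "1 \<le> (2 ^ n * d)\<^sup>2" using n by (simp add: one_le_power)
  then have "1 / d\<^sup>2 \<le> 2 ^ n * 2 ^ n"
    using d z by (simp add: divide_le_eq power2_eq_square mult_ac)
  then have "2 * (1 - cmod z) * (1 / d\<^sup>2) \<le> 2 * (1 - cmod z) * (2 ^ n * 2 ^ n)"
    using z by (intro mult_left_mono) auto
  then have "poisson z \<zeta> \<le> 2 * tent_weight n i z * 2 ^ n * indicator (dyadic_arc n i) \<zeta>"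
    using poisson_le_circle [OF z \<zeta>] i by (simp add: tw d_def algebra_simps)
  also have "\<dots> = (\<lambda>n i. 2 * tent_weight n i z * 2 ^ n * indicator (dyadic_arc n i) \<zeta>) (0 + n) (2 ^ n * 0 + i)"
    by simp
  also have "\<dots> \<le> subtree_sum (\<lambda>n i. 2 * tent_weight n i z * 2 ^ n * indicator (dyadic_arc n i) \<zeta>) (Suc N) 0 0"
    using z nN i by (intro subtree_sum_term_le) (auto intro!: mult_nonneg_nonneg tent_weight_nonneg)
  finally show ?thesis .
qed

section \<open>The weighted Carleson embedding\<close>

lemma measure_dyadic_arc_split:
  assumes "finite_measure \<phi>" "sets \<phi> = sets borel"
  shows "measure \<phi> (dyadic_arc n i)
    = measure \<phi> (dyadic_arc (Suc n) (2 * i)) + measure \<phi> (dyadic_arc (Suc n) (2 * i + 1))"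
  unfolding dyadic_arc_split [of n i]
  using assms by (intro finite_measure.finite_measure_Union dyadic_arc_children_disjoint) auto

context A2_pair
begin

lemma dyadic_pos: "0 < measure M (dyadic_arc n i)"
  by (rule measure_pos) (auto simp: measure_dyadic_arc)

lemma A2_dyadic: "measure M (dyadic_arc n i) * measure S (dyadic_arc n i) \<le> K / 4 ^ n"
proof -
  let ?A = "arc (2 * pi * i / 2 ^ n) (2 * pi * (real i + 1) / 2 ^ n)"
  have sub: "dyadic_arc n i \<subseteq> ?A" using dyadic_arc_subset_arc [of n i] by (simp add: add.commute)
  have "measure M (dyadic_arc n i) * measure S (dyadic_arc n i) \<le> measure M ?A * measure S ?A"
    using sub by (intro mult_mono M.finite_measure_mono S.finite_measure_mono) auto
  also have "\<dots> \<le> K * (measure circle_measure ?A)\<^sup>2"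
    by (intro A2_arc dyadic_arc_length)
  also have "\<dots> = K / 4 ^ n"
    unfolding measure_dyadic_arc_hull by (simp add: power_divide power2_eq_square flip: power_mult_distrib)
  finally show ?thesis .
qed

lemma disc_le_dyadic:
  "measure M (circle_disc (dyadic_center n i) (10 / 2 ^ n)) \<le> 25 * K * measure M (dyadic_arc n i)"
proof -
  have "pi / 2 ^ n \<le> 10 / 2 ^ n" using pi_less_4 by (intro divide_right_mono) auto
  then have "dyadic_arc n i \<subseteq> circle_disc (dyadic_center n i) (10 / 2 ^ n)"
    using dyadic_arc_subset_disc circle_disc_mono by (metis subset_trans)
  then have "(1 / 2 ^ n)\<^sup>2 * measure M (circle_disc (dyadic_center n i) (10 / 2 ^ n))
      \<le> K * (10 / 2 ^ n / 2)\<^sup>2 * measure M (dyadic_arc n i)"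
    using measure_disc_compare [of "10 / 2 ^ n" "dyadic_arc n i" "dyadic_center n i"]
    by (simp add: measure_dyadic_arc)
  also have "\<dots> = (1 / 2 ^ n)\<^sup>2 * (25 * K * measure M (dyadic_arc n i))"
    by (simp add: power_divide)
  finally show ?thesis by (subst (asm) mult_le_cancel_left_pos) auto
qed

text \<open>The average \<open>2 ^ n * \<phi>(J)\<close> is written as
  \<open>\<phi>(J) / S(J)\<close> times the average of \<open>S\<close>. The first factor is what
  the embedding relative to \<open>S\<close> controls, since \<open>cs\<close> is Cauchy-Schwarz
  with respect to \<open>S\<close>; the square of the second is absorbed into the coefficients
  \<open>c\<close>.\<close>

lemma dyadic_carleson_embedding:
  assumes b: "\<And>n i. 0 \<le> b n i" and D: "0 < D"
    and carleson: "\<And>d n i. subtree_sum b d n i \<le> D * measure M (dyadic_arc n i)"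
    and \<phi>: "finite_measure \<phi>" "sets \<phi> = sets borel"
    and \<Phi>: "finite_measure \<Phi>" "sets \<Phi> = sets borel"
    and cs: "\<And>E. E \<in> sets borel \<Longrightarrow> (measure \<phi> E)\<^sup>2 \<le> measure \<Phi> E * measure S E"
  shows "subtree_sum (\<lambda>n i. b n i * (2 ^ n * measure \<phi> (dyadic_arc n i))\<^sup>2) d n i
    \<le> 16 * K\<^sup>2 * D * measure \<Phi> (dyadic_arc n i)"
proof -
  interpret SM: A2_pair S M K by (rule swap)
  let ?M = "\<lambda>n i. measure M (dyadic_arc n i)" and ?S = "\<lambda>n i. measure S (dyadic_arc n i)"
  let ?m = "\<lambda>n i. measure circle_measure (dyadic_arc n i)"
  \<comment> \<open>Here arc length plays the role of \<open>f\<close>, \<open>M\<close> that of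
    \<open>s\<close>, and \<open>S\<close> that of the energy \<open>F\<close>; the required
    inequality is \<open>cauchy_schwarz\<close>.\<close>
  have step1: "subtree_sum (\<lambda>n i. b n i * (?m n i / ?M n i)\<^sup>2) d n i \<le> 4 * D * ?S n i" for d n i
  proof (rule carleson_embedding_tree)
    show "(?m n i)\<^sup>2 \<le> ?S n i * ?M n i" for n i
      using cauchy_schwarz [of "dyadic_arc n i"] by (simp add: mult.commute)
  qed (intro b dyadic_pos D carleson measure_dyadic_arc_split circle.finite_measure_axioms
      M.finite_measure_axioms S.finite_measure_axioms sets_M sets_S sets_circle_measure)+
  define c where "c = (\<lambda>n i. b n i * (2 ^ n * ?S n i)\<^sup>2)"
  \<comment> \<open>By \<open>A2\<close> the average of \<open>S\<close> is at most \<open>K\<close>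
    divided by the average of \<open>M\<close>, so \<open>step1\<close> applies to these
    coefficients.\<close>
  have c_le: "c n i \<le> K\<^sup>2 * (b n i * (?m n i / ?M n i)\<^sup>2)" for n i
  proof -
    have "2 ^ n * ?S n i \<le> K * (?m n i / ?M n i)"
    proof -
      have "?S n i \<le> K / 4 ^ n / ?M n i"
        using A2_dyadic [of n i] dyadic_pos [of n i] by (simp add: field_simps)
      then have "2 ^ n * ?S n i \<le> 2 ^ n * (K / 4 ^ n / ?M n i)" by (intro mult_left_mono) auto
      also have "\<dots> = K * (?m n i / ?M n i)"
      proof -
        have "(4::real) ^ n = 2 ^ n * 2 ^ n" by (simp flip: power_mult_distrib)
        then show ?thesis by (simp add: measure_dyadic_arc)
      qed
      finally show ?thesis .
    qed
    then have "(2 ^ n * ?S n i)\<^sup>2 \<le> (K * (?m n i / ?M n i))\<^sup>2" by (intro power_mono) auto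
    then have "b n i * (2 ^ n * ?S n i)\<^sup>2 \<le> b n i * (K * (?m n i / ?M n i))\<^sup>2"
      by (intro mult_left_mono b)
    then show ?thesis by (simp add: c_def power_mult_distrib power_divide mult_ac)
  qed
  have c_carleson: "subtree_sum c d n i \<le> (4 * K\<^sup>2 * D) * ?S n i" for d n i
  proof -
    have "subtree_sum c d n i \<le> subtree_sum (\<lambda>n i. K\<^sup>2 * (b n i * (?m n i / ?M n i)\<^sup>2)) d n i"
      by (intro subtree_sum_mono c_le)
    also have "\<dots> \<le> K\<^sup>2 * (4 * D * ?S n i)"
      unfolding subtree_sum_cmult by (intro mult_left_mono step1) auto
    finally show ?thesis by (simp add: mult_ac)
  qed
  have "subtree_sum (\<lambda>n i. c n i * (measure \<phi> (dyadic_arc n i) / ?S n i)\<^sup>2) d n i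
    \<le> 4 * (4 * K\<^sup>2 * D) * measure \<Phi> (dyadic_arc n i)"
  proof (rule carleson_embedding_tree)
    show "0 < 4 * K\<^sup>2 * D" using K_pos D by simp
    show "0 \<le> c n i" for n i using b by (simp add: c_def)
    show "(measure \<phi> (dyadic_arc n i))\<^sup>2 \<le> measure \<Phi> (dyadic_arc n i) * ?S n i" for n i
      by (intro cs) simp
  qed (intro SM.dyadic_pos c_carleson measure_dyadic_arc_split \<phi> \<Phi>
      M.finite_measure_axioms S.finite_measure_axioms sets_M sets_S)+
  also have "(\<lambda>n i. c n i * (measure \<phi> (dyadic_arc n i) / ?S n i)\<^sup>2)
      = (\<lambda>n i. b n i * (2 ^ n * measure \<phi> (dyadic_arc n i))\<^sup>2)"
    using SM.dyadic_pos by (intro ext) (simp add: c_def power_mult_distrib power_divide less_imp_neq [symmetric])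
  finally show ?thesis by (simp add: mult_ac)
qed

end

lemma subtree_sum_cauchy_schwarz:
  assumes "\<And>n i. 0 \<le> w n i"
  shows "(subtree_sum (\<lambda>n i. w n i * x n i) d n i)\<^sup>2
    \<le> subtree_sum w d n i * subtree_sum (\<lambda>n i. w n i * (x n i)\<^sup>2) d n i"
proof -
  let ?T = "SIGMA k:{..<d}. {..<(2::nat) ^ k}"
  have eq: "subtree_sum a d n i = (\<Sum>(k, l)\<in>?T. a (n + k) (2 ^ k * i + l))" for a
    unfolding subtree_sum_def by (subst sum.Sigma) auto
  define W where "W = (\<lambda>(k, l). w (n + k) (2 ^ k * i + l))"
  define X where "X = (\<lambda>(k, l). x (n + k) (2 ^ k * i + l))"
  have W: "0 \<le> W p" for p using assms by (auto simp: W_def split: prod.split)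
  have "(\<Sum>p\<in>?T. W p * X p)\<^sup>2 = (\<Sum>p\<in>?T. sqrt (W p) * (sqrt (W p) * X p))\<^sup>2"
    using W by (simp flip: mult.assoc)
  also have "\<dots> \<le> (\<Sum>p\<in>?T. (sqrt (W p))\<^sup>2) * (\<Sum>p\<in>?T. (sqrt (W p) * X p)\<^sup>2)"
    by (rule Cauchy_Schwarz_ineq_sum)
  also have "\<dots> = (\<Sum>p\<in>?T. W p) * (\<Sum>p\<in>?T. W p * (X p)\<^sup>2)"
    using W by (simp add: power_mult_distrib)
  finally show ?thesis unfolding eq W_def X_def by (simp add: case_prod_unfold)
qed

lemma integral_subtree_sum:
  assumes "\<And>n i. integrable N (a n i)"
  shows "integrable N (\<lambda>z. subtree_sum (\<lambda>n i. a n i z) d n i)"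
    and "(\<integral>z. subtree_sum (\<lambda>n i. a n i z) d n i \<partial>N) = subtree_sum (\<lambda>n i. \<integral>z. a n i z \<partial>N) d n i"
  unfolding subtree_sum_def using assms by auto

lemma integrable_tent_weight:
  assumes "finite_measure \<nu>" "sets \<nu> = sets borel" "AE z in \<nu>. cmod z < 1"
  shows "integrable \<nu> (tent_weight n i)"
proof -
  interpret finite_measure \<nu> by fact
  have [measurable_cong]: "sets \<nu> = sets borel" by fact
  show ?thesis
  proof (rule integrable_const_bound [where B = "2 ^ n"])
    show "AE z in \<nu>. norm (tent_weight n i z) \<le> 2 ^ n"
      using assms(3) by eventually_elim (auto simp: tent_weight_def indicator_def mult_left_le_one_le)
  qed simp
qed

lemma poisson_le_inverse:
  assumes "cmod z < 1" "cmod w \<le> 1"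
  shows "poisson z w \<le> 2 / (1 - cmod z)"
proof -
  have "cmod (cnj z * w) \<le> cmod z" using assms by (simp add: norm_mult mult_left_le)
  then have a: "1 - cmod z \<le> cmod (1 - cnj z * w)"
    using norm_triangle_ineq2 [of 1 "cnj z * w"] by simp
  have "poisson z w \<le> (1 - (cmod z)\<^sup>2) / (1 - cmod z)\<^sup>2"
    unfolding poisson_def using assms a
    by (intro divide_left_mono power_mono mult_pos_pos zero_less_power) (auto simp: abs_square_le_1)
  also have "\<dots> = (1 + cmod z) / (1 - cmod z)"
  proof -
    have "1 - (cmod z)\<^sup>2 = (1 + cmod z) * (1 - cmod z)" by (simp add: power2_eq_square algebra_simps)
    then show ?thesis using assms by (simp add: power2_eq_square)
  qed
  also have "\<dots> \<le> 2 / (1 - cmod z)" using assms by (intro divide_right_mono) auto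
  finally show ?thesis .
qed

lemma integrable_poisson:
  assumes "finite_measure \<phi>" "sets \<phi> = sets borel" "AE \<zeta> in \<phi>. cmod \<zeta> = 1" "cmod z < 1"
  shows "integrable \<phi> (poisson z)"
proof -
  interpret finite_measure \<phi> by fact
  have [measurable_cong]: "sets \<phi> = sets borel" by fact
  show ?thesis
  proof (rule integrable_const_bound [where B = "2 / (1 - cmod z)"])
    show "AE \<zeta> in \<phi>. norm (poisson z \<zeta>) \<le> 2 / (1 - cmod z)"
      using assms(3) by eventually_elim (use assms(4) in \<open>auto simp: poisson_nonneg poisson_le_inverse\<close>)
  qed simp
qed

text \<open>Cauchy-Schwarz with the tent weights as weights moves the square onto the averages. It
  is affordable because the total tent weight at \<open>z\<close> is at most 96, so 384 = 4 *
  96.\<close>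

lemma poisson_integral_square_le:
  assumes \<phi>: "finite_measure \<phi>" "sets \<phi> = sets borel" "AE \<zeta> in \<phi>. cmod \<zeta> = 1"
    and z: "cmod z < 1" and N: "1 < 2 ^ N * (1 - cmod z)"
  shows "(\<integral>\<zeta>. poisson z \<zeta> \<partial>\<phi>)\<^sup>2
    \<le> 384 * subtree_sum (\<lambda>n i. tent_weight n i z * (2 ^ n * measure \<phi> (dyadic_arc n i))\<^sup>2) (Suc N) 0 0"
proof -
  interpret finite_measure \<phi> by fact
  have [measurable_cong, simp]: "sets \<phi> = sets borel" by fact
  let ?a = "\<lambda>n i \<zeta>. 2 * tent_weight n i z * 2 ^ n * indicator (dyadic_arc n i) \<zeta>"
  have int: "integrable \<phi> (?a n i)" for n i
    by (intro integrable_mult_right integrable_real_indicator) (auto simp: emeasure_eq_measure)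
  have "(\<integral>\<zeta>. poisson z \<zeta> \<partial>\<phi>) \<le> (\<integral>\<zeta>. subtree_sum (\<lambda>n i. ?a n i \<zeta>) (Suc N) 0 0 \<partial>\<phi>)"
  proof (rule integral_mono_AE)
    show "AE \<zeta> in \<phi>. poisson z \<zeta> \<le> subtree_sum (\<lambda>n i. ?a n i \<zeta>) (Suc N) 0 0"
      using \<phi>(3) by eventually_elim (rule poisson_le_dyadic_sum [OF z N])
  qed (intro integral_subtree_sum int integrable_poisson \<phi> z)+
  also have "\<dots> = subtree_sum (\<lambda>n i. 2 * (tent_weight n i z * (2 ^ n * measure \<phi> (dyadic_arc n i)))) (Suc N) 0 0"
    by (subst integral_subtree_sum [OF int]) (simp add: mult_ac)
  also have "\<dots> = 2 * subtree_sum (\<lambda>n i. tent_weight n i z * (2 ^ n * measure \<phi> (dyadic_arc n i))) (Suc N) 0 0"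
    by (rule subtree_sum_cmult)
  finally have "(\<integral>\<zeta>. poisson z \<zeta> \<partial>\<phi>)\<^sup>2
    \<le> (2 * subtree_sum (\<lambda>n i. tent_weight n i z * (2 ^ n * measure \<phi> (dyadic_arc n i))) (Suc N) 0 0)\<^sup>2"
    using z by (intro power_mono integral_nonneg) (auto simp: poisson_nonneg)
  also have "\<dots> = 4 * (subtree_sum (\<lambda>n i. tent_weight n i z * (2 ^ n * measure \<phi> (dyadic_arc n i))) (Suc N) 0 0)\<^sup>2"
    by (subst power_mult_distrib) simp
  also have "\<dots> \<le> 4 * (subtree_sum (\<lambda>n i. tent_weight n i z) (Suc N) 0 0
      * subtree_sum (\<lambda>n i. tent_weight n i z * (2 ^ n * measure \<phi> (dyadic_arc n i))\<^sup>2) (Suc N) 0 0)"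
    using z by (intro mult_left_mono subtree_sum_cauchy_schwarz tent_weight_nonneg) auto
  also have "\<dots> \<le> 4 * (96 * subtree_sum (\<lambda>n i. tent_weight n i z * (2 ^ n * measure \<phi> (dyadic_arc n i))\<^sup>2) (Suc N) 0 0)"
    using z by (intro mult_left_mono mult_right_mono subtree_sum_tent_weight_le_96 subtree_sum_nonneg
        mult_nonneg_nonneg tent_weight_nonneg) auto
  finally show ?thesis by simp
qed

text \<open>Integrating the pointwise bound in \<open>z\<close> produces the coefficients
  \<open>b\<close>, the \<open>\<nu>\<close>-integrals of the tents. They are Carleson because a
  subtree of tents sits in one disc, whose \<open>M\<close>-mass is comparable to that of the arc.
  The constants are 2400 = 96 * 25, 38400 = 16 * 2400 and 14745600 = 384 * 38400.\<close>

lemma (in A2_pair) carleson_embedding: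
  assumes \<nu>: "finite_measure \<nu>" "sets \<nu> = sets borel" "AE z in \<nu>. cmod z < 1" and D: "0 < D"
    and carleson: "\<And>\<theta> \<rho>. 0 < \<rho> \<Longrightarrow> measure \<nu> (circle_disc \<theta> \<rho>) \<le> D * measure M (circle_disc \<theta> \<rho>)"
    and \<phi>: "finite_measure \<phi>" "sets \<phi> = sets borel" "AE \<zeta> in \<phi>. cmod \<zeta> = 1"
    and \<Phi>: "finite_measure \<Phi>" "sets \<Phi> = sets borel"
    and cs: "\<And>E. E \<in> sets borel \<Longrightarrow> (measure \<phi> E)\<^sup>2 \<le> measure \<Phi> E * measure S E"
  shows "(\<integral>\<^sup>+z. ennreal ((\<integral>\<zeta>. poisson z \<zeta> \<partial>\<phi>)\<^sup>2) \<partial>\<nu>)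
    \<le> ennreal (14745600 * K ^ 3 * D) * emeasure \<Phi> UNIV"
proof -
  interpret \<nu>: finite_measure \<nu> by fact
  interpret \<phi>: finite_measure \<phi> by fact
  interpret \<Phi>: finite_measure \<Phi> by fact
  have [measurable_cong, simp]: "sets \<nu> = sets borel" "sets \<phi> = sets borel" "sets \<Phi> = sets borel" by fact+
  define b where "b = (\<lambda>n i. \<integral>z. tent_weight n i z \<partial>\<nu>)"
  have int: "integrable \<nu> (tent_weight n i)" for n i by (intro integrable_tent_weight \<nu>)
  have b: "0 \<le> b n i" for n i
    unfolding b_def using \<nu>(3) by (intro integral_nonneg_AE) (auto elim!: eventually_mono simp: tent_weight_nonneg)
  have b_carleson: "subtree_sum b d n i \<le> (2400 * K * D) * measure M (dyadic_arc n i)" for d n i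
  proof -
    let ?A = "circle_disc (dyadic_center n i) (10 / 2 ^ n)"
    have "subtree_sum b d n i = (\<integral>z. subtree_sum (\<lambda>n i. tent_weight n i z) d n i \<partial>\<nu>)"
      unfolding b_def by (rule integral_subtree_sum(2) [OF int, symmetric])
    also have "\<dots> \<le> (\<integral>z. 96 * indicator ?A z \<partial>\<nu>)"
    proof (rule integral_mono_AE)
      show "AE z in \<nu>. subtree_sum (\<lambda>n i. tent_weight n i z) d n i \<le> 96 * indicator ?A z"
        using \<nu>(3) by eventually_elim (auto intro: subtree_sum_tent_weight_le)
      show "integrable \<nu> (\<lambda>z. 96 * indicator ?A z :: real)"
        by (intro integrable_mult_right integrable_real_indicator) (auto simp: \<nu>.emeasure_eq_measure)
    qed (intro integral_subtree_sum int)
    also have "\<dots> = 96 * measure \<nu> ?A" by simp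
    also have "\<dots> \<le> 96 * (D * (25 * K * measure M (dyadic_arc n i)))"
      using carleson [of "10 / 2 ^ n" "dyadic_center n i"] D
      by (intro mult_left_mono order_trans [OF carleson] disc_le_dyadic) auto
    finally show ?thesis by (simp add: mult_ac)
  qed
  have tree: "subtree_sum (\<lambda>n i. b n i * (2 ^ n * measure \<phi> (dyadic_arc n i))\<^sup>2) d 0 0
    \<le> 38400 * K ^ 3 * D * measure \<Phi> UNIV" for d
  proof -
    have "subtree_sum (\<lambda>n i. b n i * (2 ^ n * measure \<phi> (dyadic_arc n i))\<^sup>2) d 0 0
      \<le> 16 * K\<^sup>2 * (2400 * K * D) * measure \<Phi> (dyadic_arc 0 0)"
      using K_pos D by (intro dyadic_carleson_embedding b b_carleson \<phi> \<Phi> cs) auto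
    also have "\<dots> \<le> 16 * K\<^sup>2 * (2400 * K * D) * measure \<Phi> UNIV"
      using K_pos D by (intro mult_left_mono \<Phi>.finite_measure_mono) auto
    finally show ?thesis by (simp add: power2_eq_square power3_eq_cube mult_ac)
  qed
  \<comment> \<open>On \<open>A N\<close> the tree truncated after level \<open>N\<close> already
    dominates the kernel. These sets increase to the open disc and the bound does not depend on
    \<open>N\<close>.\<close>
  define A where "A = (\<lambda>N. {z. 1 < 2 ^ N * (1 - cmod z)})"
  have [measurable]: "A N \<in> sets borel" for N unfolding A_def by measurable
  let ?g = "\<lambda>z. ennreal ((\<integral>\<zeta>. poisson z \<zeta> \<partial>\<phi>)\<^sup>2)"
  have [measurable]: "?g \<in> borel_measurable borel" by measurable
  have mono: "A N \<subseteq> A N'" if "N \<le> N'" for N N'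
  proof
    fix z assume "z \<in> A N"
    then have z: "1 < 2 ^ N * (1 - cmod z)" by (simp add: A_def)
    then have "0 < 2 ^ N * (1 - cmod z)" by linarith
    then have "0 < 1 - cmod z" by (simp add: zero_less_mult_iff)
    then have "2 ^ N * (1 - cmod z) \<le> 2 ^ N' * (1 - cmod z)"
      using that by (intro mult_right_mono power_increasing) auto
    with z show "z \<in> A N'" by (simp add: A_def)
  qed
  have bound: "(\<integral>\<^sup>+z. ?g z * indicator (A N) z \<partial>\<nu>) \<le> ennreal (14745600 * K ^ 3 * D) * emeasure \<Phi> UNIV" for N
  proof -
    let ?h = "\<lambda>z. 384 * subtree_sum (\<lambda>n i. tent_weight n i z * (2 ^ n * measure \<phi> (dyadic_arc n i))\<^sup>2) (Suc N) 0 0"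
    have int2: "integrable \<nu> (\<lambda>z. tent_weight n i z * (2 ^ n * measure \<phi> (dyadic_arc n i))\<^sup>2)" for n i
      by (intro integrable_mult_left int)
    have h_nonneg: "0 \<le> ?h z" if "cmod z < 1" for z
      using that by (intro mult_nonneg_nonneg subtree_sum_nonneg tent_weight_nonneg) auto
    have "(\<integral>\<^sup>+z. ?g z * indicator (A N) z \<partial>\<nu>) \<le> (\<integral>\<^sup>+z. ennreal (?h z) \<partial>\<nu>)"
    proof (rule nn_integral_mono_AE, use \<nu>(3) in eventually_elim)
      fix z :: complex assume z: "cmod z < 1"
      show "?g z * indicator (A N) z \<le> ennreal (?h z)"
        using poisson_integral_square_le [OF \<phi> z, of N] h_nonneg [OF z]
        by (cases "z \<in> A N") (auto simp: A_def intro!: ennreal_leI)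
    qed
    also have "\<dots> = ennreal (\<integral>z. ?h z \<partial>\<nu>)"
    proof (intro nn_integral_eq_integral integrable_mult_right integral_subtree_sum int2)
      show "AE z in \<nu>. 0 \<le> ?h z" using \<nu>(3) by eventually_elim (rule h_nonneg)
    qed
    also have "(\<integral>z. ?h z \<partial>\<nu>) = 384 * subtree_sum (\<lambda>n i. b n i * (2 ^ n * measure \<phi> (dyadic_arc n i))\<^sup>2) (Suc N) 0 0"
      by (simp only: integral_mult_right_zero integral_mult_left_zero integral_subtree_sum(2) [OF int2] b_def)
    also have "ennreal \<dots> \<le> ennreal (384 * (38400 * K ^ 3 * D * measure \<Phi> UNIV))"
      by (intro ennreal_leI mult_left_mono tree) auto
    also have "\<dots> = ennreal (14745600 * K ^ 3 * D) * emeasure \<Phi> UNIV"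
      using K_pos D by (simp add: \<Phi>.emeasure_eq_measure mult_ac flip: ennreal_mult')
    finally show ?thesis .
  qed
  have "(\<integral>\<^sup>+z. ?g z \<partial>\<nu>) = (\<integral>\<^sup>+z. (SUP N. ?g z * indicator (A N) z) \<partial>\<nu>)"
  proof (rule nn_integral_cong_AE, use \<nu>(3) in eventually_elim)
    fix z :: complex assume "cmod z < 1"
    then obtain N where "1 / (1 - cmod z) < 2 ^ N" using real_arch_pow [of 2 "1 / (1 - cmod z)"] by auto
    with \<open>cmod z < 1\<close> have "z \<in> A N" by (simp add: A_def field_simps)
    show "?g z = (SUP N. ?g z * indicator (A N) z)"
    proof (rule antisym)
      show "?g z \<le> (SUP N. ?g z * indicator (A N) z)"
        using \<open>z \<in> A N\<close> by (intro SUP_upper2 [of N]) auto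
      show "(SUP N. ?g z * indicator (A N) z) \<le> ?g z"
        by (intro SUP_least) (auto simp: indicator_def)
    qed
  qed
  also have "\<dots> = (SUP N. \<integral>\<^sup>+z. ?g z * indicator (A N) z \<partial>\<nu>)"
    using mono by (intro nn_integral_monotone_convergence_SUP)
      (auto simp: incseq_def le_fun_def indicator_def intro!: mult_left_mono)
  also have "\<dots> \<le> ennreal (14745600 * K ^ 3 * D) * emeasure \<Phi> UNIV"
    by (intro SUP_least bound)
  finally show ?thesis .
qed

section \<open>Weights and sectors\<close>

text \<open>The factorization is \<open>h = (h * sqrt w) * sqrt (1 / w)\<close>. The case
  \<open>h = 1\<close> gives the locale axiom \<open>cauchy_schwarz\<close>, and
  \<open>h = |f|\<close> the hypothesis \<open>cs\<close> of the embedding.\<close>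

lemma weighted_cauchy_schwarz:
  fixes w h :: "complex \<Rightarrow> real"
  assumes [measurable]: "w \<in> borel_measurable borel" "h \<in> borel_measurable borel" "E \<in> sets borel"
    and pos: "AE \<zeta> in circle_measure. 0 < w \<zeta>" and h: "\<And>\<zeta>. 0 \<le> h \<zeta>"
  shows "(\<integral>\<^sup>+\<zeta>\<in>E. ennreal (h \<zeta>) \<partial>circle_measure)\<^sup>2
    \<le> (\<integral>\<^sup>+\<zeta>\<in>E. ennreal ((h \<zeta>)\<^sup>2 * w \<zeta>) \<partial>circle_measure) * (\<integral>\<^sup>+\<zeta>\<in>E. inverse (ennreal (w \<zeta>)) \<partial>circle_measure)"
proof -
  let ?f = "\<lambda>\<zeta>. ennreal (h \<zeta> * sqrt (w \<zeta>)) * indicator E \<zeta>"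
  let ?g = "\<lambda>\<zeta>. ennreal (sqrt (1 / w \<zeta>)) * indicator E \<zeta>"
  have "(\<integral>\<^sup>+\<zeta>\<in>E. ennreal (h \<zeta>) \<partial>circle_measure) = (\<integral>\<^sup>+\<zeta>. ?f \<zeta> * ?g \<zeta> \<partial>circle_measure)"
    using pos by (intro nn_integral_cong_AE)
      (auto elim!: eventually_mono simp: h indicator_def real_sqrt_divide simp flip: ennreal_mult)
  also have "\<dots>\<^sup>2 \<le> (\<integral>\<^sup>+\<zeta>. (?f \<zeta>)\<^sup>2 \<partial>circle_measure) * (\<integral>\<^sup>+\<zeta>. (?g \<zeta>)\<^sup>2 \<partial>circle_measure)"
    by (rule Cauchy_Schwarz_nn_integral) auto
  also have "(\<integral>\<^sup>+\<zeta>. (?f \<zeta>)\<^sup>2 \<partial>circle_measure) = (\<integral>\<^sup>+\<zeta>\<in>E. ennreal ((h \<zeta>)\<^sup>2 * w \<zeta>) \<partial>circle_measure)"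
    using pos by (intro nn_integral_cong_AE)
      (auto elim!: eventually_mono simp: h indicator_def ennreal_power power_mult_distrib)
  also have "(\<integral>\<^sup>+\<zeta>. (?g \<zeta>)\<^sup>2 \<partial>circle_measure) = (\<integral>\<^sup>+\<zeta>\<in>E. inverse (ennreal (w \<zeta>)) \<partial>circle_measure)"
    using pos by (intro nn_integral_cong_AE)
      (auto elim!: eventually_mono simp: indicator_def ennreal_power inverse_ennreal inverse_eq_divide)
  finally show ?thesis .
qed

abbreviation weight_measure :: "(complex \<Rightarrow> real) \<Rightarrow> complex measure" where
  "weight_measure w \<equiv> density circle_measure (\<lambda>\<zeta>. ennreal (w \<zeta>))"

abbreviation dual_weight_measure :: "(complex \<Rightarrow> real) \<Rightarrow> complex measure" where
  "dual_weight_measure w \<equiv> density circle_measure (\<lambda>\<zeta>. inverse (ennreal (w \<zeta>)))"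

text \<open>Because \<open>0 * \<infinity> = 0\<close> in \<open>ennreal\<close>, a weight vanishing almost everywhere
  satisfies \<open>A2\<close>.\<close>

lemma A2_degenerate_or_pair:
  assumes "A2 w"
  obtains (degenerate) "AE \<zeta> in circle_measure. w \<zeta> = 0"
  | (pair) K where "A2_pair (weight_measure w) (dual_weight_measure w) K"
    "AE \<zeta> in circle_measure. 0 < w \<zeta>"
proof (cases "AE \<zeta> in circle_measure. w \<zeta> = 0")
  case False
  have [measurable]: "w \<in> borel_measurable borel" using assms by (simp add: A2_def)
  have nonneg: "AE \<zeta> in circle_measure. 0 \<le> w \<zeta>"
    using AE_circle_measure_sphere assms by (auto elim!: eventually_mono simp: A2_def)
  obtain K where K: "\<And>a b. a < b \<Longrightarrow> b \<le> a + 2 * pi \<Longrightarrow>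
      ((\<integral>\<^sup>+\<zeta>\<in>arc a b. ennreal (w \<zeta>) \<partial>circle_measure) / emeasure circle_measure (arc a b)) *
      ((\<integral>\<^sup>+\<zeta>\<in>arc a b. inverse (ennreal (w \<zeta>)) \<partial>circle_measure) / emeasure circle_measure (arc a b))
      \<le> ennreal K"
    using assms by (auto simp: A2_def)
  let ?M = "weight_measure w" and ?S = "dual_weight_measure w"
  have em: "(\<integral>\<^sup>+\<zeta>\<in>E. ennreal (w \<zeta>) \<partial>circle_measure) = emeasure ?M E"
    "(\<integral>\<^sup>+\<zeta>\<in>E. inverse (ennreal (w \<zeta>)) \<partial>circle_measure) = emeasure ?S E" if "E \<in> sets borel" for E
    using that by (simp_all add: emeasure_density)
  have sph: "AE z in ?M. cmod z = 1" "AE z in ?S. cmod z = 1"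
    using AE_circle_measure_sphere by (auto simp: AE_density elim!: eventually_mono)
  have full: "emeasure N (arc 0 (2 * pi)) = emeasure N UNIV" if "AE z in N. cmod z = 1" "sets N = sets borel" for N
  proof (rule emeasure_eq_AE)
    have "z \<in> arc 0 (2 * pi)" if z: "cmod z = 1" for z
    proof -
      obtain i where "i < 2 ^ 0" "z \<in> dyadic_arc 0 i" using z by (rule sphere_dyadic_arc)
      then show ?thesis using dyadic_arc_subset_arc [of 0 0] by auto
    qed
    then show "AE z in N. z \<in> arc 0 (2 * pi) \<longleftrightarrow> z \<in> UNIV"
      using that(1) by (auto elim!: eventually_mono)
  qed (use that in auto)
  \<comment> \<open>\<open>A2\<close> on the full circle bounds only the product of the two masses.
    To make each mass finite, both must be shown nonzero; for \<open>?M\<close> this is where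
    non-degeneracy is used.\<close>
  have "emeasure ?M UNIV * emeasure ?S UNIV \<le> ennreal K"
    using K [of 0 "2 * pi"] by (simp add: em full sph emeasure_arc divide_ennreal_def)
  then have prod: "emeasure ?M UNIV * emeasure ?S UNIV < top"
    using ennreal_less_top le_less_trans by blast
  have "emeasure ?M UNIV \<noteq> 0"
  proof
    assume "emeasure ?M UNIV = 0"
    then have "AE \<zeta> in circle_measure. ennreal (w \<zeta>) = 0"
      by (simp add: emeasure_density nn_integral_0_iff_AE)
    with nonneg have "AE \<zeta> in circle_measure. w \<zeta> = 0" by eventually_elim (simp add: ennreal_eq_0_iff)
    with False show False by simp
  qed
  moreover have "emeasure ?S UNIV \<noteq> 0"
  proof
    assume "emeasure ?S UNIV = 0"
    then have "AE \<zeta> in circle_measure. inverse (ennreal (w \<zeta>)) = 0"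
      by (simp add: emeasure_density nn_integral_0_iff_AE)
    then have "AE \<zeta> in circle_measure. False" by (auto elim!: eventually_mono simp: ennreal_inverse_eq_0_iff)
    then show False by (simp add: AE_iff_measurable [OF _ refl] emeasure_circle_UNIV)
  qed
  ultimately have fin: "emeasure ?M UNIV < top" "emeasure ?S UNIV < top"
    using prod by (auto simp: ennreal_mult_less_top)
  have "AE \<zeta> in circle_measure. inverse (ennreal (w \<zeta>)) \<noteq> \<infinity>"
    using fin(2) by (intro nn_integral_PInf_AE) (auto simp: emeasure_density)
  then have pos: "AE \<zeta> in circle_measure. 0 < w \<zeta>"
    by eventually_elim (metis ennreal_eq_0_iff ennreal_inverse_eq_top_iff infinity_ennreal_def not_le)
  interpret M: finite_measure ?M using fin by (intro finite_measureI) auto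
  interpret S: finite_measure ?S using fin by (intro finite_measureI) auto
  \<comment> \<open>The maximum makes the constant positive, as the locale requires.\<close>
  have "A2_pair ?M ?S (max K 1)"
  proof unfold_locales
    fix E :: "complex set" assume [measurable]: "E \<in> sets borel"
    have "(emeasure circle_measure E)\<^sup>2 \<le> emeasure ?M E * emeasure ?S E"
      using weighted_cauchy_schwarz [of w "\<lambda>_. 1" E] pos by (simp add: em)
    then show "(measure circle_measure E)\<^sup>2 \<le> measure ?M E * measure ?S E"
      by (simp add: M.emeasure_eq_measure S.emeasure_eq_measure circle.emeasure_eq_measure
          ennreal_power flip: ennreal_mult)
  next
    fix a b :: real assume ab: "a < b" "b \<le> a + 2 * pi"
    let ?p = "measure circle_measure (arc a b)"
    have p: "0 < ?p" using ab by (simp add: measure_arc)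
    have "ennreal (measure ?M (arc a b) / ?p * (measure ?S (arc a b) / ?p)) \<le> ennreal K"
      using K [OF ab] p
      by (simp add: em M.emeasure_eq_measure S.emeasure_eq_measure circle.emeasure_eq_measure
          divide_ennreal flip: ennreal_mult)
    also have "\<dots> \<le> ennreal (max K 1)" by (intro ennreal_leI) auto
    finally have "measure ?M (arc a b) / ?p * (measure ?S (arc a b) / ?p) \<le> max K 1"
      by (subst (asm) ennreal_le_iff) auto
    then show "measure ?M (arc a b) * measure ?S (arc a b) \<le> max K 1 * ?p\<^sup>2"
      using p by (simp add: field_simps power2_eq_square)
  qed (use sph in auto)
  then show ?thesis using pos by (rule pair)
qed (rule degenerate)

lemma ennreal_div_less_imp_le:
  fixes x y :: ennreal
  assumes "x / y < ennreal D" "y \<noteq> 0" "y \<noteq> top"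
  shows "x \<le> ennreal D * y"
proof -
  have "x = x / y * y" using assms(2,3) by (simp add: ennreal_divide_times less_top)
  also have "\<dots> \<le> ennreal D * y" using assms by (intro mult_right_mono) auto
  finally show ?thesis .
qed

text \<open>Adding 1 produces the strict inequality, and the maximum handles negative
  \<open>c\<close>, for which \<open>ennreal c\<close> is 0. If \<open>y = 0\<close>, then
  \<open>x = 0\<close> and the quotient is \<open>0 / 0 = 0\<close>.\<close>

lemma ennreal_div_less_if_le:
  fixes x y :: ennreal
  assumes "x \<le> ennreal c * y" "y \<noteq> top"
  shows "x / y < ennreal (max c 0 + 1)"
proof -
  have "x / y \<le> ennreal c"
  proof (cases "y = 0")
    case False
    have "x / y \<le> ennreal c * y / y" using assms(1) by (rule divide_right_mono_ennreal)
    also have "\<dots> = ennreal c" using False assms(2) by (simp add: ennreal_times_divide [symmetric] less_top)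
    finally show ?thesis .
  qed (use assms in simp)
  also have "\<dots> < ennreal (max c 0 + 1)" by (intro ennreal_lessI) auto
  finally show ?thesis .
qed

lemma sector_subset_ball: "h \<le> 1 \<Longrightarrow> sector \<theta> h \<subseteq> ball 0 1"
  by (auto simp: sector_def norm_mult)

text \<open>Radial projection moves \<open>w\<close> by \<open>1 - cmod w\<close>, at most
  \<open>\<rho>\<close>, so the projected point is within \<open>2 * \<rho>\<close> of
  \<open>cis \<theta>\<close> and its angle within \<open>pi / 2 * (2 * \<rho>)\<close>. The bound
  \<open>\<rho> < 1\<close> excludes the origin, where the projection is undefined.\<close>

lemma disc_subset_sector:
  assumes "\<rho> < 1" "w \<in> circle_disc \<theta> \<rho>" "cmod w < 1"
  shows "w \<in> sector \<theta> (pi * \<rho>)"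
proof -
  have r: "1 - cmod w \<le> \<rho>" by (rule circle_disc_dist_boundary) fact
  then have w0: "w \<noteq> 0" using assms by auto
  have \<rho>: "0 < \<rho>" using r assms by linarith
  have w: "w = of_real (cmod w) * sgn w" by (simp add: sgn_eq)
  have n: "cmod (sgn w) = 1" using w0 by (simp add: norm_sgn)
  have "sgn w - w = of_real (1 - cmod w) * sgn w" by (subst (2) w) (simp add: algebra_simps)
  then have "cmod (sgn w - w) = 1 - cmod w" using n assms by (simp only: norm_mult norm_of_real) simp
  moreover have "cmod (w - cis \<theta>) \<le> \<rho>"
    using assms(2) by (simp add: circle_disc_def dist_norm norm_minus_commute)
  ultimately have "cmod (sgn w - cis \<theta>) \<le> 2 * \<rho>"
    using r norm_triangle_ineq [of "sgn w - w" "w - cis \<theta>"] by simp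
  then have "pi / 2 * cmod (sgn w - cis \<theta>) \<le> pi / 2 * (2 * \<rho>)" by (intro mult_left_mono) auto
  moreover obtain t where t: "sgn w = cis t" "\<bar>t - \<theta>\<bar> \<le> pi / 2 * cmod (sgn w - cis \<theta>)"
    using cis_near_angle [OF n] by metis
  ultimately have "\<bar>t - \<theta>\<bar> \<le> pi * \<rho>" by linarith
  moreover have "\<rho> \<le> pi * \<rho>" using \<rho> pi_gt3 by simp
  then have "1 - pi * \<rho> \<le> cmod w" using r by linarith
  ultimately show ?thesis unfolding sector_def using w t(1) assms(3) by auto
qed

text \<open>Sectors of size 1 reach the origin, and the angles within 1 of 0, 2, 4, 6 cover
  \<open>[0, 2 * pi)\<close> because \<open>2 * pi < 7\<close>.\<close>

lemma ball_subset_sectors: "ball 0 1 \<subseteq> (\<Union>\<theta>\<in>{0, 2, 4, 6}. sector \<theta> 1)"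
proof
  fix w :: complex assume w: "w \<in> ball 0 1"
  have A: "0 \<le> Arg2pi w" "Arg2pi w < 2 * pi" "w = of_real (cmod w) * cis (Arg2pi w)"
    using Arg2pi [of w] by (auto simp: is_Arg_def cis_conv_exp)
  have "2 * pi < 7" using pi_approx by simp
  with A have "\<exists>\<theta>\<in>{0, 2, 4, 6}. \<bar>Arg2pi w - \<theta>\<bar> \<le> 1" by auto
  then obtain \<theta> where "\<theta> \<in> {0, 2, 4, 6}" "\<bar>Arg2pi w - \<theta>\<bar> \<le> 1" ..
  moreover have "w \<in> sector \<theta> 1" unfolding sector_def
    using A(3) \<open>\<bar>Arg2pi w - \<theta>\<bar> \<le> 1\<close> w unfolding mem_Collect_eq
    by (intro exI [of _ "cmod w"] exI [of _ "Arg2pi w"]) simp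
  ultimately show "w \<in> (\<Union>\<theta>\<in>{0, 2, 4, 6}. sector \<theta> 1)" by blast
qed

text \<open>The condition \<open>r < 1\<close> prevents the sector from being closed; it is a
  compact image intersected with the open ball. With \<open>h \<le> 1\<close> all radii are
  nonnegative, so \<open>r\<close> is the modulus.\<close>

lemma sector_measurable:
  assumes "h \<le> 1"
  shows "sector \<theta> h \<in> sets borel"
proof -
  let ?g = "\<lambda>x. complex_of_real (fst x) * cis (snd x)"
  have "sector \<theta> h = ?g ` ({1 - h..1} \<times> {\<theta> - h..\<theta> + h}) \<inter> ball 0 1"
  proof (intro equalityI subsetI)
    fix w assume "w \<in> sector \<theta> h"
    then obtain r t where "w = of_real r * cis t" "1 - h \<le> r" "r < 1" "\<bar>t - \<theta>\<bar> \<le> h"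
      by (auto simp: sector_def)
    then show "w \<in> ?g ` ({1 - h..1} \<times> {\<theta> - h..\<theta> + h}) \<inter> ball 0 1"
      using assms by (auto simp: norm_mult intro!: image_eqI [where x = "(r, t)"])
  next
    fix w assume w: "w \<in> ?g ` ({1 - h..1} \<times> {\<theta> - h..\<theta> + h}) \<inter> ball 0 1"
    then obtain r t where rt: "w = of_real r * cis t" "1 - h \<le> r" "r \<le> 1" "\<theta> - h \<le> t" "t \<le> \<theta> + h"
      by auto
    with w assms have "r < 1" by (simp add: norm_mult)
    moreover have "\<bar>t - \<theta>\<bar> \<le> h" using rt by auto
    ultimately show "w \<in> sector \<theta> h" using rt by (auto simp: sector_def)
  qed
  moreover have "compact (?g ` ({1 - h..1} \<times> {\<theta> - h..\<theta> + h}))"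
    by (intro compact_continuous_image continuous_intros compact_Times) auto
  ultimately show ?thesis by (simp add: borel_closed compact_imp_closed)
qed

lemma sector_dist:
  assumes "w \<in> sector \<theta> h" "h \<le> 1"
  shows "cmod (w - cis \<theta>) \<le> 2 * h"
proof -
  obtain r t where w: "w = of_real r * cis t" "1 - h \<le> r" "r < 1" "\<bar>t - \<theta>\<bar> \<le> h"
    using assms by (auto simp: sector_def)
  have "w - cis t = of_real (r - 1) * cis t" by (simp add: w algebra_simps)
  then have "cmod (w - cis t) = 1 - r" using w by (simp only: norm_mult norm_of_real norm_cis) simp
  moreover have "cmod (cis t - cis \<theta>) \<le> h" using norm_cis_diff_le [of t \<theta>] w by linarith
  ultimately show ?thesis
    using w norm_triangle_ineq [of "w - cis t" "cis t - cis \<theta>"] by simp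
qed

section \<open>Carleson conditions on sectors and on discs\<close>

text \<open>With \<open>p = pext lam\<close> this is the measure \<open>\<nu>\<close> inside the
  disc. The indicator places it on the open disc, where the kernel estimates hold.\<close>

definition disc_density :: "complex measure \<Rightarrow> (complex \<Rightarrow> ennreal) \<Rightarrow> complex measure" where
  "disc_density \<tau> p = density \<tau> (\<lambda>z. p z * indicator (ball 0 1) z)"

lemma unit_ball_measurable [measurable]: "ball (0::complex) 1 \<in> sets borel"
  by simp

lemma sets_disc_density [simp]: "sets (disc_density \<tau> p) = sets \<tau>"
  by (simp add: disc_density_def)

lemma nn_integral_disc_density:
  assumes [measurable_cong]: "sets \<tau> = sets borel"
    and [measurable]: "p \<in> borel_measurable borel" "g \<in> borel_measurable borel"
  shows "(\<integral>\<^sup>+z. g z \<partial>disc_density \<tau> p) = (\<integral>\<^sup>+z\<in>ball 0 1. g z * p z \<partial>\<tau>)"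
proof -
  have "(\<integral>\<^sup>+z. g z \<partial>disc_density \<tau> p) = (\<integral>\<^sup>+z. p z * indicator (ball 0 1) z * g z \<partial>\<tau>)"
    unfolding disc_density_def by (rule nn_integral_density; measurable)
  then show ?thesis by (simp add: mult_ac)
qed

lemma nn_integral_cmult_disc_density:
  assumes \<tau>: "sets \<tau> = sets borel"
    and [measurable]: "p \<in> borel_measurable borel" "g \<in> borel_measurable borel"
  shows "(\<integral>\<^sup>+z. c * g z \<partial>disc_density \<tau> p) = c * (\<integral>\<^sup>+z\<in>ball 0 1. g z * p z \<partial>\<tau>)"
proof -
  have [measurable_cong]: "sets (disc_density \<tau> p) = sets borel" by (simp add: \<tau>)
  have "(\<integral>\<^sup>+z. c * g z \<partial>disc_density \<tau> p) = c * (\<integral>\<^sup>+z. g z \<partial>disc_density \<tau> p)"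
    by (rule nn_integral_cmult) measurable
  then show ?thesis by (simp add: nn_integral_disc_density \<tau>)
qed

lemma AE_disc_density:
  assumes [measurable_cong]: "sets \<tau> = sets borel" and [measurable]: "p \<in> borel_measurable borel"
  shows "AE z in disc_density \<tau> p. cmod z < 1"
proof -
  have [measurable]: "(\<lambda>z. p z * indicator (ball 0 1) z) \<in> borel_measurable \<tau>" by measurable
  show ?thesis unfolding disc_density_def by (subst AE_density) (auto simp: indicator_def)
qed

text \<open>Chebyshev's inequality. The test function \<open>g\<close> is a multiple of the squared
  extension of an indicator, or of a Poisson kernel, scaled to be at least 1 on the sector.\<close>

lemma nn_integral_sector_le:
  assumes "sets \<tau> = sets borel" "p \<in> borel_measurable borel" "g \<in> borel_measurable borel"
    and "h \<le> 1" "\<And>w. w \<in> sector \<theta> h \<Longrightarrow> 1 \<le> g w"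
  shows "(\<integral>\<^sup>+w\<in>sector \<theta> h. p w \<partial>\<tau>) \<le> (\<integral>\<^sup>+w. g w \<partial>disc_density \<tau> p)"
proof -
  have "(\<integral>\<^sup>+w\<in>sector \<theta> h. p w \<partial>\<tau>) \<le> (\<integral>\<^sup>+w\<in>ball 0 1. g w * p w \<partial>\<tau>)"
  proof (rule nn_integral_mono)
    fix w
    show "p w * indicator (sector \<theta> h) w \<le> g w * p w * indicator (ball 0 1) w"
      using sector_subset_ball [OF assms(4), of \<theta>] assms(5) [of w] mult_right_mono [of 1 "g w" "p w"]
      by (auto simp: indicator_def)
  qed
  then show ?thesis by (simp add: nn_integral_disc_density assms)
qed

lemma emeasure_disc_density_le:
  assumes "sets \<tau> = sets borel" "p \<in> borel_measurable borel" "A \<in> sets borel" "A \<inter> ball 0 1 \<subseteq> B"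
  shows "emeasure (disc_density \<tau> p) A \<le> (\<integral>\<^sup>+w\<in>B. p w \<partial>\<tau>)"
proof -
  have "emeasure (disc_density \<tau> p) A = (\<integral>\<^sup>+w. indicator A w \<partial>disc_density \<tau> p)"
    using assms by simp
  also have "\<dots> = (\<integral>\<^sup>+w\<in>ball 0 1. indicator A w * p w \<partial>\<tau>)"
    using assms by (intro nn_integral_disc_density) auto
  also have "\<dots> \<le> (\<integral>\<^sup>+w\<in>B. p w \<partial>\<tau>)"
    using assms(4) by (intro nn_integral_mono) (auto simp: indicator_def)
  finally show ?thesis .
qed

context A2_pair
begin

lemma doubling:
  assumes "0 < \<rho>" "\<rho> \<le> pi"
  shows "measure M (circle_disc \<theta> (2 * \<rho>)) \<le> K * pi\<^sup>2 * measure M (circle_disc \<theta> \<rho>)"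
proof -
  have "(\<rho> / pi)\<^sup>2 * measure M (circle_disc \<theta> (2 * \<rho>))
      \<le> (measure circle_measure (circle_disc \<theta> \<rho>))\<^sup>2 * measure M (circle_disc \<theta> (2 * \<rho>))"
    using assms by (intro mult_right_mono power_mono measure_circle_disc_ge) auto
  also have "\<dots> \<le> K * (2 * \<rho> / 2)\<^sup>2 * measure M (circle_disc \<theta> \<rho>)"
    using assms by (intro measure_disc_compare circle_disc_mono) auto
  finally show ?thesis using assms by (simp add: power_divide field_simps)
qed

text \<open>For radii above \<open>1 / pi\<close> the sector of size \<open>pi * \<rho>\<close>
  exceeds the admissible size 1; such discs are treated as comparable to the whole circle.\<close>

lemma measure_UNIV_le:
  assumes "1 / pi \<le> \<rho>"
  shows "measure M UNIV \<le> K * pi ^ 4 * measure M (circle_disc \<theta> \<rho>)"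
proof -
  have pi: "0 < 1 / pi" "1 / pi \<le> 1" using pi_gt3 by auto
  have "(1 / pi / pi)\<^sup>2 * measure M (circle_disc \<theta> 2)
      \<le> (measure circle_measure (circle_disc \<theta> (1 / pi)))\<^sup>2 * measure M (circle_disc \<theta> 2)"
    using pi pi_gt3 by (intro mult_right_mono power_mono measure_circle_disc_ge) (linarith | simp)+
  also have "\<dots> \<le> K * (2 / 2)\<^sup>2 * measure M (circle_disc \<theta> (1 / pi))"
    using pi by (intro measure_disc_compare circle_disc_mono circle_disc_measurable) linarith+
  also have "\<dots> \<le> K * (2 / 2)\<^sup>2 * measure M (circle_disc \<theta> \<rho>)"
    using assms K_pos by (intro mult_left_mono M.finite_measure_mono circle_disc_mono) auto
  finally have "measure M (circle_disc \<theta> 2) \<le> K * pi ^ 4 * measure M (circle_disc \<theta> \<rho>)"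
    by (simp add: power_divide power_mult_distrib field_simps power2_eq_square power4_eq_xxxx)
  moreover have "measure M UNIV \<le> measure M (circle_disc \<theta> 2)"
    using circle_disc_2 by (intro measure_mono_sphere) auto
  ultimately show ?thesis by simp
qed

lemma sector_arc_pos: "0 < h \<Longrightarrow> h \<le> 1 \<Longrightarrow> 0 < measure M (sector_arc \<theta> h)"
  unfolding sector_arc_def using pi_gt3 by (intro measure_pos) (auto simp: measure_arc)

text \<open>For \<open>\<rho>\<close> up to \<open>1 / pi\<close> the disc lies in one sector of
  size \<open>pi * \<rho>\<close>, whose arc fits into the disc of radius \<open>2 * \<rho>\<close>,
  and doubling returns to \<open>\<rho>\<close>. Larger discs are handled by covering the unit disc
  with four sectors of size 1. The witness adds the two constants, and 1 for positivity.\<close>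

lemma sector_carleson_imp_disc_carleson:
  assumes \<tau>: "sets \<tau> = sets borel" and p: "p \<in> borel_measurable borel"
    and D: "\<And>\<theta> h. 0 < h \<Longrightarrow> h \<le> 1 \<Longrightarrow>
      (\<integral>\<^sup>+w\<in>sector \<theta> h. p w \<partial>\<tau>) \<le> ennreal (D * measure M (sector_arc \<theta> h))" and D0: "0 \<le> D"
  obtains D' where "0 < D'"
    "\<And>\<theta> \<rho>. 0 < \<rho> \<Longrightarrow> emeasure (disc_density \<tau> p) (circle_disc \<theta> \<rho>) \<le> ennreal (D' * measure M (circle_disc \<theta> \<rho>))"
proof (rule that [of "1 + D * (K * pi\<^sup>2) + 4 * D * (K * pi ^ 4)"])
  show "0 < 1 + D * (K * pi\<^sup>2) + 4 * D * (K * pi ^ 4)"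
    using D0 K_pos by (intro add_pos_nonneg) auto
  fix \<theta> \<rho> :: real assume \<rho>: "0 < \<rho>"
  let ?\<nu> = "disc_density \<tau> p" and ?m = "measure M (circle_disc \<theta> \<rho>)"
  have nn: "0 \<le> D * (K * pi\<^sup>2) * ?m" "0 \<le> 4 * D * (K * pi ^ 4) * ?m" "0 \<le> ?m"
    using D0 K_pos by auto
  consider "\<rho> \<le> 1 / pi" | "1 / pi \<le> \<rho>" by linarith
  then show "emeasure ?\<nu> (circle_disc \<theta> \<rho>) \<le> ennreal ((1 + D * (K * pi\<^sup>2) + 4 * D * (K * pi ^ 4)) * ?m)"
  proof cases
    case 1
    have "1 / pi < 1" using pi_gt3 by simp
    with 1 have \<rho>1: "\<rho> < 1" by linarith
    have \<rho>pi: "pi * \<rho> \<le> 1" using 1 by (simp add: field_simps)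
    have "emeasure ?\<nu> (circle_disc \<theta> \<rho>) \<le> (\<integral>\<^sup>+w\<in>sector \<theta> (pi * \<rho>). p w \<partial>\<tau>)"
      using \<rho>1 by (intro emeasure_disc_density_le \<tau> p) (auto intro: disc_subset_sector)
    also have "\<dots> \<le> ennreal (D * measure M (sector_arc \<theta> (pi * \<rho>)))"
      using \<rho> \<rho>pi by (intro D) auto
    also have "\<dots> \<le> ennreal (D * (K * pi\<^sup>2 * ?m))"
    proof (intro ennreal_leI mult_left_mono D0)
      have "sector_arc \<theta> (pi * \<rho>) \<subseteq> circle_disc \<theta> (pi * \<rho> / 2)"
        unfolding sector_arc_def by (rule arc_subset_circle_disc)
      also have "\<dots> \<subseteq> circle_disc \<theta> (2 * \<rho>)"
        using \<rho> pi_less_4 by (intro circle_disc_mono) auto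
      finally have "measure M (sector_arc \<theta> (pi * \<rho>)) \<le> measure M (circle_disc \<theta> (2 * \<rho>))"
        by (intro M.finite_measure_mono) auto
      also have "\<dots> \<le> K * pi\<^sup>2 * ?m" using \<rho> \<rho>1 pi_gt3 by (intro doubling) auto
      finally show "measure M (sector_arc \<theta> (pi * \<rho>)) \<le> K * pi\<^sup>2 * ?m" .
    qed
    also have "\<dots> \<le> ennreal ((1 + D * (K * pi\<^sup>2) + 4 * D * (K * pi ^ 4)) * ?m)"
      using nn by (intro ennreal_leI) (simp add: algebra_simps)
    finally show ?thesis .
  next
    case 2
    have [measurable_cong]: "sets \<tau> = sets borel" by fact
    have [measurable]: "p \<in> borel_measurable borel" by fact
    have [measurable]: "sector \<theta> 1 \<in> sets borel" for \<theta> by (rule sector_measurable) simp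
    let ?T = "{0, 2, 4, 6} :: real set"
    have "emeasure ?\<nu> (circle_disc \<theta> \<rho>) \<le> (\<integral>\<^sup>+w. p w * indicator (ball 0 1) w \<partial>\<tau>)"
      by (intro emeasure_disc_density_le \<tau> p) auto
    also have "\<dots> \<le> (\<integral>\<^sup>+w. (\<Sum>\<theta>\<in>?T. p w * indicator (sector \<theta> 1) w) \<partial>\<tau>)"
    proof (rule nn_integral_mono)
      fix w
      show "p w * indicator (ball 0 1) w \<le> (\<Sum>\<theta>\<in>?T. p w * indicator (sector \<theta> 1) w)"
      proof (cases "w \<in> ball 0 1")
        case True
        then obtain t where t: "t \<in> ?T" "w \<in> sector t 1" using ball_subset_sectors by blast
        then have "p w * indicator (ball 0 1) w \<le> p w * indicator (sector t 1) w"
          by (simp add: indicator_def)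
        also have "\<dots> \<le> (\<Sum>\<theta>\<in>?T. p w * indicator (sector \<theta> 1) w)"
          using t(1) by (rule member_le_sum) auto
        finally show ?thesis .
      qed simp
    qed
    also have "\<dots> = (\<Sum>\<theta>\<in>?T. \<integral>\<^sup>+w\<in>sector \<theta> 1. p w \<partial>\<tau>)"
      by (rule nn_integral_sum) simp
    also have "\<dots> \<le> (\<Sum>\<theta>\<in>?T. ennreal (D * (K * pi ^ 4 * ?m)))"
    proof (rule sum_mono)
      fix t
      have "(\<integral>\<^sup>+w\<in>sector t 1. p w \<partial>\<tau>) \<le> ennreal (D * measure M (sector_arc t 1))"
        by (rule D) auto
      also have "\<dots> \<le> ennreal (D * (K * pi ^ 4 * ?m))"
        by (intro ennreal_leI mult_left_mono D0 order_trans [OF M.finite_measure_mono measure_UNIV_le [OF 2]]) auto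
      finally show "(\<integral>\<^sup>+w\<in>sector t 1. p w \<partial>\<tau>) \<le> ennreal (D * (K * pi ^ 4 * ?m))" .
    qed
    also have "\<dots> = ennreal (4 * D * (K * pi ^ 4) * ?m)"
      using D0 K_pos by (subst sum_ennreal) (auto simp: algebra_simps)
    also have "\<dots> \<le> ennreal ((1 + D * (K * pi\<^sup>2) + 4 * D * (K * pi ^ 4)) * ?m)"
      using nn by (intro ennreal_leI) (simp add: algebra_simps)
    finally show ?thesis .
  qed
qed

end

section \<open>Equivalence of the conditions\<close>

lemma pext_eq_weight_measure:
  assumes [measurable]: "w \<in> borel_measurable borel"
    and "AE \<zeta> in circle_measure. 0 \<le> w \<zeta>" and "cmod z < 1"
  shows "pext w z = (\<integral>\<^sup>+\<zeta>. ennreal (poisson z \<zeta>) \<partial>weight_measure w)"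
proof -
  have "pext w z = (\<integral>\<^sup>+\<zeta>. ennreal (w \<zeta>) * ennreal (poisson z \<zeta>) \<partial>circle_measure)"
    unfolding pext_def using assms(2)
    by (intro nn_integral_cong_AE) (use assms(3) in \<open>auto elim!: eventually_mono simp: ennreal_mult poisson_nonneg\<close>)
  then show ?thesis by (subst nn_integral_density) auto
qed

text \<open>The point \<open>w\<close> has angle \<open>t\<close> within \<open>h\<close> of
  \<open>\<theta>\<close> and height \<open>\<delta>\<close> at most \<open>h\<close>, so the arc of
  radius \<open>\<delta>\<close> about \<open>t\<close> stays within angle \<open>2 * h\<close>. On
  it the kernel is at least \<open>1 / (4 * \<delta>)\<close>, and its normalized length is
  \<open>\<delta> / pi\<close>.\<close>

lemma cpext_indicator_ge:
  assumes w: "w \<in> sector \<theta> h" and h: "0 < h" "h \<le> 1"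
    and A: "A \<in> sets borel" "arc (\<theta> - 2 * h) (\<theta> + 2 * h) \<subseteq> A"
  shows "1 / (4 * pi) \<le> cmod (cpext (indicator A) w)"
proof -
  obtain r t where rt: "w = of_real r * cis t" "1 - h \<le> r" "r < 1" "\<bar>t - \<theta>\<bar> \<le> h"
    using w by (auto simp: sector_def)
  define \<delta> where "\<delta> = 1 - r"
  have \<delta>: "0 < \<delta>" "\<delta> \<le> h" "w = of_real (1 - \<delta>) * cis t" using rt by (auto simp: \<delta>_def)
  have w1: "cmod w < 1" using sector_subset_ball [OF h(2), of \<theta>] w by auto
  let ?J = "arc (t - \<delta>) (t + \<delta>)"
  have "{t - \<delta>..t + \<delta>} \<subseteq> {\<theta> - 2 * h..\<theta> + 2 * h}" using rt \<delta> by auto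
  then have J: "?J \<subseteq> A" using A(2) unfolding arc_def by blast
  have int: "integrable circle_measure (poisson w)"
    by (intro integrable_poisson circle.finite_measure_axioms AE_circle_measure_sphere w1) simp
  have int2: "integrable circle_measure (\<lambda>\<zeta>. indicator A \<zeta> * poisson w \<zeta>)"
    using integrable_mult_indicator [OF _ int, of A] A by simp
  have "1 / (4 * pi) = 1 / (4 * \<delta>) * measure circle_measure ?J"
    using \<delta> h pi_gt3 by (subst measure_arc) auto
  also have "\<dots> = (\<integral>\<zeta>. 1 / (4 * \<delta>) * indicator ?J \<zeta> \<partial>circle_measure)" by simp
  also have "\<dots> \<le> (\<integral>\<zeta>. indicator A \<zeta> * poisson w \<zeta> \<partial>circle_measure)"
  proof (rule integral_mono_AE)
    show "integrable circle_measure (\<lambda>\<zeta>. 1 / (4 * \<delta>) * indicator ?J \<zeta> :: real)"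
      by (intro integrable_mult_right integrable_real_indicator) (auto simp: circle.emeasure_eq_measure)
    show "AE \<zeta> in circle_measure. 1 / (4 * \<delta>) * indicator ?J \<zeta> \<le> indicator A \<zeta> * poisson w \<zeta>"
      using AE_circle_measure_sphere
    proof eventually_elim
      fix \<zeta> :: complex assume \<zeta>: "cmod \<zeta> = 1"
      show "1 / (4 * \<delta>) * indicator ?J \<zeta> \<le> indicator A \<zeta> * poisson w \<zeta>"
      proof (cases "\<zeta> \<in> ?J")
        case True
        then have "cmod (\<zeta> - cis t) \<le> \<delta>"
          using arc_subset_circle_disc [of t \<delta>] by (auto simp: circle_disc_def dist_norm norm_minus_commute)
        then have "1 / (4 * \<delta>) \<le> poisson w \<zeta>"
          unfolding \<delta>(3) using \<delta> h \<zeta> poisson_ge_near [of \<delta> \<zeta> 1 t] by simp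
        then show ?thesis using True J by auto
      next
        case False
        then show ?thesis using w1 by (simp add: poisson_nonneg)
      qed
    qed
  qed (rule int2)
  also have "\<dots> \<le> cmod (complex_of_real (\<integral>\<zeta>. indicator A \<zeta> * poisson w \<zeta> \<partial>circle_measure))" by simp
  also have "complex_of_real (\<integral>\<zeta>. indicator A \<zeta> * poisson w \<zeta> \<partial>circle_measure) = cpext (indicator A) w"
    unfolding cpext_def integral_complex_of_real [symmetric]
    by (intro Bochner_Integration.integral_cong) (auto simp: indicator_def)
  finally show ?thesis .
qed

text \<open>The set \<open>A\<close> is kept general: a short arc is inserted for a genuine weight,
  the whole plane for a weight vanishing almost everywhere.\<close>

lemma sector_integral_le_cpext:
  assumes \<tau>: "sets \<tau> = sets borel" and p: "p \<in> borel_measurable borel"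
    and h: "0 < h" "h \<le> 1" and A [measurable]: "A \<in> sets borel" and "arc (\<theta> - 2 * h) (\<theta> + 2 * h) \<subseteq> A"
  shows "(\<integral>\<^sup>+z\<in>sector \<theta> h. p z \<partial>\<tau>)
    \<le> ennreal (16 * pi\<^sup>2) * (\<integral>\<^sup>+z\<in>ball 0 1. ennreal ((cmod (cpext (indicator A) z))\<^sup>2) * p z \<partial>\<tau>)"
proof -
  let ?f = "indicator A :: complex \<Rightarrow> complex"
  have "(\<integral>\<^sup>+z\<in>sector \<theta> h. p z \<partial>\<tau>) \<le> (\<integral>\<^sup>+z. ennreal (16 * pi\<^sup>2) * ennreal ((cmod (cpext ?f z))\<^sup>2) \<partial>disc_density \<tau> p)"
  proof (rule nn_integral_sector_le [OF \<tau> p _ h(2)])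
    show "(\<lambda>z. ennreal (16 * pi\<^sup>2) * ennreal ((cmod (cpext ?f z))\<^sup>2)) \<in> borel_measurable borel" by measurable
    fix z assume "z \<in> sector \<theta> h"
    then have "1 / (4 * pi) \<le> cmod (cpext ?f z)" using assms by (intro cpext_indicator_ge) auto
    then have "(1 / (4 * pi))\<^sup>2 \<le> (cmod (cpext ?f z))\<^sup>2" by (intro power_mono) auto
    then have "1 \<le> 16 * pi\<^sup>2 * (cmod (cpext ?f z))\<^sup>2" by (simp add: power_divide power_mult_distrib field_simps)
    then show "1 \<le> ennreal (16 * pi\<^sup>2) * ennreal ((cmod (cpext ?f z))\<^sup>2)"
      by (simp flip: ennreal_mult)
  qed
  also have "\<dots> = ennreal (16 * pi\<^sup>2) * (\<integral>\<^sup>+z\<in>ball 0 1. ennreal ((cmod (cpext ?f z))\<^sup>2) * p z \<partial>\<tau>)"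
    by (rule nn_integral_cmult_disc_density [OF \<tau> p]) measurable
  finally show ?thesis .
qed

lemma cmod_cpext_le:
  assumes [measurable]: "f \<in> borel_measurable borel" and "cmod z < 1"
  shows "cmod (cpext f z) \<le> (\<integral>\<zeta>. poisson z \<zeta> \<partial>density circle_measure (\<lambda>\<zeta>. ennreal (cmod (f \<zeta>))))"
proof -
  have "cmod (cpext f z) \<le> (\<integral>\<zeta>. cmod (f \<zeta> * complex_of_real (poisson z \<zeta>)) \<partial>circle_measure)"
    unfolding cpext_def by (rule integral_norm_bound)
  also have "\<dots> = (\<integral>\<zeta>. cmod (f \<zeta>) *\<^sub>R poisson z \<zeta> \<partial>circle_measure)"
    using assms(2) by (intro Bochner_Integration.integral_cong) (auto simp: norm_mult poisson_nonneg)
  also have "\<dots> = (\<integral>\<zeta>. poisson z \<zeta> \<partial>density circle_measure (\<lambda>\<zeta>. ennreal (cmod (f \<zeta>))))"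
    by (rule integral_density [symmetric]) auto
  finally show ?thesis .
qed

context A2_pair
begin

text \<open>\<open>carleson_embedding\<close> is applied with \<open>\<phi>\<close> of density
  \<open>cmod f\<close> and \<open>\<Phi>\<close> of density \<open>(cmod f)^2 * w\<close>; the
  modulus of the extension is at most the extension of the modulus.\<close>

lemma disc_carleson_imp_embedding:
  assumes w: "M = weight_measure w" "S = dual_weight_measure w" "AE \<zeta> in circle_measure. 0 < w \<zeta>"
    and [measurable]: "w \<in> borel_measurable borel" "p \<in> borel_measurable borel" "f \<in> borel_measurable borel"
    and \<tau>: "sets \<tau> = sets borel" and D: "0 < D"
    and carleson: "\<And>\<theta> \<rho>. 0 < \<rho> \<Longrightarrow>
      emeasure (disc_density \<tau> p) (circle_disc \<theta> \<rho>) \<le> ennreal (D * measure M (circle_disc \<theta> \<rho>))"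
    and fin: "(\<integral>\<^sup>+\<zeta>. ennreal ((cmod (f \<zeta>))\<^sup>2 * w \<zeta>) \<partial>circle_measure) < \<infinity>"
  shows "(\<integral>\<^sup>+z\<in>ball 0 1. ennreal ((cmod (cpext f z))\<^sup>2) * p z \<partial>\<tau>)
    \<le> ennreal (14745600 * K ^ 3 * D) * (\<integral>\<^sup>+\<zeta>. ennreal ((cmod (f \<zeta>))\<^sup>2 * w \<zeta>) \<partial>circle_measure)"
proof -
  let ?\<nu> = "disc_density \<tau> p"
  let ?\<phi> = "density circle_measure (\<lambda>\<zeta>. ennreal (cmod (f \<zeta>)))"
  let ?\<Phi> = "density circle_measure (\<lambda>\<zeta>. ennreal ((cmod (f \<zeta>))\<^sup>2 * w \<zeta>))"
  have AE\<nu>: "AE z in ?\<nu>. cmod z < 1" by (rule AE_disc_density [OF \<tau>]) measurable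
  have \<Phi>_UNIV: "emeasure ?\<Phi> UNIV = (\<integral>\<^sup>+\<zeta>. ennreal ((cmod (f \<zeta>))\<^sup>2 * w \<zeta>) \<partial>circle_measure)"
    by (simp add: emeasure_density)
  \<comment> \<open>The disc of radius 2 about 1 contains the unit disc, so the Carleson condition
    already bounds the total mass.\<close>
  have "emeasure ?\<nu> UNIV = emeasure ?\<nu> (circle_disc 0 2)"
  proof (rule emeasure_eq_AE)
    have "z \<in> circle_disc 0 2" if "cmod z < 1" for z
      using that norm_triangle_ineq4 [of "cis 0" z] by (simp add: circle_disc_def dist_norm)
    with AE\<nu> show "AE z in ?\<nu>. z \<in> UNIV \<longleftrightarrow> z \<in> circle_disc 0 2" by (auto elim!: eventually_mono)
  qed (auto simp: \<tau>)
  also have "\<dots> < top" by (rule le_less_trans [OF carleson]) auto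
  finally interpret \<nu>: finite_measure ?\<nu>
    by (intro finite_measureI) (auto simp: sets_eq_imp_space_eq [of ?\<nu> borel] \<tau>)
  interpret \<Phi>: finite_measure ?\<Phi> using fin by (intro finite_measureI) (auto simp: \<Phi>_UNIV)
  have cs: "(emeasure ?\<phi> E)\<^sup>2 \<le> emeasure ?\<Phi> E * emeasure S E" if [measurable]: "E \<in> sets borel" for E
    using weighted_cauchy_schwarz [of w "\<lambda>\<zeta>. cmod (f \<zeta>)" E] w(3) by (simp add: w emeasure_density)
  \<comment> \<open>Finite \<open>S\<close>-mass turns the weighted \<open>L^2\<close> bound into
    integrability of \<open>f\<close>.\<close>
  have "(emeasure ?\<phi> UNIV)\<^sup>2 < top"
    by (rule le_less_trans [OF cs]) (auto simp: S.emeasure_eq_measure \<Phi>.emeasure_eq_measure simp flip: ennreal_mult)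
  then interpret \<phi>: finite_measure ?\<phi>
    by (intro finite_measureI) (auto simp: power2_eq_square ennreal_mult_less_top)
  have "(\<integral>\<^sup>+z\<in>ball 0 1. ennreal ((cmod (cpext f z))\<^sup>2) * p z \<partial>\<tau>)
      = (\<integral>\<^sup>+z. ennreal ((cmod (cpext f z))\<^sup>2) \<partial>?\<nu>)"
    by (rule nn_integral_disc_density [OF \<tau>, symmetric]) measurable
  also have "\<dots> \<le> (\<integral>\<^sup>+z. ennreal ((\<integral>\<zeta>. poisson z \<zeta> \<partial>?\<phi>)\<^sup>2) \<partial>?\<nu>)"
  proof (rule nn_integral_mono_AE, use AE\<nu> in eventually_elim)
    fix z :: complex assume "cmod z < 1"
    then show "ennreal ((cmod (cpext f z))\<^sup>2) \<le> ennreal ((\<integral>\<zeta>. poisson z \<zeta> \<partial>?\<phi>)\<^sup>2)"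
      by (intro ennreal_leI power_mono cmod_cpext_le) auto
  qed
  also have "\<dots> \<le> ennreal (14745600 * K ^ 3 * D) * emeasure ?\<Phi> UNIV"
  proof (rule carleson_embedding)
    show "measure ?\<nu> (circle_disc \<theta> \<rho>) \<le> D * measure M (circle_disc \<theta> \<rho>)" if "0 < \<rho>" for \<theta> \<rho>
      using carleson [OF that, of \<theta>] D by (simp add: \<nu>.emeasure_eq_measure)
    show "AE \<zeta> in ?\<phi>. cmod \<zeta> = 1"
      using AE_circle_measure_sphere by (auto simp: AE_density elim!: eventually_mono)
    show "(measure ?\<phi> E)\<^sup>2 \<le> measure ?\<Phi> E * measure S E" if "E \<in> sets borel" for E
      using cs [OF that] by (simp add: \<phi>.emeasure_eq_measure \<Phi>.emeasure_eq_measure S.emeasure_eq_measure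
          ennreal_power flip: ennreal_mult)
  qed (use \<tau> D AE\<nu> \<nu>.finite_measure_axioms \<phi>.finite_measure_axioms \<Phi>.finite_measure_axioms in auto)
  finally show ?thesis unfolding \<Phi>_UNIV .
qed

text \<open>The test function is the indicator of an arc four times as long as
  \<open>sector_arc \<theta> h\<close>. The arc comparison costs \<open>16 * K\<close>, and the
  lower bound \<open>1 / (4 * pi)\<close> for the extension costs \<open>16 * pi^2\<close>.\<close>

lemma embedding_imp_sector_carleson:
  assumes w: "M = weight_measure w"
    and [measurable]: "w \<in> borel_measurable borel" "p \<in> borel_measurable borel"
    and \<tau>: "sets \<tau> = sets borel" and B: "0 \<le> B"
    and emb: "\<And>f. f \<in> borel_measurable borel \<Longrightarrow>
      (\<integral>\<^sup>+\<zeta>. ennreal ((cmod (f \<zeta>))\<^sup>2 * w \<zeta>) \<partial>circle_measure) < \<infinity> \<Longrightarrow>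
      (\<integral>\<^sup>+z\<in>ball 0 1. ennreal ((cmod (cpext f z))\<^sup>2) * p z \<partial>\<tau>)
        \<le> ennreal B * (\<integral>\<^sup>+\<zeta>. ennreal ((cmod (f \<zeta>))\<^sup>2 * w \<zeta>) \<partial>circle_measure)"
    and h: "0 < h" "h \<le> 1"
  shows "(\<integral>\<^sup>+z\<in>sector \<theta> h. p z \<partial>\<tau>) \<le> ennreal (256 * pi\<^sup>2 * B * K * measure M (sector_arc \<theta> h))"
proof -
  let ?A = "arc (\<theta> - 2 * h) (\<theta> + 2 * h)"
  let ?f = "indicator ?A :: complex \<Rightarrow> complex"
  have f: "(\<integral>\<^sup>+\<zeta>. ennreal ((cmod (?f \<zeta>))\<^sup>2 * w \<zeta>) \<partial>circle_measure) = ennreal (measure M ?A)"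
  proof -
    have "(\<integral>\<^sup>+\<zeta>. ennreal ((cmod (?f \<zeta>))\<^sup>2 * w \<zeta>) \<partial>circle_measure) = (\<integral>\<^sup>+\<zeta>\<in>?A. ennreal (w \<zeta>) \<partial>circle_measure)"
      by (intro nn_integral_cong) (auto simp: indicator_def)
    also have "\<dots> = emeasure M ?A" by (simp add: w emeasure_density)
    finally show ?thesis by (simp add: M.emeasure_eq_measure)
  qed
  have "(\<integral>\<^sup>+z\<in>sector \<theta> h. p z \<partial>\<tau>)
      \<le> ennreal (16 * pi\<^sup>2) * (\<integral>\<^sup>+z\<in>ball 0 1. ennreal ((cmod (cpext ?f z))\<^sup>2) * p z \<partial>\<tau>)"
    by (rule sector_integral_le_cpext [OF \<tau> _ h]) auto
  also have "\<dots> \<le> ennreal (16 * pi\<^sup>2) * (ennreal B * ennreal (measure M ?A))"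
    using emb [of ?f] by (intro mult_left_mono) (auto simp: f)
  also have "\<dots> = ennreal (16 * pi\<^sup>2 * B * measure M ?A)"
    using B by (simp add: ennreal_mult mult.assoc)
  also have "\<dots> \<le> ennreal (16 * pi\<^sup>2 * B * (16 * K * measure M (sector_arc \<theta> h)))"
  proof (intro ennreal_leI mult_left_mono)
    have "(measure circle_measure (sector_arc \<theta> h))\<^sup>2 * measure M ?A
        \<le> K * (measure circle_measure ?A)\<^sup>2 * measure M (sector_arc \<theta> h)"
      unfolding sector_arc_def using h pi_gt3
      by (intro measure_arc_compare arc_measurable) (auto simp: arc_def)
    also define x where "x = h / (2 * pi)"
    have "measure circle_measure (sector_arc \<theta> h) = x"
      unfolding sector_arc_def x_def using h pi_gt3 by (subst measure_arc) auto
    also have "measure circle_measure ?A = 4 * x"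
      unfolding x_def using h pi_gt3 by (subst measure_arc) auto
    finally have "x\<^sup>2 * measure M ?A \<le> x\<^sup>2 * (16 * K * measure M (sector_arc \<theta> h))"
      by (simp add: power_mult_distrib mult_ac)
    moreover have "0 < x\<^sup>2" using h by (simp add: x_def)
    ultimately show "measure M ?A \<le> 16 * K * measure M (sector_arc \<theta> h)"
      by (subst (asm) mult_le_cancel_left_pos) auto
  qed (use B in auto)
  finally show ?thesis by (simp add: mult_ac)
qed

text \<open>Both sides are compared with \<open>M(circle_disc \<theta> \<delta>) / \<delta>\<close>:
  the test integral from above by the kernel estimate, and \<open>pext w z\<close> from below,
  because the kernel is at least \<open>1 / (4 * \<delta>)\<close> on that disc.\<close>

lemma disc_carleson_imp_poisson_test:
  assumes w: "M = weight_measure w" "AE \<zeta> in circle_measure. 0 < w \<zeta>"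
    and [measurable]: "w \<in> borel_measurable borel" "p \<in> borel_measurable borel"
    and \<tau>: "sets \<tau> = sets borel" and D: "0 < D"
    and carleson: "\<And>\<theta> \<rho>. 0 < \<rho> \<Longrightarrow>
      emeasure (disc_density \<tau> p) (circle_disc \<theta> \<rho>) \<le> ennreal (D * measure M (circle_disc \<theta> \<rho>))"
  obtains C where "\<And>z. z \<in> ball 0 1 \<Longrightarrow>
    (\<integral>\<^sup>+w\<in>ball 0 1. ennreal \<bar>poisson z w\<bar> * p w \<partial>\<tau>) \<le> ennreal C * pext w z"
proof -
  obtain X where X: "0 < X" and test:
    "\<And>\<nu> D \<theta> \<delta>. sets \<nu> = sets borel \<Longrightarrow> (AE w in \<nu>. cmod w \<le> 1) \<Longrightarrow> 0 \<le> D \<Longrightarrow> 0 < \<delta> \<Longrightarrow> \<delta> \<le> 1 \<Longrightarrow>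
      (\<And>\<rho>. 0 < \<rho> \<Longrightarrow> emeasure \<nu> (circle_disc \<theta> \<rho>) \<le> ennreal (D * measure M (circle_disc \<theta> \<rho>))) \<Longrightarrow>
      (\<integral>\<^sup>+w. ennreal (poisson (of_real (1 - \<delta>) * cis \<theta>) w) \<partial>\<nu>)
        \<le> ennreal (X * D * measure M (circle_disc \<theta> \<delta>) / \<delta>)"
    using poisson_kernel_integral_le by metis
  show ?thesis
  proof (rule that [of "4 * X * D"])
    fix z :: complex assume z: "z \<in> ball 0 1"
    then obtain \<delta> \<theta> where \<delta>: "0 < \<delta>" "\<delta> \<le> 1" "z = of_real (1 - \<delta>) * cis \<theta>" by (rule ball_polar)
    let ?m = "measure M (circle_disc \<theta> \<delta>)"
    have AE\<nu>: "AE z in disc_density \<tau> p. cmod z < 1" by (rule AE_disc_density [OF \<tau>]) measurable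
    have "(\<integral>\<^sup>+w\<in>ball 0 1. ennreal \<bar>poisson z w\<bar> * p w \<partial>\<tau>)
        = (\<integral>\<^sup>+w. ennreal (poisson z w) \<partial>disc_density \<tau> p)"
      using z by (subst nn_integral_disc_density [OF \<tau>]) (auto simp: poisson_nonneg)
    also have "\<dots> \<le> ennreal (X * D * ?m / \<delta>)"
      unfolding \<delta>(3) using \<delta> D AE\<nu> by (intro test carleson) (auto simp: \<tau> elim!: eventually_mono)
    also have "\<dots> = ennreal (4 * X * D) * ennreal (?m / (4 * \<delta>))"
      using X D \<delta> by (simp flip: ennreal_mult)
    also have "\<dots> \<le> ennreal (4 * X * D) * pext w z"
    proof (rule mult_left_mono)
      have "ennreal (?m / (4 * \<delta>)) = ennreal (1 / (4 * \<delta>)) * emeasure M (circle_disc \<theta> \<delta>)"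
        using \<delta> by (simp add: M.emeasure_eq_measure flip: ennreal_mult)
      also have "\<dots> = (\<integral>\<^sup>+\<zeta>. ennreal (1 / (4 * \<delta>)) * indicator (circle_disc \<theta> \<delta>) \<zeta> \<partial>M)"
        by (subst nn_integral_cmult) auto
      also have "\<dots> \<le> (\<integral>\<^sup>+\<zeta>. ennreal (poisson z \<zeta>) \<partial>M)"
      proof (rule nn_integral_mono_AE, use M_sphere in eventually_elim)
        fix \<zeta> :: complex assume \<zeta>: "cmod \<zeta> = 1"
        show "ennreal (1 / (4 * \<delta>)) * indicator (circle_disc \<theta> \<delta>) \<zeta> \<le> ennreal (poisson z \<zeta>)"
        proof (cases "\<zeta> \<in> circle_disc \<theta> \<delta>")
          case True
          then have "cmod (\<zeta> - cis \<theta>) \<le> \<delta>"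
            by (auto simp: circle_disc_def dist_norm norm_minus_commute)
          then have "1 / (4 * \<delta>) \<le> poisson z \<zeta>"
            unfolding \<delta>(3) using \<delta> \<zeta> poisson_ge_near [of \<delta> \<zeta> 1 \<theta>] by simp
          then show ?thesis using True by (auto intro!: ennreal_leI)
        qed simp
      qed
      also have "\<dots> = pext w z"
        using z w(2) by (subst pext_eq_weight_measure) (auto simp: w(1) elim!: eventually_mono)
      finally show "ennreal (?m / (4 * \<delta>)) \<le> pext w z" .
    qed simp
    finally show "(\<integral>\<^sup>+w\<in>ball 0 1. ennreal \<bar>poisson z w\<bar> * p w \<partial>\<tau>) \<le> ennreal (4 * X * D) * pext w z" .
  qed
qed

text \<open>The test point is \<open>(1 - h) * cis \<theta>\<close>, whose kernel is at least
  \<open>1 / (9 * h)\<close> on the sector, as distances there are at most \<open>2 * h\<close>. The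
  upper bound for \<open>pext w z\<close> is the kernel estimate applied to \<open>M\<close> itself,
  and it rests on reverse doubling of \<open>S\<close>.\<close>

lemma poisson_test_imp_sector_carleson:
  assumes w: "M = weight_measure w" "AE \<zeta> in circle_measure. 0 < w \<zeta>"
    and [measurable]: "w \<in> borel_measurable borel" "p \<in> borel_measurable borel"
    and \<tau>: "sets \<tau> = sets borel" and C: "0 \<le> C"
    and test: "\<And>z. z \<in> ball 0 1 \<Longrightarrow>
      (\<integral>\<^sup>+w\<in>ball 0 1. ennreal \<bar>poisson z w\<bar> * p w \<partial>\<tau>) \<le> ennreal C * pext w z"
  obtains D where "0 \<le> D" "\<And>\<theta> h. 0 < h \<Longrightarrow> h \<le> 1 \<Longrightarrow>
      (\<integral>\<^sup>+w\<in>sector \<theta> h. p w \<partial>\<tau>) \<le> ennreal (D * measure M (sector_arc \<theta> h))"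
proof -
  obtain X where X: "0 < X" and kernel:
    "\<And>\<nu> D \<theta> \<delta>. sets \<nu> = sets borel \<Longrightarrow> (AE w in \<nu>. cmod w \<le> 1) \<Longrightarrow> 0 \<le> D \<Longrightarrow> 0 < \<delta> \<Longrightarrow> \<delta> \<le> 1 \<Longrightarrow>
      (\<And>\<rho>. 0 < \<rho> \<Longrightarrow> emeasure \<nu> (circle_disc \<theta> \<rho>) \<le> ennreal (D * measure M (circle_disc \<theta> \<rho>))) \<Longrightarrow>
      (\<integral>\<^sup>+w. ennreal (poisson (of_real (1 - \<delta>) * cis \<theta>) w) \<partial>\<nu>)
        \<le> ennreal (X * D * measure M (circle_disc \<theta> \<delta>) / \<delta>)"
    using poisson_kernel_integral_le by metis
  show ?thesis
  proof (rule that [of "9 * C * X * (K * pi\<^sup>2)"])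
    show "0 \<le> 9 * C * X * (K * pi\<^sup>2)" using C X K_pos by simp
    fix \<theta> h :: real assume h: "0 < h" "h \<le> 1"
    define z where "z = of_real (1 - h) * cis \<theta>"
    have "cmod z = 1 - h" using h by (simp add: z_def norm_mult flip: of_real_diff)
    then have z: "z \<in> ball 0 1" using h by simp
    have "(\<integral>\<^sup>+w\<in>sector \<theta> h. p w \<partial>\<tau>) \<le> (\<integral>\<^sup>+w. ennreal (9 * h) * ennreal \<bar>poisson z w\<bar> \<partial>disc_density \<tau> p)"
    proof (rule nn_integral_sector_le [OF \<tau>])
      show "p \<in> borel_measurable borel" "h \<le> 1" by fact+
      show "(\<lambda>w. ennreal (9 * h) * ennreal \<bar>poisson z w\<bar>) \<in> borel_measurable borel" by measurable
      fix v assume v: "v \<in> sector \<theta> h"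
      have "cmod (v - cis \<theta>) \<le> 2 * h" using v h by (intro sector_dist) auto
      moreover have "cmod v \<le> 1" using sector_subset_ball [OF h(2), of \<theta>] v by auto
      ultimately have "1 / (9 * h) \<le> poisson z v"
        unfolding z_def using h poisson_ge_near [of h v 2 \<theta>] by simp
      then have "1 \<le> 9 * h * poisson z v" using h by (simp add: field_simps)
      moreover have "0 \<le> poisson z v" using z by (intro poisson_nonneg) simp
      ultimately have "1 \<le> 9 * h * \<bar>poisson z v\<bar>" by simp
      then show "1 \<le> ennreal (9 * h) * ennreal \<bar>poisson z v\<bar>" using h by (simp flip: ennreal_mult)
    qed
    also have "\<dots> = ennreal (9 * h) * (\<integral>\<^sup>+w\<in>ball 0 1. ennreal \<bar>poisson z w\<bar> * p w \<partial>\<tau>)"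
      by (rule nn_integral_cmult_disc_density [OF \<tau>]) measurable
    also have "\<dots> \<le> ennreal (9 * h) * (ennreal C * pext w z)"
      by (intro mult_left_mono test z) auto
    also have "pext w z = (\<integral>\<^sup>+\<zeta>. ennreal (poisson z \<zeta>) \<partial>M)"
      using z w(2) by (subst pext_eq_weight_measure) (auto simp: w(1) elim!: eventually_mono)
    also have "ennreal (9 * h) * (ennreal C * (\<integral>\<^sup>+\<zeta>. ennreal (poisson z \<zeta>) \<partial>M))
      \<le> ennreal (9 * h) * (ennreal C * ennreal (X * 1 * measure M (circle_disc \<theta> h) / h))"
      unfolding z_def using h M_sphere
      by (intro mult_left_mono kernel) (auto elim!: eventually_mono simp: M.emeasure_eq_measure)
    also have "\<dots> = ennreal (9 * C * X * measure M (circle_disc \<theta> h))"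
      using h C X by (simp flip: ennreal_mult)
    also have "\<dots> \<le> ennreal (9 * C * X * (K * pi\<^sup>2 * measure M (sector_arc \<theta> h)))"
    proof (intro ennreal_leI mult_left_mono)
      have sub: "sector_arc \<theta> h \<subseteq> circle_disc \<theta> h"
        unfolding sector_arc_def using arc_subset_circle_disc [of \<theta> "h / 2"] circle_disc_mono [of "h / 2" h \<theta>] h by auto
      have "(measure circle_measure (sector_arc \<theta> h))\<^sup>2 * measure M (circle_disc \<theta> h)
          \<le> K * (h / 2)\<^sup>2 * measure M (sector_arc \<theta> h)"
        using h sub by (intro measure_disc_compare) (auto simp: sector_arc_def)
      also have "measure circle_measure (sector_arc \<theta> h) = h / (2 * pi)"
        unfolding sector_arc_def using h pi_gt3 by (subst measure_arc) auto
      finally have "(h / (2 * pi))\<^sup>2 * measure M (circle_disc \<theta> h)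
          \<le> (h / (2 * pi))\<^sup>2 * (K * pi\<^sup>2 * measure M (sector_arc \<theta> h))"
        by (simp add: power_mult_distrib power_divide mult_ac)
      then show "measure M (circle_disc \<theta> h) \<le> K * pi\<^sup>2 * measure M (sector_arc \<theta> h)"
        using h by (subst (asm) mult_le_cancel_left_pos) auto
    qed (use C X in auto)
    finally show "(\<integral>\<^sup>+w\<in>sector \<theta> h. p w \<partial>\<tau>) \<le> ennreal (9 * C * X * (K * pi\<^sup>2) * measure M (sector_arc \<theta> h))"
      by (simp add: mult_ac)
  qed
qed

end

lemma ball_null_if_sectors_null:
  assumes [measurable_cong]: "sets \<tau> = sets borel" and [measurable]: "p \<in> borel_measurable borel"
    and "\<And>\<theta>. (\<integral>\<^sup>+w\<in>sector \<theta> 1. p w \<partial>\<tau>) = 0"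
  shows "AE w in \<tau>. w \<in> ball 0 1 \<longrightarrow> p w = 0"
proof -
  have [measurable]: "sector \<theta> 1 \<in> sets borel" for \<theta> by (rule sector_measurable) simp
  have "AE w in \<tau>. w \<in> sector \<theta> 1 \<longrightarrow> p w = 0" for \<theta>
    using assms(3) [of \<theta>]
    by (subst (asm) nn_integral_0_iff_AE) (auto simp: indicator_def split: if_splits elim!: eventually_mono)
  then have "AE w in \<tau>. \<forall>\<theta>\<in>{0, 2, 4, 6}. w \<in> sector \<theta> 1 \<longrightarrow> p w = 0" by (intro AE_finite_allI) auto
  then show ?thesis by (rule eventually_mono) (use ball_subset_sectors in blast)
qed

theorem theorem1p5:
  fixes \<mu> lam :: "complex \<Rightarrow> real" and \<tau> :: "complex measure"
  assumes "A2 \<mu>" and "A2 lam"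
    and "sets \<tau> = sets borel" and "emeasure \<tau> (- ball 0 1) = 0"
  shows "((\<exists>B::real. \<forall>f::complex \<Rightarrow> complex.
              f \<in> borel_measurable borel \<and>
              (\<integral>\<^sup>+\<zeta>. ennreal ((cmod (f \<zeta>))^2 * \<mu> \<zeta>) \<partial>circle_measure) < \<infinity> \<longrightarrow>
              (\<integral>\<^sup>+z\<in>ball 0 1. ennreal ((cmod (cpext f z))^2) * pext lam z \<partial>\<tau>)
                \<le> ennreal B * (\<integral>\<^sup>+\<zeta>. ennreal ((cmod (f \<zeta>))^2 * \<mu> \<zeta>) \<partial>circle_measure))
          \<longleftrightarrow>
          (\<exists>C::real. \<forall>z\<in>ball 0 1.
              (\<integral>\<^sup>+w\<in>ball 0 1. ennreal \<bar>poisson z w\<bar> * pext lam w \<partial>\<tau>) / pext \<mu> z < ennreal C))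
       \<and>
         ((\<exists>C::real. \<forall>z\<in>ball 0 1.
              (\<integral>\<^sup>+w\<in>ball 0 1. ennreal \<bar>poisson z w\<bar> * pext lam w \<partial>\<tau>) / pext \<mu> z < ennreal C)
          \<longleftrightarrow>
          (\<exists>D::real. \<forall>\<theta>0 h. 0 < h \<and> h \<le> 1 \<longrightarrow>
              (\<integral>\<^sup>+w\<in>sector \<theta>0 h. pext lam w \<partial>\<tau>)
                / (\<integral>\<^sup>+\<zeta>\<in>sector_arc \<theta>0 h. ennreal (\<mu> \<zeta>) \<partial>circle_measure) < ennreal D))"
proof -
  have meas [measurable]: "\<mu> \<in> borel_measurable borel" "lam \<in> borel_measurable borel"
    using assms(1,2) by (auto simp: A2_def)
  have p [measurable]: "pext lam \<in> borel_measurable borel" by measurable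
  note \<tau> = assms(3)
  let ?i = "\<exists>B::real. \<forall>f::complex \<Rightarrow> complex.
    f \<in> borel_measurable borel \<and>
    (\<integral>\<^sup>+\<zeta>. ennreal ((cmod (f \<zeta>))^2 * \<mu> \<zeta>) \<partial>circle_measure) < \<infinity> \<longrightarrow>
    (\<integral>\<^sup>+z\<in>ball 0 1. ennreal ((cmod (cpext f z))^2) * pext lam z \<partial>\<tau>)
      \<le> ennreal B * (\<integral>\<^sup>+\<zeta>. ennreal ((cmod (f \<zeta>))^2 * \<mu> \<zeta>) \<partial>circle_measure)"
  let ?ii = "\<exists>C::real. \<forall>z\<in>ball 0 1.
    (\<integral>\<^sup>+w\<in>ball 0 1. ennreal \<bar>poisson z w\<bar> * pext lam w \<partial>\<tau>) / pext \<mu> z < ennreal C"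
  let ?iii = "\<exists>D::real. \<forall>\<theta>0 h. 0 < h \<and> h \<le> 1 \<longrightarrow>
    (\<integral>\<^sup>+w\<in>sector \<theta>0 h. pext lam w \<partial>\<tau>)
      / (\<integral>\<^sup>+\<zeta>\<in>sector_arc \<theta>0 h. ennreal (\<mu> \<zeta>) \<partial>circle_measure) < ennreal D"
  have "(?i \<longleftrightarrow> ?iii) \<and> (?ii \<longleftrightarrow> ?iii)"
    using assms(1)
  proof (cases rule: A2_degenerate_or_pair)
    case degenerate
    have null: "(\<integral>\<^sup>+\<zeta>. g \<zeta> \<partial>circle_measure) = 0" if "\<And>\<zeta>. \<mu> \<zeta> = 0 \<Longrightarrow> g \<zeta> = 0" for g
    proof -
      have "(\<integral>\<^sup>+\<zeta>. g \<zeta> \<partial>circle_measure) = (\<integral>\<^sup>+\<zeta>. 0 \<partial>circle_measure)"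
        using degenerate by (intro nn_integral_cong_AE) (auto elim!: eventually_mono intro: that)
      then show ?thesis by simp
    qed
    have f0: "(\<integral>\<^sup>+\<zeta>. ennreal ((cmod (f \<zeta>))^2 * \<mu> \<zeta>) \<partial>circle_measure) = 0" for f :: "complex \<Rightarrow> complex"
      by (rule null) simp
    have m0: "(\<integral>\<^sup>+\<zeta>\<in>A. ennreal (\<mu> \<zeta>) \<partial>circle_measure) = 0" for A
      by (rule null) simp
    have p0: "pext \<mu> z = 0" for z unfolding pext_def by (rule null) simp
    \<comment> \<open>A nonzero \<open>ennreal\<close> divided by 0 is infinite, so with vanishing
      denominators the conditions force vanishing numerators.\<close>
    have zero: "x = 0" if "x / 0 < ennreal c" for x :: ennreal and c
      using that by (auto simp: divide_ennreal_def ennreal_mult_top split: if_splits)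
    \<comment> \<open>In the degenerate case each of the three conditions is equivalent to
      \<open>?Z\<close>.\<close>
    let ?Z = "AE w in \<tau>. w \<in> ball 0 1 \<longrightarrow> pext lam w = 0"
    have from_Z: "(\<integral>\<^sup>+w\<in>A. g w * pext lam w \<partial>\<tau>) = 0" if ?Z "A \<subseteq> ball 0 1" for A g
    proof -
      have "(\<integral>\<^sup>+w\<in>A. g w * pext lam w \<partial>\<tau>) = (\<integral>\<^sup>+w. 0 \<partial>\<tau>)"
        using that by (intro nn_integral_cong_AE) (auto elim!: eventually_mono simp: indicator_def)
      then show ?thesis by simp
    qed
    have "?iii" if ?Z
    proof -
      have "(\<integral>\<^sup>+w\<in>sector \<theta> h. pext lam w \<partial>\<tau>) = 0" if "h \<le> 1" for \<theta> h
        using from_Z [OF \<open>?Z\<close> sector_subset_ball [OF that], where g = "\<lambda>_. 1"] by simp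
      then show ?thesis by (intro exI [of _ 1]) simp
    qed
    moreover have "?ii" if ?Z
      using from_Z [OF that order_refl] by (intro exI [of _ 1]) auto
    moreover have "?i" if ?Z
      using from_Z [OF that order_refl] by (intro exI [of _ 1]) auto
    moreover have "?Z" if ?iii
    proof (rule ball_null_if_sectors_null [OF \<tau> p])
      fix \<theta>
      obtain D where "\<And>\<theta> h. 0 < h \<and> h \<le> 1 \<Longrightarrow> (\<integral>\<^sup>+w\<in>sector \<theta> h. pext lam w \<partial>\<tau>) / 0 < ennreal D"
        using \<open>?iii\<close> unfolding m0 by blast
      from this [of 1 \<theta>] show "(\<integral>\<^sup>+w\<in>sector \<theta> 1. pext lam w \<partial>\<tau>) = 0" by (intro zero) simp
    qed
    \<comment> \<open>At \<open>z = 0\<close> the kernel is identically 1, so the test integral is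
      the full mass of the disc.\<close>
    moreover have "?Z" if ?ii
    proof -
      have "(\<integral>\<^sup>+w\<in>ball 0 1. ennreal \<bar>poisson 0 w\<bar> * pext lam w \<partial>\<tau>) = 0"
      proof -
        obtain C where "\<And>z. z \<in> ball 0 1 \<Longrightarrow>
            (\<integral>\<^sup>+w\<in>ball 0 1. ennreal \<bar>poisson z w\<bar> * pext lam w \<partial>\<tau>) / 0 < ennreal C"
          using \<open>?ii\<close> unfolding p0 by blast
        from this [of 0] show ?thesis by (intro zero) simp
      qed
      then have "(\<integral>\<^sup>+w. pext lam w * indicator (ball 0 1) w \<partial>\<tau>) = 0" by (simp add: poisson_def)
      moreover have [measurable_cong]: "sets \<tau> = sets borel" by (rule \<tau>)
      ultimately show ?thesis
        by (subst (asm) nn_integral_0_iff_AE) (auto simp: indicator_def split: if_splits elim!: eventually_mono)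
    qed
    \<comment> \<open>The constant function 1 has norm 0 here, so its extension must vanish in the
      left-hand integral, although it is bounded below on every sector.\<close>
    moreover have "?Z" if ?i
    proof (rule ball_null_if_sectors_null [OF \<tau> p])
      fix \<theta>
      let ?f = "indicator UNIV :: complex \<Rightarrow> complex"
      have "(\<integral>\<^sup>+w\<in>sector \<theta> 1. pext lam w \<partial>\<tau>)
          \<le> ennreal (16 * pi\<^sup>2) * (\<integral>\<^sup>+w\<in>ball 0 1. ennreal ((cmod (cpext ?f w))\<^sup>2) * pext lam w \<partial>\<tau>)"
        by (rule sector_integral_le_cpext [OF \<tau> p]) auto
      also have "\<dots> = 0"
      proof -
        obtain B where "\<And>f. f \<in> borel_measurable borel \<Longrightarrow>
          (\<integral>\<^sup>+z\<in>ball 0 1. ennreal ((cmod (cpext f z))^2) * pext lam z \<partial>\<tau>) \<le> ennreal B * 0"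
          using \<open>?i\<close> unfolding f0 by auto
        from this [of ?f] show ?thesis by simp
      qed
      finally show "(\<integral>\<^sup>+w\<in>sector \<theta> 1. pext lam w \<partial>\<tau>) = 0" by simp
    qed
    ultimately show ?thesis by blast
  next
    case (pair K)
    let ?M = "weight_measure \<mu>"
    interpret A2_pair ?M "dual_weight_measure \<mu>" K by (rule pair(1))
    have mass: "(\<integral>\<^sup>+\<zeta>\<in>sector_arc \<theta> h. ennreal (\<mu> \<zeta>) \<partial>circle_measure) = ennreal (measure ?M (sector_arc \<theta> h))" for \<theta> h
      unfolding M.emeasure_eq_measure [symmetric]
      by (rule emeasure_density [symmetric]) (auto simp: sector_arc_def)
    \<comment> \<open>Clearing the division is legitimate since arcs have positive finite mass; a
      nonnegative constant is required so that \<open>ennreal\<close> respects products.\<close>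
    have iii: "?iii \<longleftrightarrow> (\<exists>D\<ge>0. \<forall>\<theta> h. 0 < h \<longrightarrow> h \<le> 1 \<longrightarrow>
        (\<integral>\<^sup>+w\<in>sector \<theta> h. pext lam w \<partial>\<tau>) \<le> ennreal (D * measure ?M (sector_arc \<theta> h)))" (is "_ \<longleftrightarrow> ?iii'")
    proof
      assume ?iii
      then obtain D where D: "\<And>\<theta> h. 0 < h \<Longrightarrow> h \<le> 1 \<Longrightarrow>
        (\<integral>\<^sup>+w\<in>sector \<theta> h. pext lam w \<partial>\<tau>) / ennreal (measure ?M (sector_arc \<theta> h)) < ennreal D"
        unfolding mass by blast
      have "(\<integral>\<^sup>+w\<in>sector \<theta> h. pext lam w \<partial>\<tau>) \<le> ennreal (max D 0 * measure ?M (sector_arc \<theta> h))"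
        if h: "0 < h" "h \<le> 1" for \<theta> h
      proof -
        have "(\<integral>\<^sup>+w\<in>sector \<theta> h. pext lam w \<partial>\<tau>) \<le> ennreal D * ennreal (measure ?M (sector_arc \<theta> h))"
          using D [OF h, of \<theta>] sector_arc_pos [OF h, of \<theta>] by (intro ennreal_div_less_imp_le) auto
        also have "\<dots> \<le> ennreal (max D 0) * ennreal (measure ?M (sector_arc \<theta> h))"
          by (intro mult_right_mono ennreal_leI) auto
        finally show ?thesis by (simp add: ennreal_mult)
      qed
      then show ?iii' by (intro exI [of _ "max D 0"]) auto
    next
      assume ?iii'
      then obtain D where D: "0 \<le> D" "\<And>\<theta> h. 0 < h \<Longrightarrow> h \<le> 1 \<Longrightarrow>
        (\<integral>\<^sup>+w\<in>sector \<theta> h. pext lam w \<partial>\<tau>) \<le> ennreal (D * measure ?M (sector_arc \<theta> h))" by blast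
      show ?iii unfolding mass
      proof (intro exI allI impI)
        fix \<theta> h :: real assume "0 < h \<and> h \<le> 1"
        then show "(\<integral>\<^sup>+w\<in>sector \<theta> h. pext lam w \<partial>\<tau>) / ennreal (measure ?M (sector_arc \<theta> h)) < ennreal (max D 0 + 1)"
          using D by (intro ennreal_div_less_if_le) (auto simp flip: ennreal_mult)
      qed
    qed
    \<comment> \<open>These bounds allow the division by \<open>pext \<mu> z\<close> to be cleared.
      The kernel is bounded and strictly positive on the circle, so a zero integral would contradict
      the positive mass of \<open>circle_disc 0 1\<close>.\<close>
    have pext_pos_fin: "pext \<mu> z \<noteq> 0" "pext \<mu> z \<noteq> top" if z: "z \<in> ball 0 1" for z
    proof -
      have z': "cmod z < 1" using z by simp
      have eq: "pext \<mu> z = (\<integral>\<^sup>+\<zeta>. ennreal (poisson z \<zeta>) \<partial>?M)"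
        using pair(2) z' by (intro pext_eq_weight_measure) (auto elim!: eventually_mono)
      have "integrable ?M (poisson z)"
        by (intro integrable_poisson M.finite_measure_axioms M_sphere z') simp
      then have "pext \<mu> z = ennreal (\<integral>\<zeta>. poisson z \<zeta> \<partial>?M)"
        unfolding eq using z' by (intro nn_integral_eq_integral) (auto simp: poisson_nonneg)
      then show "pext \<mu> z \<noteq> top" by simp
      show "pext \<mu> z \<noteq> 0"
      proof
        assume "pext \<mu> z = 0"
        then have "AE \<zeta> in ?M. ennreal (poisson z \<zeta>) = 0"
          unfolding eq by (subst (asm) nn_integral_0_iff_AE) auto
        with M_sphere have "AE \<zeta> in ?M. \<zeta> \<notin> circle_disc 0 1"
        proof eventually_elim
          fix \<zeta> assume "cmod \<zeta> = 1" "ennreal (poisson z \<zeta>) = 0"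
          with poisson_pos [OF z, of \<zeta>] show "\<zeta> \<notin> circle_disc 0 1" by (simp add: ennreal_eq_0_iff)
        qed
        then have "emeasure ?M (circle_disc 0 1) = 0"
          by (subst (asm) AE_iff_measurable [OF _ refl]) auto
        with circle_disc_pos [of 1 0] show False by (simp add: measure_def)
      qed
    qed
    have i_iii: "?iii'" if ?i
    proof -
      from that obtain B where B: "\<And>f. f \<in> borel_measurable borel \<Longrightarrow>
        (\<integral>\<^sup>+\<zeta>. ennreal ((cmod (f \<zeta>))^2 * \<mu> \<zeta>) \<partial>circle_measure) < \<infinity> \<Longrightarrow>
        (\<integral>\<^sup>+z\<in>ball 0 1. ennreal ((cmod (cpext f z))^2) * pext lam z \<partial>\<tau>)
          \<le> ennreal B * (\<integral>\<^sup>+\<zeta>. ennreal ((cmod (f \<zeta>))^2 * \<mu> \<zeta>) \<partial>circle_measure)" by blast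
      have "(\<integral>\<^sup>+z\<in>sector \<theta> h. pext lam z \<partial>\<tau>) \<le> ennreal (256 * pi\<^sup>2 * max B 0 * K * measure ?M (sector_arc \<theta> h))"
        if "0 < h" "h \<le> 1" for \<theta> h
      proof (rule embedding_imp_sector_carleson [OF refl meas(1) p \<tau> _ _ that])
        fix f :: "complex \<Rightarrow> complex"
        assume "f \<in> borel_measurable borel"
          "(\<integral>\<^sup>+\<zeta>. ennreal ((cmod (f \<zeta>))^2 * \<mu> \<zeta>) \<partial>circle_measure) < \<infinity>"
        then show "(\<integral>\<^sup>+z\<in>ball 0 1. ennreal ((cmod (cpext f z))^2) * pext lam z \<partial>\<tau>)
          \<le> ennreal (max B 0) * (\<integral>\<^sup>+\<zeta>. ennreal ((cmod (f \<zeta>))^2 * \<mu> \<zeta>) \<partial>circle_measure)"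
          by (intro order_trans [OF B] mult_right_mono ennreal_leI) auto
      qed simp
      then show ?thesis using K_pos by (intro exI [of _ "256 * pi\<^sup>2 * max B 0 * K"]) auto
    qed
    have ii_iii: "?iii'" if ?ii
    proof -
      from that obtain C where C: "\<And>z. z \<in> ball 0 1 \<Longrightarrow>
        (\<integral>\<^sup>+w\<in>ball 0 1. ennreal \<bar>poisson z w\<bar> * pext lam w \<partial>\<tau>) / pext \<mu> z < ennreal C" by blast
      have C': "(\<integral>\<^sup>+w\<in>ball 0 1. ennreal \<bar>poisson z w\<bar> * pext lam w \<partial>\<tau>) \<le> ennreal (max C 0) * pext \<mu> z"
        if "z \<in> ball 0 1" for z
        using that by (intro order_trans [OF ennreal_div_less_imp_le [OF C pext_pos_fin]] mult_right_mono ennreal_leI) auto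
      obtain D where "0 \<le> D" "\<And>\<theta> h. 0 < h \<Longrightarrow> h \<le> 1 \<Longrightarrow>
          (\<integral>\<^sup>+w\<in>sector \<theta> h. pext lam w \<partial>\<tau>) \<le> ennreal (D * measure ?M (sector_arc \<theta> h))"
        using poisson_test_imp_sector_carleson [OF refl pair(2) meas(1) p \<tau> max.cobounded2 C'] by metis
      then show ?thesis by blast
    qed
    have iii_i_ii: "?i \<and> ?ii" if ?iii'
    proof -
      from that obtain D where D: "0 \<le> D" "\<And>\<theta> h. 0 < h \<Longrightarrow> h \<le> 1 \<Longrightarrow>
          (\<integral>\<^sup>+w\<in>sector \<theta> h. pext lam w \<partial>\<tau>) \<le> ennreal (D * measure ?M (sector_arc \<theta> h))" by blast
      obtain D' where D': "0 < D'" "\<And>\<theta> \<rho>. 0 < \<rho> \<Longrightarrow>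
          emeasure (disc_density \<tau> (pext lam)) (circle_disc \<theta> \<rho>) \<le> ennreal (D' * measure ?M (circle_disc \<theta> \<rho>))"
        using sector_carleson_imp_disc_carleson [OF \<tau> p D(2) D(1)] by metis
      obtain C where C: "\<And>z. z \<in> ball 0 1 \<Longrightarrow>
          (\<integral>\<^sup>+w\<in>ball 0 1. ennreal \<bar>poisson z w\<bar> * pext lam w \<partial>\<tau>) \<le> ennreal C * pext \<mu> z"
        using disc_carleson_imp_poisson_test [OF refl pair(2) meas(1) p \<tau> D'] by metis
      have "?ii" using C pext_pos_fin by (intro exI [of _ "max C 0 + 1"] ballI ennreal_div_less_if_le) auto
      moreover have "?i"
        using disc_carleson_imp_embedding [OF refl refl pair(2) meas(1) p _ \<tau> D']
        by (intro exI [of _ "14745600 * K ^ 3 * D'"]) blast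
      ultimately show ?thesis by blast
    qed
    show ?thesis unfolding iii using i_iii ii_iii iii_i_ii by blast
  qed
  then show ?thesis by blast
qed

end
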